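(* An FIP extension $R\subset S$ of commutative rings is Boolean if and only if, for each $M\in\mathrm{MSupp}(S/R)$, one of the following conditions holds: (1) $R_M\subset S_M$ is a minimal extension. (2) There exist $U,T\in[R_M,S_M]$ such that $R_M\subset T$ is minimal ramified, $R_M\subset U$ is minimal decomposed and $[R_M,S_M]=\{R_M,T,U,S_M\}$. (3) $R_M\subset S_M$ is a Boolean t-closed extension (equivalently, $R_M\subset S_M$ is t-closed and $\kappa_R(M)\subset\kappa_S(N)$ is a Boolean field extension, where $N$ is the only maximal ideal of $S$ lying above $M$).
   Context: Rings are commutative with unit; $\subset$ denotes proper inclusion. For a ring extension $R\subseteq S$, $[R,S]$ is the set of all $R$-subalgebras of $S$, a complete lattice under inclusion, with infimum the intersection and supremum (product) the compositum. FIP means $[R,S]$ is finite. The extension is Boolean if the lattice $[R,S]$ is distributive and each $T\in[R,S]$ has a complement, i.e. some $T'\in[R,S]$ with $T\cap T'=R$ and $TT'=S$; a Boolean field extension is a field extension that is Boolean in this sense. An extension $R\subset S$ is minimal if $[R,S]=\{R,S\}$. $\mathrm{MSupp}(S/R)$ is the set of maximal ideals $M$ of $R$ with $(S/R)_M\neq0$; $S_M=S_{R\setminus M}$; for a prime ideal $P$ of a ring $A$, $\kappa_A(P)=A_P/PA_P$. For $R\subset T$ let $P:=(R:T)$ be the conductor. $R\subset T$ is minimal decomposed if $P\in\mathrm{Max}(R)$ and there exist $M_1,M_2\in\mathrm{Max}(T)$ with $P=M_1\cap M_2$ and the natural maps $R/P\to T/M_1$, $R/P\to T/M_2$ both isomorphisms.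 $R\subset T$ is minimal ramified if $P\in\mathrm{Max}(R)$ and there exists $M'\in\mathrm{Max}(T)$ with $M'^2\subseteq P\subset M'$, $[T/P:R/P]=2$ and the natural map $R/P\to T/M'$ an isomorphism. (Such extensions are minimal.) An extension $R\subseteq S$ is t-closed if the relations $b\in S$, $r\in R$, $b^2-rb\in R$, $b^3-rb^2\in R$ imply $b\in R$.
   Formalization: The equivalence inside (3) is stated only when some maximal ideal of S lies above M or R_M ⊂ S_M is not minimal; otherwise N need not exist (R a DVR, S its fraction field: Boolean and t-closed, but no maximal ideal of S lies above M). *)

theory Defs
  imports "HOL-Algebra.Algebra"
begin

text \<open>
  A ring extension \<open>R \<subseteq> S\<close> is given by a commutative ring \<open>S\<close> (a record) together with a
  subring \<open>R\<close> (a subset of its carrier); \<open>R\<close> as a ring in its own right is \<open>S\<lparr>carrier := R\<rparr>\<close>.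
\<close>

section \<open>The lattice of intermediate rings\<close>

definition interm :: "'a set \<Rightarrow> ('a, 'm) ring_scheme \<Rightarrow> 'a set set"
  where "interm R S = {T. subring T S \<and> R \<subseteq> T}"

definition compositum :: "('a, 'm) ring_scheme \<Rightarrow> 'a set \<Rightarrow> 'a set \<Rightarrow> 'a set"
  where "compositum S T U = generate_ring S (T \<union> U)"

definition FIP :: "'a set \<Rightarrow> ('a, 'm) ring_scheme \<Rightarrow> bool"
  where "FIP R S \<longleftrightarrow> finite (interm R S)"

definition distributive_ext :: "'a set \<Rightarrow> ('a, 'm) ring_scheme \<Rightarrow> bool"
  where "distributive_ext R S \<longleftrightarrow>
    (\<forall>T\<in>interm R S. \<forall>U\<in>interm R S. \<forall>V\<in>interm R S.
       T \<inter> compositum S U V = compositum S (T \<inter> U) (T \<inter> V))"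

definition boolean_ext :: "'a set \<Rightarrow> ('a, 'm) ring_scheme \<Rightarrow> bool"
  where "boolean_ext R S \<longleftrightarrow>
    distributive_ext R S \<and>
    (\<forall>T\<in>interm R S. \<exists>T'\<in>interm R S. T \<inter> T' = R \<and> compositum S T T' = carrier S)"

definition minimal_ext :: "'a set \<Rightarrow> ('a, 'm) ring_scheme \<Rightarrow> bool"
  where "minimal_ext R S \<longleftrightarrow> R \<subset> carrier S \<and> interm R S = {R, carrier S}"

definition t_closed :: "'a set \<Rightarrow> ('a, 'm) ring_scheme \<Rightarrow> bool"
  where "t_closed R S \<longleftrightarrow>
    (\<forall>b\<in>carrier S. \<forall>r\<in>R.
       b [^]\<^bsub>S\<^esub> (2::nat) \<ominus>\<^bsub>S\<^esub> r \<otimes>\<^bsub>S\<^esub> b \<in> R \<longrightarrow>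
       b [^]\<^bsub>S\<^esub> (3::nat) \<ominus>\<^bsub>S\<^esub> r \<otimes>\<^bsub>S\<^esub> b [^]\<^bsub>S\<^esub> (2::nat) \<in> R \<longrightarrow> b \<in> R)"

section \<open>Minimal decomposed and minimal ramified extensions\<close>

definition conductor :: "'a set \<Rightarrow> ('a, 'm) ring_scheme \<Rightarrow> 'a set"
  where "conductor R T = {x \<in> R. \<forall>t\<in>carrier T. x \<otimes>\<^bsub>T\<^esub> t \<in> R}"

text \<open>
  For an ideal \<open>P\<close> of \<open>R\<close> contained in an ideal \<open>Q\<close> of \<open>T\<close>, the natural map
  \<open>R/P \<rightarrow> T/Q\<close> sends the coset \<open>P + r\<close> to \<open>Q + (P + r) = Q + r\<close>.
\<close>

definition natural_iso :: "'a set \<Rightarrow> ('a, 'm) ring_scheme \<Rightarrow> 'a set \<Rightarrow> 'a set \<Rightarrow> bool"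
  where "natural_iso R T P Q \<longleftrightarrow>
    (\<lambda>c. Q <+>\<^bsub>T\<^esub> c) \<in> ring_iso (T\<lparr>carrier := R\<rparr> Quot P) (T Quot Q)"

definition minimal_decomposed :: "'a set \<Rightarrow> ('a, 'm) ring_scheme \<Rightarrow> bool"
  where "minimal_decomposed R T \<longleftrightarrow>
    (let P = conductor R T in
      R \<subset> carrier T \<and> maximalideal P (T\<lparr>carrier := R\<rparr>) \<and>
      (\<exists>M1 M2. maximalideal M1 T \<and> maximalideal M2 T \<and> P = M1 \<inter> M2 \<and>
         natural_iso R T P M1 \<and> natural_iso R T P M2))"

text \<open>
  The cosets \<open>P + r\<close> with \<open>r \<in> R\<close> are the same sets in \<open>R/P\<close> and in \<open>T/P\<close>, so the carrier of
  \<open>R/P\<close> is the subfield of \<open>T/P\<close> over which the dimension is taken.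
\<close>

definition minimal_ramified :: "'a set \<Rightarrow> ('a, 'm) ring_scheme \<Rightarrow> bool"
  where "minimal_ramified R T \<longleftrightarrow>
    (let P = conductor R T in
      R \<subset> carrier T \<and> maximalideal P (T\<lparr>carrier := R\<rparr>) \<and>
      (\<exists>M'. maximalideal M' T \<and> M' \<cdot>\<^bsub>T\<^esub> M' \<subseteq> P \<and> P \<subset> M' \<and>
         ring.dimension (T Quot P) 2 (carrier (T\<lparr>carrier := R\<rparr> Quot P)) (carrier (T Quot P)) \<and>
         natural_iso R T P M'))"

section \<open>Localization\<close>

text \<open>The fraction \<open>a/s\<close>, as an equivalence class of pairs, for a multiplicative subset \<open>D\<close> of \<open>A\<close>.\<close>

definition lfrac :: "('a, 'm) ring_scheme \<Rightarrow> 'a set \<Rightarrow> 'a \<Rightarrow> 'a \<Rightarrow> ('a \<times> 'a) set"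
  where "lfrac A D a s =
    {(b, t). b \<in> carrier A \<and> t \<in> D \<and> (\<exists>u\<in>D. u \<otimes>\<^bsub>A\<^esub> (t \<otimes>\<^bsub>A\<^esub> a) = u \<otimes>\<^bsub>A\<^esub> (s \<otimes>\<^bsub>A\<^esub> b))}"

definition loc_ring :: "('a, 'm) ring_scheme \<Rightarrow> 'a set \<Rightarrow> ('a \<times> 'a) set ring"
  where "loc_ring A D =
    \<lparr>carrier = {lfrac A D a s | a s. a \<in> carrier A \<and> s \<in> D},
     monoid.mult = (\<lambda>x y. \<Union>(a, s)\<in>x. \<Union>(b, t)\<in>y. lfrac A D (a \<otimes>\<^bsub>A\<^esub> b) (s \<otimes>\<^bsub>A\<^esub> t)),
     monoid.one = lfrac A D \<one>\<^bsub>A\<^esub> \<one>\<^bsub>A\<^esub>,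
     ring.zero = lfrac A D \<zero>\<^bsub>A\<^esub> \<one>\<^bsub>A\<^esub>,
     ring.add = (\<lambda>x y. \<Union>(a, s)\<in>x. \<Union>(b, t)\<in>y.
              lfrac A D ((t \<otimes>\<^bsub>A\<^esub> a) \<oplus>\<^bsub>A\<^esub> (s \<otimes>\<^bsub>A\<^esub> b)) (s \<otimes>\<^bsub>A\<^esub> t))\<rparr>"

text \<open>
  For a subring \<open>R\<close> of \<open>S\<close> and \<open>D \<subseteq> R\<close>, the localization of \<open>R\<close> at \<open>D\<close> embeds into that of \<open>S\<close>
  and is identified with its image, the set of fractions with numerator in \<open>R\<close>
  (see \<open>loc_sub_iso\<close> below).
\<close>

definition loc_sub :: "'a set \<Rightarrow> ('a, 'm) ring_scheme \<Rightarrow> 'a set \<Rightarrow> ('a \<times> 'a) set set"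
  where "loc_sub R S D = {lfrac S D r s | r s. r \<in> R \<and> s \<in> D}"

text \<open>The extension \<open>R\<^sub>M \<subseteq> S\<^sub>M\<close> at a prime ideal \<open>M\<close> of \<open>R\<close>.\<close>

abbreviation sub_at :: "'a set \<Rightarrow> ('a, 'm) ring_scheme \<Rightarrow> 'a set \<Rightarrow> ('a \<times> 'a) set set"
  where "sub_at R S M \<equiv> loc_sub R S (R - M)"

abbreviation ring_at :: "'a set \<Rightarrow> ('a, 'm) ring_scheme \<Rightarrow> 'a set \<Rightarrow> ('a \<times> 'a) set ring"
  where "ring_at R S M \<equiv> loc_ring S (R - M)"

subsection \<open>The localization is a ring, and the localized subring is a subring of it\<close>

locale localizing = cring A for A (structure) +
  fixes D
  assumes D_sub: "D \<subseteq> carrier A"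
    and D_one: "\<one> \<in> D"
    and D_mult: "\<lbrakk>s \<in> D; t \<in> D\<rbrakk> \<Longrightarrow> s \<otimes> t \<in> D"
begin

lemma D_carr [simp]: "s \<in> D \<Longrightarrow> s \<in> carrier A"
  using D_sub by blast

lemma lfrac_eqI:
  assumes "a \<in> carrier A" "b \<in> carrier A" "s \<in> D" "t \<in> D" "u \<in> D"
    and eq: "u \<otimes> (t \<otimes> a) = u \<otimes> (s \<otimes> b)"
  shows "lfrac A D a s = lfrac A D b t"
proof -
  have sub: "lfrac A D a s \<subseteq> lfrac A D b t"
    if as: "a \<in> carrier A" "b \<in> carrier A" "s \<in> D" "t \<in> D" "u \<in> D"
      and eq: "u \<otimes> (t \<otimes> a) = u \<otimes> (s \<otimes> b)" for a b s t u
  proof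
    fix p assume "p \<in> lfrac A D a s"
    then obtain c r v where p: "p = (c, r)" "c \<in> carrier A" "r \<in> D" "v \<in> D"
      and e: "v \<otimes> (r \<otimes> a) = v \<otimes> (s \<otimes> c)"
      unfolding lfrac_def by auto
    have "(s \<otimes> u \<otimes> v) \<otimes> (r \<otimes> b) = (v \<otimes> r) \<otimes> (u \<otimes> (s \<otimes> b))"
      using as p by (simp add: m_ac)
    also have "\<dots> = (u \<otimes> t) \<otimes> (v \<otimes> (r \<otimes> a))"
      unfolding eq[symmetric] using as p by (simp add: m_ac)
    also have "\<dots> = (s \<otimes> u \<otimes> v) \<otimes> (t \<otimes> c)"
      unfolding e using as p by (simp add: m_ac)
    finally show "p \<in> lfrac A D b t"
      unfolding lfrac_def using p as by (auto intro!: bexI[of _ "s \<otimes> u \<otimes> v"] D_mult)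
  qed
  show ?thesis
    using sub[OF assms(1-5) eq] sub[OF assms(2,1,4,3,5) eq[symmetric]] by blast
qed

lemma lfrac_self: "\<lbrakk>a \<in> carrier A; s \<in> D\<rbrakk> \<Longrightarrow> (a, s) \<in> lfrac A D a s"
  unfolding lfrac_def using D_one by auto

lemma lfrac_eq_iff:
  assumes "a \<in> carrier A" "b \<in> carrier A" "s \<in> D" "t \<in> D"
  shows "lfrac A D a s = lfrac A D b t \<longleftrightarrow> (\<exists>u\<in>D. u \<otimes> (t \<otimes> a) = u \<otimes> (s \<otimes> b))"
proof
  assume "lfrac A D a s = lfrac A D b t"
  then have "(b, t) \<in> lfrac A D a s" using lfrac_self assms by blast
  then show "\<exists>u\<in>D. u \<otimes> (t \<otimes> a) = u \<otimes> (s \<otimes> b)" unfolding lfrac_def by auto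
next
  assume "\<exists>u\<in>D. u \<otimes> (t \<otimes> a) = u \<otimes> (s \<otimes> b)"
  then obtain u where "u \<in> D" "u \<otimes> (t \<otimes> a) = u \<otimes> (s \<otimes> b)" by blast
  then show "lfrac A D a s = lfrac A D b t" by (rule lfrac_eqI[OF assms])
qed

lemma lfrac_memD:
  assumes "(b, t) \<in> lfrac A D a s" "a \<in> carrier A" "s \<in> D"
  shows "b \<in> carrier A \<and> t \<in> D \<and> lfrac A D b t = lfrac A D a s"
proof -
  have "b \<in> carrier A" "t \<in> D" "\<exists>u\<in>D. u \<otimes> (t \<otimes> a) = u \<otimes> (s \<otimes> b)"
    using assms(1) unfolding lfrac_def by auto
  then show ?thesis using lfrac_eq_iff[of a b s t] assms(2,3) by simp
qed

lemma lfrac_UN: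
  assumes "a \<in> carrier A" "b \<in> carrier A" "s \<in> D" "t \<in> D"
    and F: "\<And>a' b' s' t'. \<lbrakk>a' \<in> carrier A; b' \<in> carrier A; s' \<in> D; t' \<in> D;
        lfrac A D a' s' = lfrac A D a s; lfrac A D b' t' = lfrac A D b t\<rbrakk> \<Longrightarrow>
        F a' s' b' t' = F a s b t"
  shows "(\<Union>(a', s')\<in>lfrac A D a s. \<Union>(b', t')\<in>lfrac A D b t. F a' s' b' t') = F a s b t"
proof -
  have "F a' s' b' t' = F a s b t"
    if p: "(a', s') \<in> lfrac A D a s" and q: "(b', t') \<in> lfrac A D b t" for a' s' b' t'
    using lfrac_memD[OF p assms(1,3)] lfrac_memD[OF q assms(2,4)] by (intro F) simp_all
  then have "(\<Union>(b', t')\<in>lfrac A D b t. F a' s' b' t') = F a s b t"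
    if "(a', s') \<in> lfrac A D a s" for a' s'
    using that lfrac_self[OF assms(2,4)] by (intro SUP_eq_const) auto
  then show ?thesis
    using lfrac_self[OF assms(1,3)] by (intro SUP_eq_const) auto
qed

lemma loc_mult [simp]:
  assumes "a \<in> carrier A" "b \<in> carrier A" "s \<in> D" "t \<in> D"
  shows "lfrac A D a s \<otimes>\<^bsub>loc_ring A D\<^esub> lfrac A D b t = lfrac A D (a \<otimes> b) (s \<otimes> t)"
proof -
  have "lfrac A D (a' \<otimes> b') (s' \<otimes> t') = lfrac A D (a \<otimes> b) (s \<otimes> t)"
    if as: "a' \<in> carrier A" "b' \<in> carrier A" "s' \<in> D" "t' \<in> D"
      and 1: "lfrac A D a' s' = lfrac A D a s" and 2: "lfrac A D b' t' = lfrac A D b t"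
    for a' b' s' t'
  proof -
    obtain u where u: "u \<in> D" "u \<otimes> (s \<otimes> a') = u \<otimes> (s' \<otimes> a)"
      using 1 lfrac_eq_iff assms as by auto
    obtain v where v: "v \<in> D" "v \<otimes> (t \<otimes> b') = v \<otimes> (t' \<otimes> b)"
      using 2 lfrac_eq_iff assms as by auto
    have "(u \<otimes> v) \<otimes> ((s \<otimes> t) \<otimes> (a' \<otimes> b')) = (u \<otimes> (s \<otimes> a')) \<otimes> (v \<otimes> (t \<otimes> b'))"
      using assms as u(1) v(1) by (simp add: m_ac)
    also have "\<dots> = (u \<otimes> v) \<otimes> ((s' \<otimes> t') \<otimes> (a \<otimes> b))"
      unfolding u(2) v(2) using assms as u(1) v(1) by (simp add: m_ac)
    finally show ?thesis
      using assms as u(1) v(1) by (intro lfrac_eqI[of _ _ _ _ "u \<otimes> v"]) (auto intro: D_mult)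
  qed
  then show ?thesis
    using lfrac_UN[OF assms, of "\<lambda>a s b t. lfrac A D (a \<otimes> b) (s \<otimes> t)"]
    unfolding loc_ring_def by simp
qed

lemma loc_add [simp]:
  assumes "a \<in> carrier A" "b \<in> carrier A" "s \<in> D" "t \<in> D"
  shows "lfrac A D a s \<oplus>\<^bsub>loc_ring A D\<^esub> lfrac A D b t = lfrac A D (t \<otimes> a \<oplus> s \<otimes> b) (s \<otimes> t)"
proof -
  have "lfrac A D (t' \<otimes> a' \<oplus> s' \<otimes> b') (s' \<otimes> t') = lfrac A D (t \<otimes> a \<oplus> s \<otimes> b) (s \<otimes> t)"
    if as: "a' \<in> carrier A" "b' \<in> carrier A" "s' \<in> D" "t' \<in> D"
      and 1: "lfrac A D a' s' = lfrac A D a s" and 2: "lfrac A D b' t' = lfrac A D b t"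
    for a' b' s' t'
  proof -
    obtain u where u: "u \<in> D" "u \<otimes> (s \<otimes> a') = u \<otimes> (s' \<otimes> a)"
      using 1 lfrac_eq_iff assms as by auto
    obtain v where v: "v \<in> D" "v \<otimes> (t \<otimes> b') = v \<otimes> (t' \<otimes> b)"
      using 2 lfrac_eq_iff assms as by auto
    have "(u \<otimes> v) \<otimes> ((s \<otimes> t) \<otimes> (t' \<otimes> a' \<oplus> s' \<otimes> b')) =
        (v \<otimes> t \<otimes> t') \<otimes> (u \<otimes> (s \<otimes> a')) \<oplus> (u \<otimes> s \<otimes> s') \<otimes> (v \<otimes> (t \<otimes> b'))"
      using assms as u(1) v(1) by (simp add: m_ac r_distr)
    also have "\<dots> = (u \<otimes> v) \<otimes> ((s' \<otimes> t') \<otimes> (t \<otimes> a \<oplus> s \<otimes> b))"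
      unfolding u(2) v(2) using assms as u(1) v(1) by (simp add: m_ac r_distr)
    finally show ?thesis
      using assms as u(1) v(1) by (intro lfrac_eqI[of _ _ _ _ "u \<otimes> v"]) (auto intro: D_mult)
  qed
  then show ?thesis
    using lfrac_UN[OF assms, of "\<lambda>a s b t. lfrac A D (t \<otimes> a \<oplus> s \<otimes> b) (s \<otimes> t)"]
    unfolding loc_ring_def by simp
qed

lemma loc_one: "\<one>\<^bsub>loc_ring A D\<^esub> = lfrac A D \<one> \<one>"
  and loc_zero: "\<zero>\<^bsub>loc_ring A D\<^esub> = lfrac A D \<zero> \<one>"
  by (simp_all add: loc_ring_def)

lemma loc_carrierE:
  assumes "x \<in> carrier (loc_ring A D)"
  obtains a s where "a \<in> carrier A" "s \<in> D" "x = lfrac A D a s"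
  using assms unfolding loc_ring_def by auto

lemma loc_carrierI [simp]: "a \<in> carrier A \<Longrightarrow> s \<in> D \<Longrightarrow> lfrac A D a s \<in> carrier (loc_ring A D)"
  unfolding loc_ring_def by auto

lemma lfrac_cong:
  assumes "a \<in> carrier A" "b \<in> carrier A" "s \<in> D" "t \<in> D" "t \<otimes> a = s \<otimes> b"
  shows "lfrac A D a s = lfrac A D b t"
  using lfrac_eqI[OF assms(1-4) D_one] assms(5) by simp

lemma loc_minus:
  assumes "a \<in> carrier A" "s \<in> D"
  shows "lfrac A D (\<ominus> a) s \<oplus>\<^bsub>loc_ring A D\<^esub> lfrac A D a s = \<zero>\<^bsub>loc_ring A D\<^esub>"
proof -
  have "lfrac A D (s \<otimes> \<ominus> a \<oplus> s \<otimes> a) (s \<otimes> s) = lfrac A D \<zero> \<one>"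
    by (rule lfrac_cong) (use assms in \<open>simp_all add: D_one D_mult r_minus l_neg\<close>)
  then show ?thesis using assms by (simp add: loc_zero)
qed

lemma loc_ring_cring: "cring (loc_ring A D)"
proof (intro cringI abelian_groupI comm_monoidI)
  fix x y assume xy: "x \<in> carrier (loc_ring A D)" "y \<in> carrier (loc_ring A D)"
  from xy show "x \<oplus>\<^bsub>loc_ring A D\<^esub> y \<in> carrier (loc_ring A D)"
    "x \<otimes>\<^bsub>loc_ring A D\<^esub> y \<in> carrier (loc_ring A D)"
    by (auto elim!: loc_carrierE intro!: loc_carrierI D_mult)
  from xy show "x \<oplus>\<^bsub>loc_ring A D\<^esub> y = y \<oplus>\<^bsub>loc_ring A D\<^esub> x"
    "x \<otimes>\<^bsub>loc_ring A D\<^esub> y = y \<otimes>\<^bsub>loc_ring A D\<^esub> x"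
    by (auto elim!: loc_carrierE intro!: lfrac_cong D_mult simp: m_ac a_ac)
  from xy show "\<exists>y\<in>carrier (loc_ring A D). y \<oplus>\<^bsub>loc_ring A D\<^esub> x = \<zero>\<^bsub>loc_ring A D\<^esub>"
    by (metis loc_carrierE loc_carrierI loc_minus a_inv_closed)
next
  fix x y z
  assume "x \<in> carrier (loc_ring A D)" "y \<in> carrier (loc_ring A D)" "z \<in> carrier (loc_ring A D)"
  then show "x \<oplus>\<^bsub>loc_ring A D\<^esub> y \<oplus>\<^bsub>loc_ring A D\<^esub> z = x \<oplus>\<^bsub>loc_ring A D\<^esub> (y \<oplus>\<^bsub>loc_ring A D\<^esub> z)"
    "x \<otimes>\<^bsub>loc_ring A D\<^esub> y \<otimes>\<^bsub>loc_ring A D\<^esub> z = x \<otimes>\<^bsub>loc_ring A D\<^esub> (y \<otimes>\<^bsub>loc_ring A D\<^esub> z)"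
    by (auto elim!: loc_carrierE intro!: lfrac_cong D_mult simp: D_mult r_distr l_distr m_ac a_ac)
next
  fix x y z
  assume xyz: "x \<in> carrier (loc_ring A D)" "y \<in> carrier (loc_ring A D)" "z \<in> carrier (loc_ring A D)"
  obtain a s b t c u where *: "x = lfrac A D a s" "y = lfrac A D b t" "z = lfrac A D c u"
    "a \<in> carrier A" "b \<in> carrier A" "c \<in> carrier A" "s \<in> D" "t \<in> D" "u \<in> D"
    using xyz by (metis loc_carrierE)
  have "lfrac A D ((t \<otimes> a \<oplus> s \<otimes> b) \<otimes> c) (s \<otimes> t \<otimes> u) =
      lfrac A D (t \<otimes> u \<otimes> (a \<otimes> c) \<oplus> s \<otimes> u \<otimes> (b \<otimes> c)) (s \<otimes> u \<otimes> (t \<otimes> u))"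
    by (rule lfrac_cong) (use * in \<open>simp_all add: D_mult r_distr l_distr m_ac\<close>)
  then show "(x \<oplus>\<^bsub>loc_ring A D\<^esub> y) \<otimes>\<^bsub>loc_ring A D\<^esub> z =
       x \<otimes>\<^bsub>loc_ring A D\<^esub> z \<oplus>\<^bsub>loc_ring A D\<^esub> y \<otimes>\<^bsub>loc_ring A D\<^esub> z"
    using * by (simp add: D_mult)
next
  fix x assume x: "x \<in> carrier (loc_ring A D)"
  then show "\<zero>\<^bsub>loc_ring A D\<^esub> \<oplus>\<^bsub>loc_ring A D\<^esub> x = x" "\<one>\<^bsub>loc_ring A D\<^esub> \<otimes>\<^bsub>loc_ring A D\<^esub> x = x"
    by (auto elim!: loc_carrierE simp: loc_zero loc_one D_one)
qed (auto simp: loc_zero loc_one D_one)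

lemma loc_a_inv:
  assumes "a \<in> carrier A" "s \<in> D"
  shows "\<ominus>\<^bsub>loc_ring A D\<^esub> lfrac A D a s = lfrac A D (\<ominus> a) s"
proof -
  interpret L: cring "loc_ring A D" by (rule loc_ring_cring)
  show ?thesis using assms loc_minus by (intro L.minus_equality) auto
qed

lemma loc_sub_subring:
  assumes "subring R A" "D \<subseteq> R"
  shows "subring (loc_sub R A D) (loc_ring A D)"
proof -
  interpret L: cring "loc_ring A D" by (rule loc_ring_cring)
  note R = subringE[OF assms(1)]
  have DR: "s \<in> D \<Longrightarrow> s \<in> R" for s using assms(2) by blast
  have Rc: "r \<in> R \<Longrightarrow> r \<in> carrier A" for r using R(1) by blast
  have I: "r \<in> R \<Longrightarrow> s \<in> D \<Longrightarrow> lfrac A D r s \<in> loc_sub R A D" for r s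
    unfolding loc_sub_def by auto
  have E: "\<exists>r s. x = lfrac A D r s \<and> r \<in> R \<and> s \<in> D" if "x \<in> loc_sub R A D" for x
    using that unfolding loc_sub_def by auto
  show ?thesis
  proof (rule L.subringI)
    show "loc_sub R A D \<subseteq> carrier (loc_ring A D)"
      using E Rc by fastforce
    show "\<one>\<^bsub>loc_ring A D\<^esub> \<in> loc_sub R A D"
      using I R(3) D_one by (simp add: loc_one)
    show "\<ominus>\<^bsub>loc_ring A D\<^esub> x \<in> loc_sub R A D" if "x \<in> loc_sub R A D" for x
      using E[OF that] Rc I R(5) by (auto simp: loc_a_inv)
    show "x \<otimes>\<^bsub>loc_ring A D\<^esub> y \<in> loc_sub R A D" "x \<oplus>\<^bsub>loc_ring A D\<^esub> y \<in> loc_sub R A D"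
      if "x \<in> loc_sub R A D" "y \<in> loc_sub R A D" for x y
      using E[OF that(1)] E[OF that(2)] by (auto simp: Rc D_mult DR intro!: I R(6,7))
  qed
qed

lemma loc_sub_iso:
  assumes "subring R A" "D \<subseteq> R"
  shows "\<exists>h\<in>ring_iso (loc_ring (A\<lparr>carrier := R\<rparr>) D) (loc_ring A D\<lparr>carrier := loc_sub R A D\<rparr>).
           \<forall>r\<in>R. \<forall>s\<in>D. h (lfrac (A\<lparr>carrier := R\<rparr>) D r s) = lfrac A D r s"
proof -
  let ?R = "A\<lparr>carrier := R\<rparr>" and ?L = "loc_ring A D\<lparr>carrier := loc_sub R A D\<rparr>"
  have "cring ?R"
    using subcringI'[OF assms(1)] subcring_iff[OF subringE(1)[OF assms(1)]] by blast
  then interpret R: localizing ?R D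
    using assms(2) D_one D_mult by (simp add: localizing_def localizing_axioms_def)
  note RE = subringE[OF assms(1)]
  have Rc: "r \<in> R \<Longrightarrow> r \<in> carrier A" for r using RE(1) by blast
  define h where "h = (\<lambda>x. \<Union>(r, s)\<in>x. lfrac A D r s)"
  have h: "h (lfrac ?R D r s) = lfrac A D r s" if rs: "r \<in> R" "s \<in> D" for r s
  proof -
    have "lfrac A D r' s' = lfrac A D r s" if "(r', s') \<in> lfrac ?R D r s" for r' s'
      using R.lfrac_memD[OF that] R.lfrac_eq_iff[of r' r s' s] lfrac_eq_iff[of r' r s' s] rs Rc
      by auto
    then have "(case p of (r', s') \<Rightarrow> lfrac A D r' s') = lfrac A D r s"
      if "p \<in> lfrac ?R D r s" for p
      using that by (cases p) blast
    then have "h (lfrac ?R D r s) = (\<Union>p\<in>lfrac ?R D r s. lfrac A D r s)"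
      unfolding h_def by (intro SUP_cong refl)
    moreover have "(r, s) \<in> lfrac ?R D r s"
      using R.lfrac_self rs by simp
    ultimately show ?thesis by blast
  qed
  have c: "carrier (loc_ring ?R D) = {lfrac ?R D r s | r s. r \<in> R \<and> s \<in> D}"
    unfolding loc_ring_def by simp
  have D: "s \<in> D \<Longrightarrow> s \<in> R" for s using assms(2) by blast
  have I: "r \<in> R \<Longrightarrow> s \<in> D \<Longrightarrow> lfrac A D r s \<in> loc_sub R A D" for r s
    unfolding loc_sub_def by blast
  have "h \<in> ring_hom (loc_ring ?R D) ?L"
  proof (rule ring_hom_memI)
    fix x assume x: "x \<in> carrier (loc_ring ?R D)"
    then show "h x \<in> carrier ?L" unfolding c by (auto simp: h I)
    fix y assume y: "y \<in> carrier (loc_ring ?R D)"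
    obtain a s b t where ab: "x = lfrac ?R D a s" "y = lfrac ?R D b t"
      "a \<in> R" "b \<in> R" "s \<in> D" "t \<in> D"
      using x y unfolding c by auto
    show "h (x \<otimes>\<^bsub>loc_ring ?R D\<^esub> y) = h x \<otimes>\<^bsub>?L\<^esub> h y"
      using ab R.loc_mult[of a b s t] by (simp add: h Rc RE(6) D_mult)
    show "h (x \<oplus>\<^bsub>loc_ring ?R D\<^esub> y) = h x \<oplus>\<^bsub>?L\<^esub> h y"
      using ab R.loc_add[of a b s t] by (simp add: h Rc RE(6,7) D D_mult)
  next
    show "h \<one>\<^bsub>loc_ring ?R D\<^esub> = \<one>\<^bsub>?L\<^esub>"
      using R.loc_one h[OF RE(3) D_one] by (simp add: loc_one)
  qed
  moreover have "bij_betw h (carrier (loc_ring ?R D)) (carrier ?L)"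
  proof (rule bij_betwI')
    fix x y assume xy: "x \<in> carrier (loc_ring ?R D)" "y \<in> carrier (loc_ring ?R D)"
    obtain a s b t where "x = lfrac ?R D a s" "y = lfrac ?R D b t"
      "a \<in> R" "b \<in> R" "s \<in> D" "t \<in> D"
      using xy unfolding c by auto
    then show "(h x = h y) = (x = y)"
      using R.lfrac_eq_iff[of a b s t] lfrac_eq_iff[of a b s t] by (simp add: h Rc)
  next
    show "h x \<in> carrier ?L" if "x \<in> carrier (loc_ring ?R D)" for x
      using that unfolding c by (auto simp: h I)
    show "\<exists>x\<in>carrier (loc_ring ?R D). y = h x" if y: "y \<in> carrier ?L" for y
    proof -
      obtain r s where "y = lfrac A D r s" "r \<in> R" "s \<in> D"
        using y by (auto simp: loc_sub_def)
      then have "lfrac ?R D r s \<in> carrier (loc_ring ?R D)" "y = h (lfrac ?R D r s)"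
        by (simp_all add: h)
      then show ?thesis by blast
    qed
  qed
  ultimately show ?thesis using h unfolding ring_iso_def by blast
qed

end

section \<open>The support of the module \<open>S/R\<close>\<close>

text \<open>The ring-valued fields \<open>mult\<close> and \<open>one\<close> of a module record play no role for modules.\<close>

definition quot_module :: "'a set \<Rightarrow> ('a, 'm) ring_scheme \<Rightarrow> ('a, 'a set) module"
  where "quot_module R S =
    \<lparr>carrier = a_rcosets\<^bsub>S\<^esub> R, monoid.mult = undefined, monoid.one = undefined,
     ring.zero = R, ring.add = set_add S,
     smult = (\<lambda>r c. \<Union>x\<in>c. R +>\<^bsub>S\<^esub> (r \<otimes>\<^bsub>S\<^esub> x))\<rparr>"

definition mfrac :: "('a, 'b, 'm) module_scheme \<Rightarrow> 'a set \<Rightarrow> 'b \<Rightarrow> 'a \<Rightarrow> ('b \<times> 'a) set"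
  where "mfrac N D m s =
    {(n, t). n \<in> carrier N \<and> t \<in> D \<and> (\<exists>u\<in>D. u \<odot>\<^bsub>N\<^esub> (t \<odot>\<^bsub>N\<^esub> m) = u \<odot>\<^bsub>N\<^esub> (s \<odot>\<^bsub>N\<^esub> n))}"

definition loc_module ::
    "('a, 'k) ring_scheme \<Rightarrow> 'a set \<Rightarrow> ('a, 'b, 'm) module_scheme \<Rightarrow>
      (('a \<times> 'a) set, ('b \<times> 'a) set) module"
  where "loc_module A D N =
    \<lparr>carrier = {mfrac N D m s | m s. m \<in> carrier N \<and> s \<in> D}, monoid.mult = undefined, monoid.one = undefined,
     ring.zero = mfrac N D \<zero>\<^bsub>N\<^esub> \<one>\<^bsub>A\<^esub>,
     ring.add = (\<lambda>x y. \<Union>(m, s)\<in>x. \<Union>(n, t)\<in>y.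
              mfrac N D ((t \<odot>\<^bsub>N\<^esub> m) \<oplus>\<^bsub>N\<^esub> (s \<odot>\<^bsub>N\<^esub> n)) (s \<otimes>\<^bsub>A\<^esub> t)),
     smult = (\<lambda>x y. \<Union>(a, s)\<in>x. \<Union>(m, t)\<in>y. mfrac N D (a \<odot>\<^bsub>N\<^esub> m) (s \<otimes>\<^bsub>A\<^esub> t))\<rparr>"

definition MSupp :: "'a set \<Rightarrow> ('a, 'm) ring_scheme \<Rightarrow> 'a set set"
  where "MSupp R S =
    {M. maximalideal M (S\<lparr>carrier := R\<rparr>) \<and>
        (let Q = loc_module (S\<lparr>carrier := R\<rparr>) (R - M) (quot_module R S)
         in carrier Q \<noteq> {\<zero>\<^bsub>Q\<^esub>})}"

section \<open>Residue fields\<close>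

definition loc_ideal :: "('a, 'm) ring_scheme \<Rightarrow> 'a set \<Rightarrow> ('a \<times> 'a) set set"
  where "loc_ideal A P =
    Idl\<^bsub>loc_ring A (carrier A - P)\<^esub> ((\<lambda>p. lfrac A (carrier A - P) p \<one>\<^bsub>A\<^esub>) ` P)"

definition kappa :: "('a, 'm) ring_scheme \<Rightarrow> 'a set \<Rightarrow> ('a \<times> 'a) set set ring"
  where "kappa A P = loc_ring A (carrier A - P) Quot loc_ideal A P"

text \<open>
  If \<open>N\<close> lies above \<open>M\<close>, the field \<open>\<kappa>\<^sub>R(M)\<close> embeds into \<open>\<kappa>\<^sub>S(N)\<close> by sending the residue class of
  \<open>r/s\<close> in \<open>R\<^sub>M\<close> to the residue class of \<open>r/s\<close> in \<open>S\<^sub>N\<close>; the following is its image.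
\<close>

definition kappa_sub :: "'a set \<Rightarrow> ('a, 'm) ring_scheme \<Rightarrow> 'a set \<Rightarrow> 'a set \<Rightarrow> ('a \<times> 'a) set set set"
  where "kappa_sub R S M N =
    {loc_ideal S N +>\<^bsub>loc_ring S (carrier S - N)\<^esub> lfrac S (carrier S - N) r s | r s.
       r \<in> R \<and> s \<in> R - M}"

definition Max_above :: "'a set \<Rightarrow> ('a, 'm) ring_scheme \<Rightarrow> 'a set \<Rightarrow> 'a set set"
  where "Max_above R S M = {N. maximalideal N S \<and> N \<inter> R = M}"

end

(*
  Localization maps [R,S] onto [R_M,S_M] as lattices. A finite distributive lattice is Boolean unless
  it has an interval that is a chain K < W < V; if all localizations are Boolean, the supports of
  W/K and V/W are disjoint, and a partition of unity in R contradicts such a chain. So being Boolean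
  is a local property.

  Over a local ring (A,m), an atom C of [A,B] satisfies mC <= m, or all elements of C outside A are
  inverses of elements of m. If A <= B is not t-closed, there is an atom A[x] with x^2 or x^2 - x in m;
  then mD <= m for every atom D. In a distributive lattice two atoms C, D generate only
  {A, C, D, CD}, and rings such as A[x+y] and A[xy] with x in C and y in D show that of two distinct
  atoms one is ramified and the other decomposed. Hence B is an atom or [A,B] has four elements.

  If A <= B is t-closed and mC <= m for some ring C in [A,B], then the elements of C outside m are
  units. Unless some element of m becomes invertible in B, this gives mB <= m, the field B/m is the
  residue field at the only N above M, and [A,B] is isomorphic to the lattice of rings between the
  residue fields.
*)
theory Submission
  imports Defs
begin

section \<open>The lattice of intermediate rings\<close>

text \<open>Suprema in the lattice are generated rings, whose elements have no normal form.
  Distributivity is therefore exploited through test rings with an explicit carrier, such as A + A z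
  or A + x D: being in such a ring is an equation with coefficients in A, where every coefficient is
  a unit or lies in m, and units can be cancelled. The condition m C <= m matters because m is then
  an ideal of C, so that C behaves like an algebra over the field A/m; the computations are made in
  C up to elements of m, mostly without forming quotients. The detour through chains has this
  reason: the distributive law is an equality of intermediate rings and can be checked at each M,
  whereas complements found at different M need not come from one ring of [R,S].\<close>

lemma intermD: "T \<in> interm A S \<Longrightarrow> subring T S" "T \<in> interm A S \<Longrightarrow> A \<subseteq> T"
  "T \<in> interm A S \<Longrightarrow> T \<subseteq> carrier S"
  by (auto simp: interm_def dest: subringE(1))

lemma intermI: "subring T S \<Longrightarrow> A \<subseteq> T \<Longrightarrow> T \<in> interm A S"
  by (simp add: interm_def)

lemma finite_set_minimal:
  assumes "finite F" "Y \<in> F"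
  shows "\<exists>C. C \<in> F \<and> (\<forall>U. U \<in> F \<longrightarrow> U \<subseteq> C \<longrightarrow> U = C)"
  using finite_has_minimal[of F] assms by blast

lemma finite_set_maximal:
  assumes "finite F" "Y \<in> F"
  shows "\<exists>C. C \<in> F \<and> (\<forall>U. U \<in> F \<longrightarrow> C \<subseteq> U \<longrightarrow> U = C)"
  using finite_has_maximal[of F] assms by blast

definition atom_over :: "'a set \<Rightarrow> ('a, 'm) ring_scheme \<Rightarrow> 'a set \<Rightarrow> bool"
  where "atom_over A S C \<longleftrightarrow> C \<in> interm A S \<and> C \<noteq> A \<and> (\<forall>T\<in>interm A S. T \<subseteq> C \<longrightarrow> T = A \<or> T = C)"

lemma atom_overD:
  assumes "atom_over A S C"
  shows "C \<in> interm A S" "C \<noteq> A" "A \<subseteq> C" "T \<in> interm A S \<Longrightarrow> T \<subseteq> C \<Longrightarrow> T \<noteq> A \<Longrightarrow> T = C"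
  using assms by (auto simp: atom_over_def interm_def)

locale ambient_ring = cring S for S (structure)
begin

lemma interm_Int: "T \<in> interm A S \<Longrightarrow> U \<in> interm A S \<Longrightarrow> T \<inter> U \<in> interm A S"
  by (simp add: interm_def subring_inter)

lemma interm_base: "subring A S \<Longrightarrow> A \<in> interm A S"
  by (simp add: interm_def)

lemma interm_top: "subring A S \<Longrightarrow> carrier S \<in> interm A S"
  by (simp add: interm_def carrier_is_subring subringE(1))

lemma compositum_upper1: "T \<subseteq> compositum S T U"
  and compositum_upper2: "U \<subseteq> compositum S T U"
  by (auto simp: compositum_def intro: generate_ring.incl)

lemma compositum_least: "T \<subseteq> V \<Longrightarrow> U \<subseteq> V \<Longrightarrow> subring V S \<Longrightarrow> compositum S T U \<subseteq> V"
  unfolding compositum_def by (rule generate_ring_min_subring1) (auto dest: subringE(1))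

lemma compositum_interm:
  "T \<in> interm A S \<Longrightarrow> U \<in> interm A S \<Longrightarrow> compositum S T U \<in> interm A S"
  using compositum_upper1[of T U] generate_ring_is_subring[of "T \<union> U"]
  unfolding interm_def by (auto simp: compositum_def dest: subringE(1))

lemma compositum_eqI:
  assumes "T \<subseteq> W" "U \<subseteq> W" "subring W S" "\<And>V. subring V S \<Longrightarrow> T \<subseteq> V \<Longrightarrow> U \<subseteq> V \<Longrightarrow> W \<subseteq> V"
  shows "compositum S T U = W"
proof
  show "compositum S T U \<subseteq> W" by (rule compositum_least) (use assms in auto)
  have "T \<union> U \<subseteq> carrier S" using assms(1,2,3) by (auto dest: subringE(1))
  then have "subring (compositum S T U) S"
    unfolding compositum_def by (rule generate_ring_is_subring)
  then show "W \<subseteq> compositum S T U"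
    using assms(4) compositum_upper1 compositum_upper2 by blast
qed

lemma compositum_absorb: "T \<subseteq> U \<Longrightarrow> subring U S \<Longrightarrow> compositum S T U = U"
  by (rule compositum_eqI) auto

lemma compositum_commute: "compositum S T U = compositum S U T"
  by (simp add: compositum_def Un_commute)

lemma distributiveD:
  assumes "distributive_ext A S" "T \<in> interm A S" "U \<in> interm A S" "V \<in> interm A S"
  shows "T \<inter> compositum S U V = compositum S (T \<inter> U) (T \<inter> V)"
  using assms unfolding distributive_ext_def by blast

lemma boolean_complement:
  assumes "boolean_ext A S" "T \<in> interm A S"
  obtains T' where "T' \<in> interm A S" "T \<inter> T' = A" "compositum S T T' = carrier S"
  using assms unfolding boolean_ext_def by blast

lemma atom_below:
  assumes "FIP A S" "T \<in> interm A S" "T \<noteq> A"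
  obtains C where "atom_over A S C" "C \<subseteq> T"
proof -
  let ?F = "{U \<in> interm A S. U \<noteq> A \<and> U \<subseteq> T}"
  have "finite ?F" "T \<in> ?F" using assms by (auto simp: FIP_def)
  then obtain C where C: "C \<in> ?F" "\<forall>U. U \<in> ?F \<longrightarrow> U \<subseteq> C \<longrightarrow> U = C"
    using finite_set_minimal[of ?F T] by blast
  have "atom_over A S C"
    unfolding atom_over_def using C by blast
  then show ?thesis using C(1) that by blast
qed

lemma atoms_disjoint:
  assumes "atom_over A S C" "atom_over A S D" "C \<noteq> D"
  shows "C \<inter> D = A"
proof (rule ccontr)
  assume "C \<inter> D \<noteq> A"
  moreover have "C \<inter> D \<in> interm A S" using assms interm_Int atom_overD(1) by blast
  ultimately have "C \<inter> D = C" "C \<inter> D = D" using assms atom_overD(4) by (metis Int_lower1, metis Int_lower2)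
  then show False using assms(3) by simp
qed

text \<open>By distributivity E is the compositum of its intersections with C and D, and each of
  these is A or the whole atom.\<close>

lemma below_two_atoms:
  assumes base: "subring A S" and "distributive_ext A S" "atom_over A S C" "atom_over A S D"
    and E: "E \<in> interm A S" "E \<subseteq> compositum S C D"
  shows "E \<in> {A, C, D, compositum S C D}"
proof -
  note CD = atom_overD(1)[OF assms(3)] atom_overD(1)[OF assms(4)]
  have eq: "E = compositum S (E \<inter> C) (E \<inter> D)"
    using distributiveD[OF assms(2) E(1) CD] E(2) by auto
  have 1: "E \<inter> C = A \<or> E \<inter> C = C" "E \<inter> D = A \<or> E \<inter> D = D"
    using interm_Int[OF E(1) CD(1)] interm_Int[OF E(1) CD(2)] assms(3,4)
    by (auto simp: atom_over_def)
  have "A \<subseteq> C" "A \<subseteq> D" "subring C S" "subring D S" using CD intermD by blast+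
  moreover have "subring A S" using base .
  ultimately have "compositum S A A = A" "compositum S A D = D" "compositum S C A = C"
    using compositum_absorb[of A A] compositum_absorb[of A C] compositum_absorb[of A D]
      compositum_commute[of A C] by simp_all
  then show ?thesis using 1 eq by (elim disjE) simp_all
qed

text \<open>A complement of J other than A would contain an atom, which also lies in J, hence in the
  intersection A.\<close>

lemma boolean_atoms_generate:
  assumes "boolean_ext A S" "FIP A S" "J \<in> interm A S"
    and J: "\<And>C. atom_over A S C \<Longrightarrow> C \<subseteq> J"
  shows "J = carrier S"
proof -
  obtain J' where J': "J' \<in> interm A S" "J \<inter> J' = A" "compositum S J J' = carrier S"
    using boolean_complement assms(1,3) by blast
  have "J' = A"
  proof (rule ccontr)
    assume "J' \<noteq> A"
    then obtain C where C: "atom_over A S C" "C \<subseteq> J'" using atom_below assms(2) J'(1) by blast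
    then have "C \<subseteq> J \<inter> J'" using J by blast
    then show False using C atom_overD(2,3)[OF C(1)] J'(2) by blast
  qed
  then show ?thesis
    using J'(3) compositum_absorb[of A J] compositum_commute[of J J'] intermD(1,2)[OF assms(3)] by simp
qed

lemma minimal_boolean:
  assumes "subring A S" "minimal_ext A S"
  shows "boolean_ext A S"
proof -
  have I: "interm A S = {A, carrier S}" and A: "A \<subseteq> carrier S"
    using assms(2) unfolding minimal_ext_def by auto
  have "compositum S A A = A" "compositum S A (carrier S) = carrier S"
    "compositum S (carrier S) A = carrier S" "compositum S (carrier S) (carrier S) = carrier S"
    using compositum_absorb[of A A] compositum_absorb[OF A carrier_is_subring] assms(1)
      compositum_commute[of A "carrier S"] compositum_absorb[OF subset_refl carrier_is_subring] by auto
  then show ?thesis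
    unfolding boolean_ext_def distributive_ext_def I using A
    by (auto simp: Int_absorb1 Int_absorb2)
qed

text \<open>T and U are incomparable, so among the four members their intersection can only be A and
  their compositum only S. The laws are then read off from \<open>table\<close>.\<close>

lemma four_element_boolean:
  assumes "subring A S" and I: "interm A S = {A, T, U, carrier S}" and "\<not> T \<subseteq> U" "\<not> U \<subseteq> T"
  shows "boolean_ext A S"
proof -
  have in_I: "T \<in> interm A S" "U \<in> interm A S" unfolding I by auto
  note AT = intermD[OF in_I(1)] intermD[OF in_I(2)]
  have A: "A \<subseteq> carrier S" using AT by auto
  have TU: "T \<inter> U = A"
    using interm_Int[OF in_I] assms(3,4) AT unfolding I by auto
  have CTU: "compositum S T U = carrier S"
    using compositum_interm[OF in_I] compositum_upper1[of T U] compositum_upper2[of U T] assms(3,4) AT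
    unfolding I by auto
  have C: "compositum S K Y = Y" "compositum S Y K = Y" if "K \<subseteq> Y" "Y \<in> interm A S" for K Y
    using compositum_absorb[of K Y] compositum_commute[of K Y] that intermD(1)[OF that(2)] by simp_all
  have sub: "A \<subseteq> T" "A \<subseteq> U" "T \<subseteq> carrier S" "U \<subseteq> carrier S"
    using intermD(2,3) in_I by blast+
  note top = interm_top[OF assms(1)] and base = interm_base[OF assms(1)]
  note comp = C[OF sub(1) in_I(1)] C[OF sub(2) in_I(2)] C[OF sub(3) top] C[OF sub(4) top] C[OF A top]
    C[OF subset_refl in_I(1)] C[OF subset_refl in_I(2)] C[OF subset_refl base] C[OF subset_refl top]
  note inter = sub[THEN Int_absorb1] sub[THEN Int_absorb2] A[THEN Int_absorb1] A[THEN Int_absorb2] Int_absorb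
  note table = comp inter CTU CTU[unfolded compositum_commute[of T]] TU TU[unfolded Int_commute[of T]]
  have dist: "K \<inter> compositum S Y Z = compositum S (K \<inter> Y) (K \<inter> Z)"
    if "K \<in> {A, T, U, carrier S}" "Y \<in> {A, T, U, carrier S}" "Z \<in> {A, T, U, carrier S}" for K Y Z
    using that by (elim insertE emptyE; hypsubst; simp only: table)
  have compl: "\<exists>T'\<in>{A, T, U, carrier S}. K \<inter> T' = A \<and> compositum S K T' = carrier S"
    if "K \<in> {A, T, U, carrier S}" for K
    using that by (elim insertE emptyE; hypsubst; simp only: table bex_simps simp_thms)
  show ?thesis
    unfolding boolean_ext_def distributive_ext_def I by (intro conjI ballI dist compl)
qed

text \<open>
  In a finite distributive lattice that is not Boolean, some join-irreducible element is not an
  atom; together with its unique lower cover it gives an interval that is a chain of length two.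
\<close>

lemma boolean_if_no_chain:
  assumes "subring A S" "FIP A S" "distributive_ext A S"
    and no_chain: "\<And>K W V. \<lbrakk>K \<in> interm A S; W \<in> interm A S; V \<in> interm A S; K \<subset> W; W \<subset> V;
        \<And>T. \<lbrakk>T \<in> interm A S; K \<subseteq> T; T \<subseteq> V\<rbrakk> \<Longrightarrow> T \<in> {K, W, V}\<rbrakk> \<Longrightarrow> False"
  shows "boolean_ext A S"
  unfolding boolean_ext_def
proof (intro conjI ballI assms(3))
  fix T assume T: "T \<in> interm A S"
  have fin: "finite (interm A S)" using assms(2) by (simp add: FIP_def)
  \<comment> \<open>The candidate for a complement of T: a U maximal with T meeting U only in
    A.\<close>
  let ?F = "{U \<in> interm A S. T \<inter> U = A}"
  have "finite ?F" "A \<in> ?F" using fin interm_base[OF assms(1)] intermD(2)[OF T] by auto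
  then obtain U where U0: "U \<in> ?F" "\<forall>V. V \<in> ?F \<longrightarrow> U \<subseteq> V \<longrightarrow> V = U"
    using finite_set_maximal[of ?F A] by blast
  then have U: "U \<in> interm A S" "T \<inter> U = A"
    and Umax: "\<And>V. V \<in> interm A S \<Longrightarrow> T \<inter> V = A \<Longrightarrow> U \<subseteq> V \<Longrightarrow> V = U" by simp_all
  let ?P = "compositum S T U"
  have P: "?P \<in> interm A S" using T U compositum_interm by blast
  have "?P = carrier S"
  proof (rule ccontr)
    assume "?P \<noteq> carrier S"
    \<comment> \<open>V is minimal among the rings not below \<open>?P\<close>, so every smaller
      ring lies in \<open>?P\<close>, and W is the largest ring properly below V.\<close>
    let ?G = "{V \<in> interm A S. \<not> V \<subseteq> ?P}"
    have "finite ?G" "carrier S \<in> ?G"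
      using fin interm_top[OF assms(1)] intermD(3)[OF P] \<open>?P \<noteq> carrier S\<close> by auto
    then obtain V where V0: "V \<in> ?G" "\<forall>Y. Y \<in> ?G \<longrightarrow> Y \<subseteq> V \<longrightarrow> Y = V"
      using finite_set_minimal[of ?G "carrier S"] by blast
    then have V: "V \<in> interm A S" "\<not> V \<subseteq> ?P"
      and Vmin: "\<And>Y. Y \<in> interm A S \<Longrightarrow> \<not> Y \<subseteq> ?P \<Longrightarrow> Y \<subseteq> V \<Longrightarrow> Y = V" by simp_all
    define W where "W = V \<inter> ?P"
    have W: "W \<in> interm A S" unfolding W_def using V P interm_Int by blast
    show False
    proof (cases "W = A")
      \<comment> \<open>V meets T only in A. By distributivity the compositum of U and V does so
        too, and maximality of U puts V inside U.\<close>
      case True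
      let ?UV = "compositum S U V"
      have "V \<inter> T \<subseteq> W" using compositum_upper1[of T U] by (auto simp: W_def)
      then have VT: "T \<inter> V = A" using True intermD(2)[OF V(1)] intermD(2)[OF T] by blast
      have "T \<inter> ?UV = compositum S (T \<inter> U) (T \<inter> V)"
        using distributiveD[OF assms(3) T U(1) V(1)] .
      then have "T \<inter> ?UV = A" using VT U(2) compositum_absorb[of A A] assms(1) by simp
      then have "?UV = U" using Umax compositum_interm[OF U(1) V(1)] compositum_upper1 by blast
      then have "V \<subseteq> ?P" using compositum_upper2 by blast
      then show False using V(2) by blast
    next
      case False
      \<comment> \<open>K is a lower cover of W, so K, W and V make up the whole interval from K to
        V.\<close>
      let ?H = "{K \<in> interm A S. K \<subset> W}"
      have "finite ?H" "A \<in> ?H" using fin interm_base[OF assms(1)] intermD(2)[OF W] False by auto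
      then obtain K where K0: "K \<in> ?H" "\<forall>Y. Y \<in> ?H \<longrightarrow> K \<subseteq> Y \<longrightarrow> Y = K"
        using finite_set_maximal[of ?H A] by blast
      then have K: "K \<in> interm A S" "K \<subset> W"
        and Kmax: "\<And>Y. Y \<in> interm A S \<Longrightarrow> Y \<subset> W \<Longrightarrow> K \<subseteq> Y \<Longrightarrow> Y = K" by simp_all
      have "Y \<in> {K, W, V}" if "Y \<in> interm A S" "K \<subseteq> Y" "Y \<subseteq> V" for Y
        using that Vmin[of Y] Kmax[of Y] by (auto simp: W_def)
      moreover have "W \<subset> V" using V(2) by (auto simp: W_def)
      ultimately show False using no_chain[OF K(1) W V(1) K(2)] by blast
    qed
  qed
  then show "\<exists>T'\<in>interm A S. T \<inter> T' = A \<and> compositum S T T' = carrier S" using U by blast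
qed

text \<open>The complement C of W in the whole lattice is moved into the interval as the compositum
  of K and V \<inter> C. Distributivity keeps the meet with W at K and the join at V.\<close>

lemma boolean_relative_complement:
  assumes "boolean_ext A S" "K \<in> interm A S" "W \<in> interm A S" "V \<in> interm A S" "K \<subseteq> W" "W \<subseteq> V"
  obtains Z where "Z \<in> interm A S" "K \<subseteq> Z" "Z \<subseteq> V" "Z \<inter> W = K" "compositum S Z W = V"
proof -
  obtain C where C: "C \<in> interm A S" "W \<inter> C = A" "compositum S W C = carrier S"
    using boolean_complement assms(1,3) by blast
  have dist: "distributive_ext A S" using assms(1) by (simp add: boolean_ext_def)
  define Z where "Z = compositum S K (V \<inter> C)"
  have VC: "V \<inter> C \<in> interm A S" using assms C interm_Int by blast
  have Z: "Z \<in> interm A S" unfolding Z_def using compositum_interm[OF assms(2) VC] .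
  have KZ: "K \<subseteq> Z" unfolding Z_def by (rule compositum_upper1)
  have ZV: "Z \<subseteq> V" unfolding Z_def using assms by (intro compositum_least) (auto dest: intermD(1))
  have "W \<inter> Z = compositum S (W \<inter> K) (W \<inter> (V \<inter> C))"
    unfolding Z_def using distributiveD[OF dist assms(3,2) VC] .
  moreover have "W \<inter> K = K" "W \<inter> (V \<inter> C) = A" using assms(5,6) C(2) by auto
  ultimately have ZW: "Z \<inter> W = K"
    using compositum_absorb[of A K] compositum_commute[of A K] intermD(1,2)[OF assms(2)] by auto
  have "V = V \<inter> compositum S W C" using C(3) intermD(3)[OF assms(4)] by auto
  also have "\<dots> = compositum S W (V \<inter> C)" using distributiveD[OF dist assms(4,3) C(1)] assms(6)
    by (simp add: Int_absorb1)
  also have "\<dots> \<subseteq> compositum S Z W"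
    by (rule compositum_least[OF compositum_upper2])
      (use compositum_upper2[of "V \<inter> C" K] compositum_upper1[of Z W] compositum_interm[OF Z assms(3)]
        in \<open>auto simp: Z_def dest: intermD(1)\<close>)
  finally have "V \<subseteq> compositum S Z W" .
  moreover have "compositum S Z W \<subseteq> V" using ZV assms by (intro compositum_least) (auto dest: intermD(1))
  ultimately show ?thesis using that Z KZ ZV ZW by blast
qed

end

section \<open>Transport of the Boolean property along lattice maps\<close>

text \<open>Meant for localization, which is a surjective lattice homomorphism but in general not
  injective. The assumption \<open>mono\<close> sends bottom to bottom and top to top.\<close>

lemma boolean_hom_image:
  assumes "cring S" "subring A S" "cring S'" "subring A' S'"
    and h: "h ` interm A S = interm A' S'"
    and mono: "\<And>T U. \<lbrakk>T \<in> interm A S; U \<in> interm A S; T \<subseteq> U\<rbrakk> \<Longrightarrow> h T \<subseteq> h U"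
    and hInt: "\<And>T U. \<lbrakk>T \<in> interm A S; U \<in> interm A S\<rbrakk> \<Longrightarrow> h (T \<inter> U) = h T \<inter> h U"
    and hcomp: "\<And>T U. \<lbrakk>T \<in> interm A S; U \<in> interm A S\<rbrakk> \<Longrightarrow>
       h (compositum S T U) = compositum S' (h T) (h U)"
    and "boolean_ext A S"
  shows "boolean_ext A' S'"
proof -
  interpret S: ambient_ring S using assms(1) by (rule ambient_ring.intro)
  interpret S': ambient_ring S' using assms(3) by (rule ambient_ring.intro)
  have hin: "h T \<in> interm A' S'" if "T \<in> interm A S" for T using h that by blast
  note base = S.interm_base[OF assms(2)] S'.interm_base[OF assms(4)]
  note top = S.interm_top[OF assms(2)] S'.interm_top[OF assms(4)]
  obtain T0 where "T0 \<in> interm A S" "A' = h T0" using base(2) h by blast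
  then have "h A \<subseteq> A'" using mono base(1) intermD(2) by metis
  then have hA: "h A = A'" using intermD(2)[OF hin[OF base(1)]] by blast
  obtain T1 where "T1 \<in> interm A S" "carrier S' = h T1" using top(2) h by blast
  then have "carrier S' \<subseteq> h (carrier S)" using mono top(1) intermD(3) by metis
  then have hS: "h (carrier S) = carrier S'" using intermD(3)[OF hin[OF top(1)]] by blast
  have dist: "distributive_ext A S" using assms(9) by (simp add: boolean_ext_def)
  show ?thesis
    unfolding boolean_ext_def distributive_ext_def h[symmetric]
  proof (intro conjI ballI; elim imageE; hypsubst)
    fix T U V assume TUV: "T \<in> interm A S" "U \<in> interm A S" "V \<in> interm A S"
    have "h (T \<inter> compositum S U V) = h (compositum S (T \<inter> U) (T \<inter> V))"
      using S.distributiveD[OF dist TUV] by simp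
    then show "h T \<inter> compositum S' (h U) (h V) = compositum S' (h T \<inter> h U) (h T \<inter> h V)"
      using TUV by (simp add: hInt hcomp S.interm_Int S.compositum_interm)
  next
    fix T assume T: "T \<in> interm A S"
    then obtain T' where T': "T' \<in> interm A S" "T \<inter> T' = A" "compositum S T T' = carrier S"
      using S.boolean_complement[OF assms(9)] by blast
    then have "h T \<inter> h T' = A' \<and> compositum S' (h T) (h T') = carrier S'"
      using hInt[OF T T'(1)] hcomp[OF T T'(1)] hA hS by simp
    then show "\<exists>T'\<in>h ` interm A S. h T \<inter> T' = A' \<and> compositum S' (h T) T' = carrier S'"
      using T'(1) by blast
  qed
qed

text \<open>Meets and joins are determined by the order. The inclusions that do not follow from
  monotonicity of \<open>f\<close> are obtained by pulling back with \<open>g\<close>.\<close>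

lemma boolean_order_iso_imp:
  assumes "cring S" "subring A S" "cring S'" "subring A' S'"
    and f: "\<And>T. T \<in> interm A S \<Longrightarrow> f T \<in> interm A' S' \<and> g (f T) = T"
    and g: "\<And>T. T \<in> interm A' S' \<Longrightarrow> g T \<in> interm A S \<and> f (g T) = T"
    and fm: "\<And>T U. \<lbrakk>T \<in> interm A S; U \<in> interm A S; T \<subseteq> U\<rbrakk> \<Longrightarrow> f T \<subseteq> f U"
    and gm: "\<And>T U. \<lbrakk>T \<in> interm A' S'; U \<in> interm A' S'; T \<subseteq> U\<rbrakk> \<Longrightarrow> g T \<subseteq> g U"
    and "boolean_ext A S"
  shows "boolean_ext A' S'"
proof -
  interpret S: ambient_ring S using assms(1) by (rule ambient_ring.intro)
  interpret S': ambient_ring S' using assms(3) by (rule ambient_ring.intro)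
  have fi: "f T \<in> interm A' S'" and gf: "g (f T) = T" if "T \<in> interm A S" for T using f[OF that] by auto
  have gi: "g T \<in> interm A S" and fg: "f (g T) = T" if "T \<in> interm A' S'" for T using g[OF that] by auto
  have "f ` interm A S = interm A' S'" using fi gi fg by (auto simp: image_iff) metis
  moreover have "f (T \<inter> U) = f T \<inter> f U" if TU: "T \<in> interm A S" "U \<in> interm A S" for T U
  proof
    note TI = S.interm_Int[OF TU] and fI = S'.interm_Int[OF fi[OF TU(1)] fi[OF TU(2)]]
    show "f (T \<inter> U) \<subseteq> f T \<inter> f U" using fm[OF TI TU(1)] fm[OF TI TU(2)] by blast
    have "g (f T \<inter> f U) \<subseteq> T \<inter> U"
      using gm[OF fI fi[OF TU(1)]] gm[OF fI fi[OF TU(2)]] gf[OF TU(1)] gf[OF TU(2)] by simp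
    then show "f T \<inter> f U \<subseteq> f (T \<inter> U)" using fm[OF gi[OF fI] TI] fg[OF fI] by simp
  qed
  moreover have "f (compositum S T U) = compositum S' (f T) (f U)"
    if TU: "T \<in> interm A S" "U \<in> interm A S" for T U
  proof
    note TC = S.compositum_interm[OF TU] and fC = S'.compositum_interm[OF fi[OF TU(1)] fi[OF TU(2)]]
    show "compositum S' (f T) (f U) \<subseteq> f (compositum S T U)"
      using fm[OF TU(1) TC S.compositum_upper1] fm[OF TU(2) TC S.compositum_upper2] intermD(1)[OF fi[OF TC]]
      by (rule S'.compositum_least)
    have "T \<subseteq> g (compositum S' (f T) (f U))" "U \<subseteq> g (compositum S' (f T) (f U))"
      using gm[OF fi[OF TU(1)] fC S'.compositum_upper1] gm[OF fi[OF TU(2)] fC S'.compositum_upper2]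
        gf[OF TU(1)] gf[OF TU(2)] by simp_all
    then have "compositum S T U \<subseteq> g (compositum S' (f T) (f U))"
      using intermD(1)[OF gi[OF fC]] by (rule S.compositum_least)
    then show "f (compositum S T U) \<subseteq> compositum S' (f T) (f U)"
      using fm[OF TC gi[OF fC]] fg[OF fC] by simp
  qed
  ultimately show ?thesis by (intro boolean_hom_image[OF assms(1-4) _ fm _ _ assms(9)])
qed

lemma boolean_order_iso:
  assumes "cring S" "subring A S" "cring S'" "subring A' S'"
    and f: "\<And>T. T \<in> interm A S \<Longrightarrow> f T \<in> interm A' S' \<and> g (f T) = T"
    and g: "\<And>T. T \<in> interm A' S' \<Longrightarrow> g T \<in> interm A S \<and> f (g T) = T"
    and fm: "\<And>T U. \<lbrakk>T \<in> interm A S; U \<in> interm A S; T \<subseteq> U\<rbrakk> \<Longrightarrow> f T \<subseteq> f U"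
    and gm: "\<And>T U. \<lbrakk>T \<in> interm A' S'; U \<in> interm A' S'; T \<subseteq> U\<rbrakk> \<Longrightarrow> g T \<subseteq> g U"
  shows "boolean_ext A S \<longleftrightarrow> boolean_ext A' S'"
  using boolean_order_iso_imp[OF assms(1-4) f g fm gm] boolean_order_iso_imp[OF assms(3,4,1,2) g f gm fm]
  by blast

section \<open>Maximal ideals of a subring\<close>

lemma (in cring) maximalideal_exists:
  assumes "ideal J R" "\<one> \<notin> J"
  obtains M where "maximalideal M R" "J \<subseteq> M"
proof -
  let ?F = "{I. ideal I R \<and> J \<subseteq> I \<and> \<one> \<notin> I}"
  have "\<exists>M\<in>?F. \<forall>I\<in>?F. M \<subseteq> I \<longrightarrow> I = M"
  proof (rule subset_Zorn_nonempty)
    show "?F \<noteq> {}" using assms by blast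
    fix C assume C: "C \<noteq> {}" "subset.chain ?F C"
    then have sub: "\<And>I. I \<in> C \<Longrightarrow> ideal I R \<and> J \<subseteq> I \<and> \<one> \<notin> I"
      and lin: "\<And>I K. I \<in> C \<Longrightarrow> K \<in> C \<Longrightarrow> I \<subseteq> K \<or> K \<subseteq> I"
      by (auto simp: subset_chain_def)
    note idl = sub[THEN conjunct1]
    note asg = ideal.axioms(1)[OF idl]
    have "ideal (\<Union>C) R"
    proof (rule idealI)
      show "subgroup (\<Union>C) (add_monoid R)"
      proof (rule add.subgroupI)
        show "\<Union>C \<subseteq> carrier R" using ideal.Icarr[OF idl] by blast
        show "\<Union>C \<noteq> {}" using C(1) additive_subgroup.zero_closed[OF asg] by blast
        show "\<ominus> a \<in> \<Union>C" if "a \<in> \<Union>C" for a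
          using that additive_subgroup.a_inv_closed[OF asg] by blast
        show "a \<oplus> b \<in> \<Union>C" if ab: "a \<in> \<Union>C" "b \<in> \<Union>C" for a b
        proof -
          obtain I K where "I \<in> C" "a \<in> I" "K \<in> C" "b \<in> K" using ab by blast
          then obtain L where "L \<in> C" "a \<in> L" "b \<in> L" using lin[of I K] by blast
          then show ?thesis using additive_subgroup.a_closed[OF asg] by blast
        qed
      qed
      show "x \<otimes> a \<in> \<Union>C" if "a \<in> \<Union>C" "x \<in> carrier R" for a x
        using that ideal.I_l_closed[OF idl] by blast
      show "a \<otimes> x \<in> \<Union>C" if "a \<in> \<Union>C" "x \<in> carrier R" for a x
        using that ideal.I_r_closed[OF idl] by blast
    qed (rule ring_axioms)
    then show "\<Union>C \<in> ?F" using sub C(1) by blast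
  qed
  then obtain M where M0: "M \<in> ?F" and max: "\<forall>I\<in>?F. M \<subseteq> I \<longrightarrow> I = M" by blast
  then have M: "ideal M R" "J \<subseteq> M" "\<one> \<notin> M" by simp_all
  have "maximalideal M R"
  proof (rule maximalidealI[OF M(1)])
    show "carrier R \<noteq> M" using M(3) by blast
    fix I assume I: "ideal I R" "M \<subseteq> I" "I \<subseteq> carrier R"
    show "I = M \<or> I = carrier R"
    proof (cases "\<one> \<in> I")
      case True then show ?thesis using ideal.one_imp_carrier[OF I(1)] by blast
    next
      case False then show ?thesis using max I M(2) by blast
    qed
  qed
  then show ?thesis using M(2) that by blast
qed

context ambient_ring
begin

lemma subring_cring: "subring A S \<Longrightarrow> cring (S\<lparr>carrier := A\<rparr>)"
  using subcringI' subcring_iff subringE(1) by blast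

text \<open>Negation is multiplication by the element -1 of A, so these closure properties suffice.
  Stating them with the operations of S keeps the restricted record out of later
  computations.\<close>

lemma ideal_of_subringI:
  assumes A: "subring A S" and "J \<subseteq> A" "\<zero> \<in> J"
    and add: "\<And>x y. x \<in> J \<Longrightarrow> y \<in> J \<Longrightarrow> x \<oplus> y \<in> J"
    and mult: "\<And>r x. r \<in> A \<Longrightarrow> x \<in> J \<Longrightarrow> r \<otimes> x \<in> J"
  shows "ideal J (S\<lparr>carrier := A\<rparr>)"
proof -
  interpret A: cring "S\<lparr>carrier := A\<rparr>" using subring_cring[OF A] .
  have J: "x \<in> J \<Longrightarrow> x \<in> carrier S" for x using assms(2) subringE(1)[OF A] by blast
  have inv: "\<ominus>\<^bsub>S\<lparr>carrier := A\<rparr>\<^esub> x \<in> J" if "x \<in> J" for x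
  proof -
    have "\<ominus>\<^bsub>S\<lparr>carrier := A\<rparr>\<^esub> x = \<ominus>\<^bsub>S\<lparr>carrier := A\<rparr>\<^esub> \<one>\<^bsub>S\<lparr>carrier := A\<rparr>\<^esub> \<otimes>\<^bsub>S\<lparr>carrier := A\<rparr>\<^esub> x"
      using that assms(2) A.l_minus[of "\<one>" x] subringE(3)[OF A] J by auto
    then show ?thesis using mult[OF A.a_inv_closed[OF A.one_closed, simplified] that] by simp
  qed
  show ?thesis
  proof (rule idealI)
    show "subgroup J (add_monoid (S\<lparr>carrier := A\<rparr>))"
      by (rule A.add.subgroupI) (use assms inv in auto)
    show "\<And>a x. a \<in> J \<Longrightarrow> x \<in> carrier (S\<lparr>carrier := A\<rparr>) \<Longrightarrow> x \<otimes>\<^bsub>S\<lparr>carrier := A\<rparr>\<^esub> a \<in> J"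
      using mult by simp
    show "a \<otimes>\<^bsub>S\<lparr>carrier := A\<rparr>\<^esub> x \<in> J" if "a \<in> J" "x \<in> carrier (S\<lparr>carrier := A\<rparr>)" for a x
      using mult[of x a] m_comm[OF J, of a x] subringE(1)[OF A] that by auto
  qed (rule A.ring_axioms)
qed

lemma ideal_of_subringD:
  assumes A: "subring A S" and "ideal J (S\<lparr>carrier := A\<rparr>)"
  shows "J \<subseteq> A" "\<zero> \<in> J" "\<And>x y. x \<in> J \<Longrightarrow> y \<in> J \<Longrightarrow> x \<oplus> y \<in> J"
    "\<And>r x. r \<in> A \<Longrightarrow> x \<in> J \<Longrightarrow> r \<otimes> x \<in> J"
proof -
  interpret J: ideal J "S\<lparr>carrier := A\<rparr>" by fact
  show "J \<subseteq> A" using J.Icarr by auto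
  show "\<zero> \<in> J" using additive_subgroup.zero_closed[OF J.is_additive_subgroup] by simp
  show "x \<oplus> y \<in> J" if "x \<in> J" "y \<in> J" for x y using additive_subgroup.a_closed[OF J.is_additive_subgroup that] by simp
  show "r \<otimes> x \<in> J" if "r \<in> A" "x \<in> J" for r x using J.I_l_closed[of x r] that by simp
qed

lemma maximalideal_of_subringD:
  assumes A: "subring A S" and M: "maximalideal M (S\<lparr>carrier := A\<rparr>)"
  shows "\<one> \<notin> M" "\<And>s. s \<in> A - M \<Longrightarrow> \<exists>r\<in>A. \<exists>p\<in>M. s \<otimes> r \<oplus> p = \<one>"
    "\<And>a b. a \<in> A \<Longrightarrow> b \<in> A \<Longrightarrow> a \<otimes> b \<in> M \<Longrightarrow> a \<in> M \<or> b \<in> M"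
proof -
  interpret M: maximalideal M "S\<lparr>carrier := A\<rparr>" by fact
  interpret A: cring "S\<lparr>carrier := A\<rparr>" using subring_cring[OF A] .
  note AE = subringE[OF A] and ME = ideal_of_subringD[OF A M.ideal_axioms]
  have Ac: "x \<in> A \<Longrightarrow> x \<in> carrier S" for x using AE(1) by blast
  have Mc: "x \<in> M \<Longrightarrow> x \<in> carrier S" for x using ME(1) AE(1) by blast
  show "\<one> \<notin> M" using M.one_imp_carrier M.I_notcarr by auto
  show "a \<in> M \<or> b \<in> M" if "a \<in> A" "b \<in> A" "a \<otimes> b \<in> M" for a b
    using primeideal.I_prime[OF A.maximalideal_prime[OF M]] that by simp
  fix s assume s: "s \<in> A - M"
  \<comment> \<open>The ideal s A + M; it contains M properly and hence is all of A.\<close>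
  let ?J = "{x. \<exists>r\<in>A. \<exists>p\<in>M. x = s \<otimes> r \<oplus> p}"
  have JA: "?J \<subseteq> A"
  proof
    fix x assume "x \<in> ?J"
    then obtain r p where x: "x = s \<otimes> r \<oplus> p" "r \<in> A" "p \<in> M" by blast
    show "x \<in> A" unfolding x(1) by (intro AE(6,7)) (use s x ME(1) in auto)
  qed
  have "ideal ?J (S\<lparr>carrier := A\<rparr>)"
  proof (rule ideal_of_subringI[OF A])
    show "?J \<subseteq> A" by (rule JA)
    show "\<zero> \<in> ?J" using AE(2) ME(2) s Ac by (intro CollectI bexI[of _ \<zero>]) auto
    fix x y assume "x \<in> ?J"
    then obtain r p where x: "x = s \<otimes> r \<oplus> p" "r \<in> A" "p \<in> M" by blast
    {
      assume "y \<in> ?J"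
      then obtain r' p' where y: "y = s \<otimes> r' \<oplus> p'" "r' \<in> A" "p' \<in> M" by blast
      have "x \<oplus> y = s \<otimes> (r \<oplus> r') \<oplus> (p \<oplus> p')"
        using x y s Ac Mc by (simp add: r_distr a_ac)
      then show "x \<oplus> y \<in> ?J" using x y AE(7) ME(3) by blast
    next
      assume y: "y \<in> A"
      have "y \<otimes> x = s \<otimes> (y \<otimes> r) \<oplus> y \<otimes> p"
        using x y s Ac Mc by (simp add: r_distr m_ac)
      then show "y \<otimes> x \<in> ?J" using x y AE(6) ME(4) by blast
    }
  qed
  then have "?J = M \<or> ?J = A" if "M \<subseteq> ?J" using M.I_maximal[of ?J] JA that by simp
  moreover have MJ: "M \<subseteq> ?J"
  proof
    fix p assume "p \<in> M"
    then have "p = s \<otimes> \<zero> \<oplus> p" using s Ac Mc by auto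
    then show "p \<in> ?J" using AE(2) \<open>p \<in> M\<close> by blast
  qed
  moreover have "s = s \<otimes> \<one> \<oplus> \<zero>" using s Ac by auto
  then have "s \<in> ?J" using AE(3) ME(2) by blast
  then have "?J \<noteq> M" using s by (metis (no_types, lifting) DiffD2)
  ultimately have "?J = A" by (simp only: simp_thms)
  then have "\<one> \<in> ?J" by (simp only: AE(3))
  then show "\<exists>r\<in>A. \<exists>p\<in>M. s \<otimes> r \<oplus> p = \<one>" by (elim CollectE bexE) (rule bexI, rule bexI, rule sym)
qed

lemma maximalideal_of_subringI:
  assumes A: "subring A S" and J: "ideal M (S\<lparr>carrier := A\<rparr>)" "\<one> \<notin> M"
    and inv: "\<And>s. s \<in> A - M \<Longrightarrow> \<exists>r\<in>A. \<exists>p\<in>M. s \<otimes> r \<oplus> p = \<one>"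
  shows "maximalideal M (S\<lparr>carrier := A\<rparr>)"
proof (rule maximalidealI[OF J(1)])
  show "carrier (S\<lparr>carrier := A\<rparr>) \<noteq> M" using J(2) subringE(3)[OF A] by auto
  fix I assume I: "ideal I (S\<lparr>carrier := A\<rparr>)" "M \<subseteq> I" "I \<subseteq> carrier (S\<lparr>carrier := A\<rparr>)"
  note IE = ideal_of_subringD[OF A I(1)]
  show "I = M \<or> I = carrier (S\<lparr>carrier := A\<rparr>)"
  proof (rule ccontr)
    assume *: "\<not> ?thesis"
    then obtain s where s: "s \<in> I" "s \<notin> M" using I(2) by blast
    then obtain r p where rp: "r \<in> A" "p \<in> M" "s \<otimes> r \<oplus> p = \<one>" using inv IE(1) by blast
    have "r \<otimes> s = s \<otimes> r" using rp(1) s(1) IE(1) subringE(1)[OF A] by (intro m_comm) auto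
    then have "\<one> \<in> I" using IE(3)[OF IE(4)[OF rp(1) s(1)], of p] rp I(2) by auto
    then have "I = A" using ideal.one_imp_carrier[OF I(1)] by simp
    then show False using * by simp
  qed
qed

end

section \<open>Localization of the lattice of intermediate rings\<close>

locale localized_subring = ambient_ring S for S (structure) +
  fixes R M
  assumes R: "subring R S" and M: "maximalideal M (S\<lparr>carrier := R\<rparr>)"
begin

abbreviation loc where "loc T \<equiv> loc_sub T S (R - M)"
abbreviation frac where "frac x s \<equiv> lfrac S (R - M) x s"
abbreviation RB where "RB \<equiv> loc_ring S (R - M)"

lemmas RE = subringE[OF R]
lemmas ME = ideal_of_subringD[OF R maximalideal.axioms(1)[OF M]]
lemmas Mmax = maximalideal_of_subringD[OF R M]

lemma R_carrier [simp]: "x \<in> R \<Longrightarrow> x \<in> carrier S"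
  using RE(1) by blast

lemma M_R [simp]: "x \<in> M \<Longrightarrow> x \<in> R"
  using ME(1) by blast

lemma one_R [simp]: "\<one> \<in> R" "\<one> \<notin> M"
  using RE(3) Mmax(1) by blast+

sublocale localizing S "R - M"
  using RE(3,6) Mmax(1,3) by unfold_locales (auto simp: subset_iff)

sublocale L: ambient_ring RB
  using loc_ring_cring by (rule ambient_ring.intro)

lemma loc_memI: "x \<in> T \<Longrightarrow> s \<in> R - M \<Longrightarrow> frac x s \<in> loc T"
  unfolding loc_sub_def by blast

text \<open>An element of \<open>loc T\<close> may be given with a numerator outside T. The
  criterion removes the choice of a representative, since x/s = (u x)/(u s).\<close>

lemma loc_mem_iff:
  assumes T: "T \<in> interm R S" and x: "x \<in> carrier S" and s: "s \<in> R - M"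
  shows "frac x s \<in> loc T \<longleftrightarrow> (\<exists>u\<in>R - M. u \<otimes> x \<in> T)"
proof
  note TE = subringE[OF intermD(1)[OF T]] and RT = intermD(2)[OF T]
  assume "frac x s \<in> loc T"
  then obtain y t where yt: "frac x s = frac y t" "y \<in> T" "t \<in> R - M" unfolding loc_sub_def by blast
  then obtain u where u: "u \<in> R - M" "u \<otimes> (t \<otimes> x) = u \<otimes> (s \<otimes> y)"
    using lfrac_eq_iff[of x y s t] x s TE(1) by blast
  have "(u \<otimes> t) \<otimes> x = u \<otimes> (s \<otimes> y)" using u x yt(3) by (simp add: m_assoc)
  also have "\<dots> \<in> T" using u(1) s yt(2) RT by (intro TE(6)) auto
  finally show "\<exists>u\<in>R - M. u \<otimes> x \<in> T" using D_mult[OF u(1) yt(3)] by blast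
next
  assume "\<exists>u\<in>R - M. u \<otimes> x \<in> T"
  then obtain u where u: "u \<in> R - M" "u \<otimes> x \<in> T" by blast
  have "frac x s = frac (u \<otimes> x) (u \<otimes> s)"
    using u s x by (intro lfrac_cong D_mult) (simp_all add: m_ac)
  then show "frac x s \<in> loc T" using loc_memI[OF u(2) D_mult[OF u(1) s]] by simp
qed

lemma loc_carrier: "loc (carrier S) = carrier RB"
  by (simp add: loc_sub_def loc_ring_def)

lemma loc_mono: "T \<subseteq> U \<Longrightarrow> loc T \<subseteq> loc U"
  unfolding loc_sub_def by blast

lemma loc_subring: "T \<in> interm R S \<Longrightarrow> subring (loc T) RB"
  by (rule loc_sub_subring) (auto dest: intermD)

lemma loc_interm: "T \<in> interm R S \<Longrightarrow> loc T \<in> interm (loc R) RB"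
  by (rule intermI[OF loc_subring loc_mono]) (auto dest: intermD)

lemma loc_R_subring: "subring (loc R) RB"
  by (rule loc_subring[OF interm_base[OF R]])

lemma frac_unit:
  assumes "s \<in> R - M" "t \<in> R - M"
  shows "frac s t \<otimes>\<^bsub>RB\<^esub> frac t s = \<one>\<^bsub>RB\<^esub>"
proof -
  have "frac (s \<otimes> t) (t \<otimes> s) = frac \<one> \<one>"
    using assms by (intro lfrac_cong D_mult) (simp_all add: m_comm D_one)
  then show ?thesis using assms by (simp add: loc_one)
qed

lemma frac_split: "x \<in> carrier S \<Longrightarrow> s \<in> R - M \<Longrightarrow> frac x s = frac x \<one> \<otimes>\<^bsub>RB\<^esub> frac \<one> s"
  by (simp add: D_one)

text \<open>Contraction along S -> S_M. It is a right inverse of \<open>loc\<close>, which gives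
  surjectivity of \<open>loc\<close>; contracting \<open>loc T\<close> may yield a ring larger than
  T.\<close>

definition num :: "('a \<times> 'a) set set \<Rightarrow> 'a set"
  where "num V = {x \<in> carrier S. frac x \<one> \<in> V}"

text \<open>Both s/1 and 1/s lie in R_M and hence in V, so denominators can be inserted and
  removed.\<close>

lemma frac_mem_interm_iff:
  assumes V: "V \<in> interm (loc R) RB" and "x \<in> carrier S" "s \<in> R - M"
  shows "frac x s \<in> V \<longleftrightarrow> frac x \<one> \<in> V"
proof
  note VE = subringE[OF intermD(1)[OF V]] and RV = intermD(2)[OF V]
  have s: "frac s \<one> \<in> V" "frac \<one> s \<in> V"
    using RV assms(3) by (auto intro!: subsetD[OF RV] loc_memI D_one RE(3))
  show "frac x s \<in> V" if "frac x \<one> \<in> V"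
    using VE(6)[OF that s(2)] frac_split[OF assms(2,3)] by simp
  assume "frac x s \<in> V"
  then have "frac x s \<otimes>\<^bsub>RB\<^esub> frac s \<one> \<in> V" using s by (intro VE(6))
  moreover have "frac (x \<otimes> s) (s \<otimes> \<one>) = frac x \<one>"
    using assms by (intro lfrac_cong D_mult) (simp_all add: m_comm D_one)
  ultimately show "frac x \<one> \<in> V" using assms by (simp add: D_one)
qed

lemma num_interm:
  assumes V: "V \<in> interm (loc R) RB"
  shows "num V \<in> interm R S"
proof -
  note VE = subringE[OF intermD(1)[OF V]] and RV = intermD(2)[OF V]
  show ?thesis
  proof (rule intermI[OF subringI])
    show "num V \<subseteq> carrier S" "R \<subseteq> num V" "\<one> \<in> num V"
      using RV by (auto simp: num_def D_one RE(3) intro!: subsetD[OF RV] loc_memI)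
    show "\<ominus> x \<in> num V" if "x \<in> num V" for x
      using that VE(5)[of "frac x \<one>"] by (auto simp: num_def loc_a_inv D_one)
    show "x \<otimes> y \<in> num V" if "x \<in> num V" "y \<in> num V" for x y
      using that VE(6)[of "frac x \<one>" "frac y \<one>"] D_one by (auto simp: num_def)
    show "x \<oplus> y \<in> num V" if "x \<in> num V" "y \<in> num V" for x y
      using that VE(7)[of "frac x \<one>" "frac y \<one>"] D_one by (auto simp: num_def)
  qed
qed

lemma loc_num:
  assumes V: "V \<in> interm (loc R) RB"
  shows "loc (num V) = V"
proof
  show "loc (num V) \<subseteq> V"
    using iffD2[OF frac_mem_interm_iff[OF V]] by (auto simp: loc_sub_def num_def)
  show "V \<subseteq> loc (num V)"
  proof
    fix z assume z: "z \<in> V"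
    then have "z \<in> carrier RB" using intermD(3)[OF V] by blast
    then obtain x s where "x \<in> carrier S" "s \<in> R - M" "z = frac x s" by (rule loc_carrierE)
    then show "z \<in> loc (num V)"
      using iffD1[OF frac_mem_interm_iff[OF V]] z loc_memI[of x "num V" s] by (simp add: num_def)
  qed
qed

lemma loc_surj: "loc ` interm R S = interm (loc R) RB"
  using loc_interm num_interm loc_num by (auto simp: image_iff) metis

lemma loc_Int:
  assumes T: "T \<in> interm R S" and U: "U \<in> interm R S"
  shows "loc (T \<inter> U) = loc T \<inter> loc U"
proof
  show "loc (T \<inter> U) \<subseteq> loc T \<inter> loc U" by (simp add: loc_mono)
  show "loc T \<inter> loc U \<subseteq> loc (T \<inter> U)"
  proof
    fix z assume z: "z \<in> loc T \<inter> loc U"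
    then obtain x s where x: "z = frac x s" "x \<in> T" "s \<in> R - M" by (auto simp: loc_sub_def)
    then have xc: "x \<in> carrier S" using intermD(3)[OF T] by blast
    \<comment> \<open>As u is in R, u x stays in T, and x/s = (u x)/(u s) gets a numerator common to
      T and U.\<close>
    then obtain u where u: "u \<in> R - M" "u \<otimes> x \<in> U" using loc_mem_iff[OF U] z x by auto
    have "u \<otimes> x \<in> T" using u(1) x(2) intermD(2)[OF T] by (intro subringE(6)[OF intermD(1)[OF T]]) auto
    then show "z \<in> loc (T \<inter> U)"
      using loc_mem_iff[OF interm_Int[OF T U] xc x(3)] u x(1) by blast
  qed
qed

text \<open>Left to right by minimality of the generated ring: with V the right-hand side,
  \<open>num V\<close> is a ring containing T and U.\<close>

lemma loc_compositum:
  assumes T: "T \<in> interm R S" and U: "U \<in> interm R S"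
  shows "loc (compositum S T U) = compositum RB (loc T) (loc U)"
proof
  let ?V = "compositum RB (loc T) (loc U)"
  have V: "?V \<in> interm (loc R) RB" using L.compositum_interm loc_interm T U by blast
  have "frac x \<one> \<in> ?V" if "x \<in> T \<union> U" for x
    using that L.compositum_upper1[of "loc T" "loc U"] L.compositum_upper2[of "loc U" "loc T"]
      loc_memI[OF _ D_one] by blast
  then have "T \<subseteq> num ?V" "U \<subseteq> num ?V"
    using intermD(3)[OF T] intermD(3)[OF U] unfolding num_def by blast+
  then have "compositum S T U \<subseteq> num ?V"
    using intermD(1)[OF num_interm[OF V]] by (rule compositum_least)
  then show "loc (compositum S T U) \<subseteq> ?V" using loc_mono loc_num[OF V] by blast
  show "?V \<subseteq> loc (compositum S T U)"
    using loc_mono[OF compositum_upper1] loc_mono[OF compositum_upper2]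
      loc_subring[OF compositum_interm[OF T U]] by (rule L.compositum_least)
qed

lemma loc_boolean: "boolean_ext R S \<Longrightarrow> boolean_ext (loc R) RB"
  by (rule boolean_hom_image[OF is_cring R L.is_cring loc_R_subring loc_surj loc_mono loc_Int loc_compositum])

lemma loc_FIP: "FIP R S \<Longrightarrow> FIP (loc R) RB"
  unfolding FIP_def loc_surj[symmetric] by (rule finite_imageI)

lemma loc_M_unit:
  assumes "z \<in> loc R" "z \<notin> loc M"
  shows "\<exists>w\<in>loc R. z \<otimes>\<^bsub>RB\<^esub> w = \<one>\<^bsub>RB\<^esub>"
proof -
  obtain r s where rs: "z = frac r s" "r \<in> R" "s \<in> R - M" using assms(1) by (auto simp: loc_sub_def)
  then have "r \<in> R - M" using assms(2) loc_memI by blast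
  then have "frac s r \<in> loc R" "z \<otimes>\<^bsub>RB\<^esub> frac s r = \<one>\<^bsub>RB\<^esub>"
    using frac_unit[OF _ rs(3)] rs loc_memI[of s R r] by simp_all
  then show ?thesis by blast
qed

lemma frac_loc_M_iff:
  assumes "x \<in> carrier S" "s \<in> R - M"
  shows "frac x s \<in> loc M \<longleftrightarrow> (\<exists>u\<in>R - M. u \<otimes> x \<in> M)"
proof
  assume "frac x s \<in> loc M"
  then obtain y t where yt: "frac x s = frac y t" "y \<in> M" "t \<in> R - M" unfolding loc_sub_def by blast
  then obtain u where u: "u \<in> R - M" "u \<otimes> (t \<otimes> x) = u \<otimes> (s \<otimes> y)"
    using lfrac_eq_iff[of x y s t] assms by auto
  have "(u \<otimes> t) \<otimes> x = u \<otimes> (s \<otimes> y)" using u assms yt(3) by (simp add: m_assoc)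
  also have "\<dots> \<in> M" using u(1) assms(2) yt(2) by (intro ME(4)) auto
  finally show "\<exists>u\<in>R - M. u \<otimes> x \<in> M" using D_mult[OF u(1) yt(3)] by blast
next
  assume "\<exists>u\<in>R - M. u \<otimes> x \<in> M"
  then obtain u where u: "u \<in> R - M" "u \<otimes> x \<in> M" by blast
  have "frac x s = frac (u \<otimes> x) (u \<otimes> s)"
    using u assms by (intro lfrac_cong D_mult) (simp_all add: m_ac)
  then show "frac x s \<in> loc M" using loc_memI[OF u(2) D_mult[OF u(1) assms(2)]] by simp
qed

lemma loc_M_ideal: "ideal (loc M) (RB\<lparr>carrier := loc R\<rparr>)"
proof (rule L.ideal_of_subringI[OF loc_R_subring])
  show "loc M \<subseteq> loc R" by (rule loc_mono) (use ME(1) in blast)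
  show "\<zero>\<^bsub>RB\<^esub> \<in> loc M" unfolding loc_zero using ME(2) D_one by (rule loc_memI)
  show "z \<oplus>\<^bsub>RB\<^esub> w \<in> loc M" if zw0: "z \<in> loc M" "w \<in> loc M" for z w
  proof -
    obtain x s y t where zw: "z = frac x s" "x \<in> M" "s \<in> R - M" "w = frac y t" "y \<in> M" "t \<in> R - M"
      using zw0 unfolding loc_sub_def by blast
    then have "t \<otimes> x \<oplus> s \<otimes> y \<in> M" by (intro ME(3,4)) auto
    then show ?thesis using zw loc_memI[OF _ D_mult[OF zw(3,6)]] by simp
  qed
  show "z \<otimes>\<^bsub>RB\<^esub> w \<in> loc M" if zw0: "z \<in> loc R" "w \<in> loc M" for z w
  proof -
    obtain x s y t where zw: "z = frac x s" "x \<in> R" "s \<in> R - M" "w = frac y t" "y \<in> M" "t \<in> R - M"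
      using zw0 unfolding loc_sub_def by blast
    then have "x \<otimes> y \<in> M" by (intro ME(3,4)) auto
    then show ?thesis using zw loc_memI[OF _ D_mult[OF zw(3,6)]] by simp
  qed
qed

lemma one_notin_loc_M: "\<one>\<^bsub>RB\<^esub> \<notin> loc M"
proof
  assume "\<one>\<^bsub>RB\<^esub> \<in> loc M"
  then obtain u where "u \<in> R - M" "u \<otimes> \<one> \<in> M" using frac_loc_M_iff[OF one_closed D_one] by (auto simp: loc_one)
  then show False by simp
qed

end

section \<open>The local-global principle for Boolean extensions\<close>

context ambient_ring
begin

text \<open>The class of x vanishes in (S/R)_M exactly if some u outside M carries x into R. The
  proof checks this through the encodings of cosets and module fractions.\<close>

lemma MSupp_iff:
  assumes R: "subring R S"
  shows "M \<in> MSupp R S \<longleftrightarrow>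
    maximalideal M (S\<lparr>carrier := R\<rparr>) \<and> (\<exists>x\<in>carrier S. \<forall>u\<in>R - M. u \<otimes> x \<notin> R)"
proof (cases "maximalideal M (S\<lparr>carrier := R\<rparr>)")
  case False
  then show ?thesis by (simp add: MSupp_def)
next
  case True
  note RE = subringE[OF R] and Mmax = maximalideal_of_subringD[OF R True]
  have Rc: "x \<in> R \<Longrightarrow> x \<in> carrier S" for x using RE(1) by blast
  have sg: "subgroup R (add_monoid S)" using R by (simp add: subring.axioms(1))
  interpret Rg: abelian_subgroup R S
    by (rule abelian_subgroupI3) (use sg in \<open>auto simp: additive_subgroup_def is_abelian_group\<close>)
  define N where "N = quot_module R S"
  define D where "D = R - M"
  define Q where "Q = loc_module (S\<lparr>carrier := R\<rparr>) D N"
  have cos: "R +> x = R +> y" if "x \<ominus> y \<in> R" "x \<in> carrier S" "y \<in> carrier S" for x y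
  proof -
    have "x = (x \<ominus> y) \<oplus> y" using that by (simp add: minus_eq a_assoc l_neg)
    then have "x \<in> R +> y" using that(1) unfolding a_r_coset_def' by blast
    then show ?thesis using a_repr_independence[OF _ that(3) sg, of x] by simp
  qed
  have cos_R: "R +> x = R \<longleftrightarrow> x \<in> R" if "x \<in> carrier S" for x
    using a_coset_join1[OF _ that sg] a_coset_join2[OF that sg] by blast
  have cN: "carrier N = (\<lambda>x. R +> x) ` carrier S"
    by (auto simp: N_def quot_module_def A_RCOSETS_def')
  have smult: "r \<odot>\<^bsub>N\<^esub> (R +> x) = R +> (r \<otimes> x)" if r: "r \<in> R" and x: "x \<in> carrier S" for r x
  proof -
    have "R +> (r \<otimes> y) = R +> (r \<otimes> x)" if yx: "y \<in> R +> x" for y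
    proof -
      obtain q where q: "q \<in> R" "y = q \<oplus> x" using yx unfolding a_r_coset_def' by blast
      have "r \<otimes> (q \<oplus> x) \<ominus> r \<otimes> x = r \<otimes> q" using r x q(1)[THEN Rc] Rc[OF r]
        by (simp add: r_distr minus_eq a_assoc r_neg)
      then have "r \<otimes> y \<ominus> r \<otimes> x \<in> R" using RE(6)[OF r q(1)] q(2) by simp
      then show ?thesis using cos[of "r \<otimes> y" "r \<otimes> x"] r x q Rc by simp
    qed
    moreover have "x \<in> R +> x" using Rg.a_rcos_self[OF x] by simp
    ultimately have "(\<Union>y\<in>R +> x. R +> (r \<otimes> y)) = R +> (r \<otimes> x)" by blast
    then show ?thesis by (simp add: N_def quot_module_def)
  qed
  have zero: "\<zero>\<^bsub>N\<^esub> = R" "R +> \<zero> = R"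
    using cos_R[of \<zero>] RE(2) by (auto simp: N_def quot_module_def)
  have RN: "R \<in> carrier N" unfolding cN using zero(2) by (metis image_eqI zero_closed)
  have szero: "r \<odot>\<^bsub>N\<^esub> R = R" if "r \<in> R" for r
    using smult[OF that zero_closed] zero(2) that Rc by simp
  have D1: "\<one> \<in> D" and DR: "D \<subseteq> R" using RE(3) Mmax(1) by (auto simp: D_def)
  have Qc: "carrier Q = {mfrac N D c s | c s. c \<in> carrier N \<and> s \<in> D}"
    and Qz: "\<zero>\<^bsub>Q\<^esub> = mfrac N D R \<one>"
    using zero(1) by (auto simp: Q_def loc_module_def)
  have "carrier Q = {\<zero>\<^bsub>Q\<^esub>} \<longleftrightarrow> (\<forall>x\<in>carrier S. \<exists>u\<in>D. u \<otimes> x \<in> R)"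
  proof
    assume L: "carrier Q = {\<zero>\<^bsub>Q\<^esub>}"
    show "\<forall>x\<in>carrier S. \<exists>u\<in>D. u \<otimes> x \<in> R"
    proof
      fix x assume x: "x \<in> carrier S"
      then have "R +> x \<in> carrier N" using cN by blast
      then have "mfrac N D (R +> x) \<one> \<in> carrier Q" unfolding Qc using D1 by blast
      then have "mfrac N D (R +> x) \<one> = mfrac N D R \<one>" using L Qz by simp
      moreover have "(R +> x, \<one>) \<in> mfrac N D (R +> x) \<one>"
        using \<open>R +> x \<in> carrier N\<close> D1 unfolding mfrac_def by auto
      ultimately obtain u where u: "u \<in> D" "u \<odot>\<^bsub>N\<^esub> (\<one> \<odot>\<^bsub>N\<^esub> R) = u \<odot>\<^bsub>N\<^esub> (\<one> \<odot>\<^bsub>N\<^esub> (R +> x))"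
        unfolding mfrac_def by auto
      then have "R +> (u \<otimes> x) = R" using smult szero x RE(3) DR Rc by (auto simp: subset_iff)
      then show "\<exists>u\<in>D. u \<otimes> x \<in> R" using cos_R[of "u \<otimes> x"] u(1) DR Rc x by blast
    qed
  next
    assume *: "\<forall>x\<in>carrier S. \<exists>u\<in>D. u \<otimes> x \<in> R"
    \<comment> \<open>If every class is killed by an element of D, all fractions are equivalent, so
      each of them is the full set of pairs. For two classes the product of their killers u and v
      serves.\<close>
    have all: "mfrac N D c s = carrier N \<times> D" if "c \<in> carrier N" "s \<in> D" for c s
    proof -
      have "\<exists>u\<in>D. u \<odot>\<^bsub>N\<^esub> (t \<odot>\<^bsub>N\<^esub> c) = u \<odot>\<^bsub>N\<^esub> (s \<odot>\<^bsub>N\<^esub> d)" if dt: "d \<in> carrier N" "t \<in> D" for d t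
      proof -
        obtain x where x: "c = R +> x" "x \<in> carrier S" using \<open>c \<in> carrier N\<close> unfolding cN by (rule imageE)
        obtain y where y: "d = R +> y" "y \<in> carrier S" using dt(1) unfolding cN by (rule imageE)
        note xy = x(2,1) y(2,1)
        obtain u where u: "u \<in> D" "u \<otimes> x \<in> R" using bspec[OF * x(2)] by (rule bexE)
        obtain v where v: "v \<in> D" "v \<otimes> y \<in> R" using bspec[OF * y(2)] by (rule bexE)
        note uv = u v
        have st: "s \<in> R" "t \<in> R" "u \<in> R" "v \<in> R" using \<open>s \<in> D\<close> dt uv DR by blast+
        have "(u \<otimes> v) \<otimes> (t \<otimes> x) = (v \<otimes> t) \<otimes> (u \<otimes> x)" "(u \<otimes> v) \<otimes> (s \<otimes> y) = (u \<otimes> s) \<otimes> (v \<otimes> y)"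
          using st xy Rc by (simp_all add: m_ac)
        then have "(u \<otimes> v) \<otimes> (t \<otimes> x) \<in> R" "(u \<otimes> v) \<otimes> (s \<otimes> y) \<in> R"
          using RE(6)[OF RE(6)[OF st(4,2)] uv(2)] RE(6)[OF RE(6)[OF st(3,1)] uv(4)] by simp_all
        moreover have "(u \<otimes> v) \<odot>\<^bsub>N\<^esub> (t \<odot>\<^bsub>N\<^esub> c) = R +> ((u \<otimes> v) \<otimes> (t \<otimes> x))"
          "(u \<otimes> v) \<odot>\<^bsub>N\<^esub> (s \<odot>\<^bsub>N\<^esub> d) = R +> ((u \<otimes> v) \<otimes> (s \<otimes> y))"
          using xy st smult RE(6) Rc by simp_all
        moreover have "u \<otimes> v \<in> D" using uv st RE(6) Mmax(3) unfolding D_def by blast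
        ultimately show ?thesis using cos_R[OF Rc, THEN iffD2] by (intro bexI[of _ "u \<otimes> v"]) simp_all
      qed
      then show ?thesis unfolding mfrac_def by blast
    qed
    have "mfrac N D c s = mfrac N D R \<one>" if "c \<in> carrier N" "s \<in> D" for c s
      using all[OF that] all[OF RN D1] by simp
    then show "carrier Q = {\<zero>\<^bsub>Q\<^esub>}" unfolding Qc Qz using RN D1 by blast
  qed
  then show ?thesis using True unfolding MSupp_def by (auto simp: Q_def N_def D_def Let_def)
qed

lemma MSupp_localized:
  assumes "subring R S" "M \<in> MSupp R S"
  shows "localized_subring S R M"
  using assms MSupp_iff[OF assms(1)] ambient_ring_axioms
  by (simp add: localized_subring_def localized_subring_axioms_def)

text \<open>This ideal records where x becomes an element of U: for a maximal ideal M, x/1 lies in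
  U_M exactly if M does not contain the ideal.\<close>

lemma colon_ideal:
  assumes R: "subring R S" and U: "U \<in> interm R S" and x: "x \<in> carrier S"
  shows "ideal {r \<in> R. r \<otimes> x \<in> U} (S\<lparr>carrier := R\<rparr>)"
proof (rule ideal_of_subringI[OF R])
  note RE = subringE[OF R] and UE = subringE[OF intermD(1)[OF U]] and RU = intermD(2)[OF U]
  have Rc: "x \<in> R \<Longrightarrow> x \<in> carrier S" for x using RE(1) by blast
  show "{r \<in> R. r \<otimes> x \<in> U} \<subseteq> R" "\<zero> \<in> {r \<in> R. r \<otimes> x \<in> U}" using RE(2) UE(2) x by auto
  fix r s assume s: "s \<in> {r \<in> R. r \<otimes> x \<in> U}"
  show "r \<oplus> s \<in> {r \<in> R. r \<otimes> x \<in> U}" if r: "r \<in> {r \<in> R. r \<otimes> x \<in> U}"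
    using r s x RE(7) UE(7) Rc by (auto simp: l_distr)
  show "r \<otimes> s \<in> {r \<in> R. r \<otimes> x \<in> U}" if r: "r \<in> R"
    using r s x RE(6) UE(6)[of r "s \<otimes> x"] RU Rc by (auto simp: m_assoc)
qed

lemma MSupp_colonI:
  assumes R: "subring R S" and U: "U \<in> interm R S" and x: "x \<in> carrier S"
    and M: "maximalideal M (S\<lparr>carrier := R\<rparr>)" "{r \<in> R. r \<otimes> x \<in> U} \<subseteq> M"
  shows "M \<in> MSupp R S"
  using assms intermD(2)[OF U] unfolding MSupp_iff[OF R] by blast

section \<open>Gluing over the maximal ideals of R\<close>

text \<open>For x in T outside U the ideal (U : x) is proper, so it lies in a maximal ideal M. This
  M belongs to the support, and x/1 in U_M would put an element outside M into (U : x).\<close>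

lemma locally_subset:
  assumes R: "subring R S" and T: "T \<in> interm R S" and U: "U \<in> interm R S"
    and loc: "\<And>M. M \<in> MSupp R S \<Longrightarrow> loc_sub T S (R - M) \<subseteq> loc_sub U S (R - M)"
  shows "T \<subseteq> U"
proof
  fix x assume x: "x \<in> T"
  then have xc: "x \<in> carrier S" using intermD(3)[OF T] by blast
  interpret R: cring "S\<lparr>carrier := R\<rparr>" using subring_cring[OF R] .
  let ?J = "{r \<in> R. r \<otimes> x \<in> U}"
  show "x \<in> U"
  proof (rule ccontr)
    assume "x \<notin> U"
    then have "\<one>\<^bsub>S\<lparr>carrier := R\<rparr>\<^esub> \<notin> ?J" using xc by simp
    then obtain M where Mx: "maximalideal M (S\<lparr>carrier := R\<rparr>)" "?J \<subseteq> M"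
      using R.maximalideal_exists[OF colon_ideal[OF R U xc]] by blast
    have MS: "M \<in> MSupp R S" using MSupp_colonI[OF R U xc Mx] .
    interpret localized_subring S R M using MSupp_localized[OF R MS] .
    have "frac x \<one> \<in> loc U" using loc[OF MS] loc_memI[OF x D_one] by blast
    then show False using loc_mem_iff[OF U xc D_one] Mx(2) by blast
  qed
qed

text \<open>Descent on n: since a + b = 1, a^n x = a^(n+1) x + a^n (b x), and b x is already in
  U.\<close>

lemma comaximal_power:
  assumes R: "subring R S" and U: "U \<in> interm R S" and ab: "a \<in> R" "b \<in> R" "a \<oplus> b = \<one>"
    and x: "x \<in> carrier S" and "b \<otimes> x \<in> U" "a [^] (n::nat) \<otimes> x \<in> U"
  shows "x \<in> U"
  using assms(8)
proof (induction n)
  case 0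
  then show ?case using x by simp
next
  case (Suc n)
  note UE = subringE[OF intermD(1)[OF U]] and RU = intermD(2)[OF U]
  have c: "a \<in> carrier S" "b \<in> carrier S" "a \<in> U" using ab subringE(1)[OF R] RU by auto
  have pow: "a [^] k \<in> U" for k :: nat using c(3) UE(3,6) by (induction k) auto
  have "a [^] n \<otimes> x = a [^] n \<otimes> ((a \<oplus> b) \<otimes> x)" using ab(3) x by simp
  also have "\<dots> = a [^] Suc n \<otimes> x \<oplus> a [^] n \<otimes> (b \<otimes> x)"
    using c x by (simp add: l_distr r_distr m_assoc)
  also have "\<dots> \<in> U" using UE(6,7) Suc.prems assms(7) pow by blast
  finally show ?case using Suc.IH by blast
qed

text \<open>The part of V that falls into K once a is inverted. In a chain K, W, V without further
  rings it has to be one of the three.\<close>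

lemma power_torsion_interm:
  assumes R: "subring R S" and K: "K \<in> interm R S" and V: "V \<in> interm R S" and a: "a \<in> R"
  shows "{x \<in> V. \<exists>n::nat. a [^] n \<otimes> x \<in> K} \<in> interm R S" (is "?Y \<in> _")
proof (rule intermI[OF subringI])
  note KE = subringE[OF intermD(1)[OF K]] and VE = subringE[OF intermD(1)[OF V]]
  note RK = intermD(2)[OF K] and RV = intermD(2)[OF V]
  have c: "a \<in> carrier S" "a \<in> K" using a subringE(1)[OF R] RK by auto
  have pow: "a [^] k \<in> K" for k :: nat using c(2) KE(3,6) by (induction k) auto
  have Vc: "x \<in> V \<Longrightarrow> x \<in> carrier S" for x using VE(1) by blast
  show "?Y \<subseteq> carrier S" using VE(1) by blast
  have one: "a [^] (0::nat) \<otimes> x \<in> K" if "x \<in> K" "x \<in> carrier S" for x using that by simp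
  show "R \<subseteq> ?Y" using RK RV Vc one by blast
  then show "\<one> \<in> ?Y" using subringE(3)[OF R] by blast
  show "\<ominus> x \<in> ?Y" if xY: "x \<in> ?Y" for x
  proof -
    obtain n :: nat where n: "x \<in> V" "a [^] n \<otimes> x \<in> K" using xY by blast
    then have "a [^] n \<otimes> \<ominus> x \<in> K" using KE(5)[OF n(2)] c Vc by (simp add: r_minus)
    then show ?thesis using VE(5)[OF n(1)] by blast
  qed
  fix x y assume xy: "x \<in> ?Y" "y \<in> ?Y"
  then obtain n k :: nat where n: "x \<in> V" "y \<in> V" "a [^] n \<otimes> x \<in> K" "a [^] k \<otimes> y \<in> K" by blast
  have "a [^] (n + k) \<otimes> (x \<otimes> y) = (a [^] n \<otimes> x) \<otimes> (a [^] k \<otimes> y)"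
    using c n Vc by (simp add: nat_pow_mult[symmetric] m_ac)
  then have "a [^] (n + k) \<otimes> (x \<otimes> y) \<in> K" using KE(6)[OF n(3,4)] by simp
  then show "x \<otimes> y \<in> ?Y" using VE(6)[OF n(1,2)] by blast
  have "a [^] (n + k) \<otimes> (x \<oplus> y) = a [^] k \<otimes> (a [^] n \<otimes> x) \<oplus> a [^] n \<otimes> (a [^] k \<otimes> y)"
    using c n Vc by (simp add: nat_pow_mult[symmetric] m_ac r_distr)
  then have "a [^] (n + k) \<otimes> (x \<oplus> y) \<in> K" using KE(7)[OF KE(6)[OF pow n(3)] KE(6)[OF pow n(4)]] by simp
  then show "x \<oplus> y \<in> ?Y" using VE(7)[OF n(1,2)] by blast
qed

text \<open>
  For a chain \<open>K \<subset> W \<subset> V\<close> without further intermediate rings, the Boolean localizations force the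
  supports of \<open>W/K\<close> and \<open>V/W\<close> to be disjoint; a partition of unity then yields a ring strictly
  between \<open>K\<close> and \<open>V\<close> that is different from \<open>W\<close>.
\<close>

lemma locally_boolean_no_chain:
  assumes R: "subring R S"
    and bool: "\<And>M. M \<in> MSupp R S \<Longrightarrow> boolean_ext (sub_at R S M) (ring_at R S M)"
    and K: "K \<in> interm R S" and W: "W \<in> interm R S" and V: "V \<in> interm R S" and sub: "K \<subset> W" "W \<subset> V"
    and chain: "\<And>T. \<lbrakk>T \<in> interm R S; K \<subseteq> T; T \<subseteq> V\<rbrakk> \<Longrightarrow> T \<in> {K, W, V}"
  shows False
proof -
  obtain t s where t: "t \<in> W" "t \<notin> K" and s: "s \<in> V" "s \<notin> W" using sub by blast
  have tc: "t \<in> carrier S" and sc: "s \<in> carrier S" using t s intermD(3)[OF W] intermD(3)[OF V] by auto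
  have Rc: "x \<in> R \<Longrightarrow> x \<in> carrier S" for x using subringE(1)[OF R] by blast
  interpret R: cring "S\<lparr>carrier := R\<rparr>" using subring_cring[OF R] .
  \<comment> \<open>Annihilators of the class of t modulo K and of the class of s modulo W. A
    maximal ideal containing both would keep both steps of the chain strict after
    localization.\<close>
  define J1 where "J1 = {r \<in> R. r \<otimes> t \<in> K}"
  define J2 where "J2 = {r \<in> R. r \<otimes> s \<in> W}"
  note J1 = colon_ideal[OF R K tc, folded J1_def] and J2 = colon_ideal[OF R W sc, folded J2_def]
  define J where "J = J1 <+>\<^bsub>S\<lparr>carrier := R\<rparr>\<^esub> J2"
  have J: "ideal J (S\<lparr>carrier := R\<rparr>)" unfolding J_def by (rule R.add_ideals[OF J1 J2])
  have J_iff: "x \<in> J \<longleftrightarrow> (\<exists>a\<in>J1. \<exists>b\<in>J2. x = a \<oplus> b)" for x by (simp add: J_def set_add_def' Bex_def)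
  have "J1 \<subseteq> J" "J2 \<subseteq> J"
  proof -
    have z: "\<zero> \<in> J1" "\<zero> \<in> J2" using ideal_of_subringD(2)[OF R J1] ideal_of_subringD(2)[OF R J2] by auto
    show "J1 \<subseteq> J"
    proof
      fix x assume x: "x \<in> J1"
      then have "x = x \<oplus> \<zero>" using Rc by (simp add: J1_def)
      then show "x \<in> J" using x z J_iff by blast
    qed
    show "J2 \<subseteq> J"
    proof
      fix x assume x: "x \<in> J2"
      then have "x = \<zero> \<oplus> x" using Rc by (simp add: J2_def)
      then show "x \<in> J" using x z J_iff by blast
    qed
  qed
  have "\<one> \<in> J"
  proof (rule ccontr)
    assume "\<one> \<notin> J"
    then obtain M where Mx: "maximalideal M (S\<lparr>carrier := R\<rparr>)" "J \<subseteq> M"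
      using R.maximalideal_exists[OF J] by auto
    from Mx(2) have JM: "J1 \<subseteq> M" "J2 \<subseteq> M" using \<open>J1 \<subseteq> J\<close> \<open>J2 \<subseteq> J\<close> by auto
    have MS: "M \<in> MSupp R S" using MSupp_colonI[OF R K tc Mx(1)] JM(1) by (simp add: J1_def)
    interpret localized_subring S R M using MSupp_localized[OF R MS] .
    have "frac t \<one> \<in> loc W" "frac t \<one> \<notin> loc K" "frac s \<one> \<in> loc V" "frac s \<one> \<notin> loc W"
      using loc_memI[OF _ D_one] t s loc_mem_iff[OF K tc D_one] loc_mem_iff[OF W sc D_one] JM
      by (auto simp: J1_def J2_def)
    then have ne: "loc K \<noteq> loc W" "loc W \<noteq> loc V" by auto
    obtain Z where Z: "Z \<in> interm (loc R) RB" "loc K \<subseteq> Z" "Z \<subseteq> loc V" "Z \<inter> loc W = loc K"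
        "compositum RB Z (loc W) = loc V"
      using L.boolean_relative_complement[OF bool[OF MS] loc_interm[OF K] loc_interm[OF W] loc_interm[OF V]]
        loc_mono sub by blast
    \<comment> \<open>Z is a complement of W_M between K_M and V_M. The ring defined here lies
      between K and V and localizes to Z, so Z would be K_M, W_M or V_M, none of which is a
      complement of W_M.\<close>
    define Z' where "Z' = compositum S K (num Z \<inter> V)"
    note nZ = num_interm[OF Z(1)] and nZV = interm_Int[OF num_interm[OF Z(1)] V]
    have "Z' \<in> interm R S" unfolding Z'_def by (rule compositum_interm[OF K nZV])
    moreover have "K \<subseteq> Z'" unfolding Z'_def by (rule compositum_upper1)
    moreover have "Z' \<subseteq> V" unfolding Z'_def
      by (rule compositum_least) (use sub intermD(1)[OF V] in auto)
    ultimately have Z': "Z' = K \<or> Z' = W \<or> Z' = V" using chain by blast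
    have "loc Z' = compositum RB (loc K) (Z \<inter> loc V)"
      unfolding Z'_def loc_compositum[OF K nZV] loc_Int[OF nZ V] loc_num[OF Z(1)] ..
    also have "\<dots> = Z" using Z(2,3) L.compositum_absorb[OF Z(2) intermD(1)[OF Z(1)]] by (simp add: Int_absorb2)
    finally have "Z = loc K \<or> Z = loc W \<or> Z = loc V" using Z' by auto
    moreover have "loc K \<subseteq> loc W" "loc W \<subseteq> loc V" using loc_mono sub by auto
    ultimately show False
      using ne Z(4,5) L.compositum_absorb[OF \<open>loc K \<subseteq> loc W\<close> loc_subring[OF W]] by auto
  qed
  then obtain a b where ab: "a \<in> R" "b \<in> R" "a \<oplus> b = \<one>" "a \<otimes> t \<in> K" "b \<otimes> s \<in> W"
    using J_iff by (auto simp: J1_def J2_def)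
  have ac: "a \<in> carrier S" "b \<in> carrier S" using ab Rc by auto
  have ba: "b \<oplus> a = \<one>" using ab(3) ac by (simp add: a_comm)
  have Ysub: "K \<subseteq> {x \<in> U. \<exists>n::nat. c [^] n \<otimes> x \<in> K}" if "K \<subseteq> U" for U c
  proof
    fix x assume x: "x \<in> K"
    then have "c [^] (0::nat) \<otimes> x \<in> K" using intermD(3)[OF K] by auto
    then show "x \<in> {x \<in> U. \<exists>n::nat. c [^] n \<otimes> x \<in> K}" using x \<open>K \<subseteq> U\<close> by blast
  qed
  \<comment> \<open>This ring contains t, which is not in K, and lies in W, so it is W: every
    element of W is carried into K by a power of a.\<close>
  let ?Y = "{x \<in> W. \<exists>n::nat. a [^] n \<otimes> x \<in> K}"
  have "a [^] (1::nat) \<otimes> t \<in> K" using ab(4) ac by simp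
  then have tY: "t \<in> ?Y" using t(1) by blast
  have "?Y \<in> {K, W, V}"
    by (rule chain[OF power_torsion_interm[OF R K W ab(1)] Ysub]) (use sub in auto)
  then have "?Y = W" using tY t(2) sub by blast
  then obtain n :: nat where n: "a [^] n \<otimes> (b \<otimes> s) \<in> K" using ab(5) by blast
  \<comment> \<open>a^n s is still outside W, because a^n s and b s in W would give s in W; yet b
    carries it into K. Hence the corresponding ring for b is all of V.\<close>
  let ?s = "a [^] n \<otimes> s"
  have "s \<in> W" if "?s \<in> W" using comaximal_power[OF R W ab(1-3) sc ab(5) that] .
  then have s': "?s \<notin> W" using s(2) by blast
  have "?s \<in> V"
  proof -
    note VE = subringE[OF intermD(1)[OF V]]
    have "a \<in> V" using intermD(2)[OF V] ab(1) by blast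
    then have "a [^] n \<in> V" using VE(3,6) by (induction n) auto
    then show ?thesis using VE(6) s(1) by blast
  qed
  moreover have "b [^] (1::nat) \<otimes> ?s \<in> K" using n ac sc by (simp add: m_ac)
  ultimately have sY: "?s \<in> {x \<in> V. \<exists>n::nat. b [^] n \<otimes> x \<in> K}" (is "_ \<in> ?Y'") by blast
  have "?Y' \<in> {K, W, V}"
    by (rule chain[OF power_torsion_interm[OF R K V ab(2)] Ysub]) (use sub in auto)
  then have "?Y' = V" using sY s' sub by blast
  \<comment> \<open>Now a t and some b^m t lie in K, and a + b = 1.\<close>
  then obtain m :: nat where "b [^] m \<otimes> t \<in> K" using t(1) sub by blast
  then have "t \<in> K" using comaximal_power[OF R K ab(2,1) ba tc ab(4)] by blast
  then show False using t(2) by blast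
qed

text \<open>The distributive law is checked at each M by \<open>locally_subset\<close>. Complements
  come from the absence of two-step chains.\<close>

theorem boolean_iff_locally:
  assumes R: "subring R S" and fip: "FIP R S"
  shows "boolean_ext R S \<longleftrightarrow> (\<forall>M\<in>MSupp R S. boolean_ext (sub_at R S M) (ring_at R S M))"
proof
  assume "boolean_ext R S"
  then show "\<forall>M\<in>MSupp R S. boolean_ext (sub_at R S M) (ring_at R S M)"
    using localized_subring.loc_boolean[OF MSupp_localized[OF R]] by blast
next
  assume bool: "\<forall>M\<in>MSupp R S. boolean_ext (sub_at R S M) (ring_at R S M)"
  show "boolean_ext R S"
  proof (rule boolean_if_no_chain[OF R fip])
    show "distributive_ext R S"
      unfolding distributive_ext_def
    proof (intro ballI)
      fix T U V assume T: "T \<in> interm R S" and U: "U \<in> interm R S" and V: "V \<in> interm R S"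
      note I = interm_Int[OF T U] interm_Int[OF T V] compositum_interm[OF U V]
      note C = compositum_interm[OF I(1,2)] interm_Int[OF T I(3)]
      have "loc_sub (T \<inter> compositum S U V) S (R - M) = loc_sub (compositum S (T \<inter> U) (T \<inter> V)) S (R - M)"
        if "M \<in> MSupp R S" for M
      proof -
        interpret localized_subring S R M using MSupp_localized[OF R that] .
        have "distributive_ext (loc R) RB" using bool that by (simp add: boolean_ext_def)
        then show ?thesis
          using L.distributiveD[OF _ loc_interm[OF T] loc_interm[OF U] loc_interm[OF V]]
          by (simp only: loc_Int[OF T I(3)] loc_compositum[OF U V] loc_compositum[OF I(1,2)] loc_Int[OF T U] loc_Int[OF T V])
      qed
      then show "T \<inter> compositum S U V = compositum S (T \<inter> U) (T \<inter> V)"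
        by (intro subset_antisym locally_subset[OF R C(2,1)] locally_subset[OF R C(1,2)]) simp_all
    qed
  next
    fix K W V assume *: "K \<in> interm R S" "W \<in> interm R S" "V \<in> interm R S" "K \<subset> W" "W \<subset> V"
      "\<And>T. \<lbrakk>T \<in> interm R S; K \<subseteq> T; T \<subseteq> V\<rbrakk> \<Longrightarrow> T \<in> {K, W, V}"
    show False by (rule locally_boolean_no_chain[OF R bspec[OF bool] *])
  qed
qed

end

section \<open>Atoms over a local subring\<close>

text \<open>A is local with maximal ideal m, expressed by elements of S. The locale thus applies to
  R_M inside S_M and also to larger local subrings of the same S with the same m.\<close>

locale local_subring = ambient_ring S for S (structure) +
  fixes A m
  assumes A: "subring A S"
    and m_ideal: "ideal m (S\<lparr>carrier := A\<rparr>)"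
    and one_notin_m: "\<one> \<notin> m"
    and m_unit: "\<lbrakk>a \<in> A; a \<notin> m\<rbrakk> \<Longrightarrow> \<exists>b\<in>A. a \<otimes> b = \<one>"
begin

lemmas AE = subringE[OF A]
lemmas mE = ideal_of_subringD[OF A m_ideal]

lemma A_carrier [simp]: "a \<in> A \<Longrightarrow> a \<in> carrier S"
  using AE(1) by blast

lemma m_A [simp]: "a \<in> m \<Longrightarrow> a \<in> A"
  using mE(1) by blast

lemma A_closed [simp]: "\<zero> \<in> A" "\<one> \<in> A" "a \<in> A \<Longrightarrow> \<ominus> a \<in> A"
  "\<lbrakk>a \<in> A; b \<in> A\<rbrakk> \<Longrightarrow> a \<oplus> b \<in> A" "\<lbrakk>a \<in> A; b \<in> A\<rbrakk> \<Longrightarrow> a \<otimes> b \<in> A" "\<lbrakk>a \<in> A; b \<in> A\<rbrakk> \<Longrightarrow> a \<ominus> b \<in> A"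
  using AE by (auto simp: minus_eq)

lemma A_pow [simp]: "a \<in> A \<Longrightarrow> a [^] (n::nat) \<in> A"
  by (induction n) auto

lemma m_mult_left: "\<lbrakk>a \<in> A; b \<in> m\<rbrakk> \<Longrightarrow> a \<otimes> b \<in> m"
  using mE(4) by blast

lemma m_mult_right: "\<lbrakk>b \<in> m; a \<in> A\<rbrakk> \<Longrightarrow> b \<otimes> a \<in> m"
  using mE(4)[of a b] m_comm[of b a] by simp

lemma m_uminus: "a \<in> m \<Longrightarrow> \<ominus> a \<in> m"
  using m_mult_left[of "\<ominus> \<one>" a] by (simp add: l_minus)

lemma m_closed [simp]: "\<zero> \<in> m" "\<lbrakk>a \<in> m; b \<in> m\<rbrakk> \<Longrightarrow> a \<oplus> b \<in> m" "a \<in> m \<Longrightarrow> \<ominus> a \<in> m"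
  "\<lbrakk>a \<in> A; b \<in> m\<rbrakk> \<Longrightarrow> a \<otimes> b \<in> m" "\<lbrakk>b \<in> m; a \<in> A\<rbrakk> \<Longrightarrow> b \<otimes> a \<in> m"
  "\<lbrakk>a \<in> m; b \<in> m\<rbrakk> \<Longrightarrow> a \<ominus> b \<in> m"
  using mE(2,3) m_mult_left m_mult_right m_uminus by (auto simp: minus_eq)

lemma m_prime: "\<lbrakk>a \<in> A; b \<in> A; a \<otimes> b \<in> m\<rbrakk> \<Longrightarrow> a \<in> m \<or> b \<in> m"
proof (rule ccontr)
  assume ab: "a \<in> A" "b \<in> A" "a \<otimes> b \<in> m" and "\<not> (a \<in> m \<or> b \<in> m)"
  then obtain c d where cd: "c \<in> A" "a \<otimes> c = \<one>" "d \<in> A" "b \<otimes> d = \<one>" using m_unit by blast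
  have car: "a \<in> carrier S" "b \<in> carrier S" "c \<in> carrier S" "d \<in> carrier S" using ab cd by auto
  have "(c \<otimes> d) \<otimes> (a \<otimes> b) = (a \<otimes> c) \<otimes> (b \<otimes> d)" using car by (simp add: m_ac)
  then have "(c \<otimes> d) \<otimes> (a \<otimes> b) = \<one>" using cd by simp
  then show False using m_mult_left[of "c \<otimes> d", OF _ ab(3)] cd one_notin_m by simp
qed

lemma one_minus_unit:
  assumes "a \<in> m" shows "\<exists>b\<in>A. (\<one> \<ominus> a) \<otimes> b = \<one>"
proof (rule m_unit)
  have c: "a \<in> carrier S" using assms by simp
  have "(\<one> \<ominus> a) \<oplus> a = \<one>" using c by algebra
  then show "\<one> \<ominus> a \<notin> m" using m_closed(2)[OF _ assms, of "\<one> \<ominus> a"] one_notin_m by auto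
qed (use assms in simp)

lemma unit_or_one_minus_unit:
  assumes "a \<in> A" shows "a \<notin> m \<or> \<one> \<ominus> a \<notin> m"
proof -
  have c: "a \<in> carrier S" using assms by simp
  have "(\<one> \<ominus> a) \<oplus> a = \<one>" using c by algebra
  then show ?thesis using m_closed(2)[of "\<one> \<ominus> a" a] one_notin_m by auto
qed

lemma unit_cancel:
  assumes T: "subring T S" "A \<subseteq> T" and "u \<in> A" "u \<notin> m" "x \<in> carrier S" "u \<otimes> x \<in> T"
  shows "x \<in> T"
proof -
  obtain w where w: "w \<in> A" "u \<otimes> w = \<one>" using m_unit assms(3,4) by blast
  have c: "u \<in> carrier S" "w \<in> carrier S" using assms w by auto
  have "w \<otimes> (u \<otimes> x) = (u \<otimes> w) \<otimes> x" using c assms(5) by (simp add: m_ac)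
  then have "w \<otimes> (u \<otimes> x) = x" using w(2) assms(5) by simp
  moreover have "w \<otimes> (u \<otimes> x) \<in> T" using subringE(6)[OF T(1)] T(2) w(1) assms(6) by blast
  ultimately show ?thesis by simp
qed

lemmas unit_cancel_A = unit_cancel[OF A subset_refl]

lemma unit_cancel_m:
  assumes "u \<in> A" "u \<notin> m" "x \<in> carrier S" "u \<otimes> x \<in> m"
  shows "x \<in> m"
  using unit_cancel_A[of u x] m_prime[of u x] assms by auto

text \<open>For a ring T between A and S this says that m is an ideal of T, so that T/m is an
  algebra over the field A/m.\<close>

definition absorbs :: "'a set \<Rightarrow> bool"
  where "absorbs T \<longleftrightarrow> (\<forall>a\<in>m. \<forall>x\<in>T. a \<otimes> x \<in> m)"

lemma absorbsD: "\<lbrakk>absorbs T; a \<in> m; x \<in> T\<rbrakk> \<Longrightarrow> a \<otimes> x \<in> m"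
  by (simp add: absorbs_def)

section \<open>Intermediate rings with explicit carriers\<close>

text \<open>The common source of the test rings A + x T, A + A z and A + m A[t].\<close>

lemma module_extension_interm:
  assumes J: "J \<subseteq> carrier S" "\<zero> \<in> J" "\<And>x y. x \<in> J \<Longrightarrow> y \<in> J \<Longrightarrow> x \<oplus> y \<in> J"
    and scale: "\<And>r x. r \<in> A \<Longrightarrow> x \<in> J \<Longrightarrow> r \<otimes> x \<in> J"
    and mult: "\<And>x y. x \<in> J \<Longrightarrow> y \<in> J \<Longrightarrow> \<exists>a\<in>A. \<exists>z\<in>J. x \<otimes> y = a \<oplus> z"
  shows "{a \<oplus> x | a x. a \<in> A \<and> x \<in> J} \<in> interm A S" (is "?E \<in> _")
proof -
  have I: "a \<oplus> x \<in> ?E" if "a \<in> A" "x \<in> J" for a x using that by blast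
  have Jc: "x \<in> J \<Longrightarrow> x \<in> carrier S" for x using J(1) by blast
  have AE': "A \<subseteq> ?E"
  proof
    fix a assume a: "a \<in> A"
    then have "a \<oplus> \<zero> = a" by simp
    then show "a \<in> ?E" using I[OF a J(2)] by (simp only:)
  qed
  show ?thesis
  proof (rule intermI[OF subringI AE'])
    show "?E \<subseteq> carrier S" using Jc by auto
    show "\<one> \<in> ?E" using AE' A_closed(2) by blast
    fix u assume "u \<in> ?E"
    then obtain a x where u: "u = a \<oplus> x" "a \<in> A" "x \<in> J" by blast
    have uc: "a \<in> carrier S" "x \<in> carrier S" using u Jc by auto
    have "\<ominus> u = \<ominus> a \<oplus> \<ominus> \<one> \<otimes> x" using uc unfolding u(1) by algebra
    then show "\<ominus> u \<in> ?E" using I[OF A_closed(3)[OF u(2)] scale[OF A_closed(3)[OF A_closed(2)] u(3)]] by simp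
    fix v assume "v \<in> ?E"
    then obtain b y where v: "v = b \<oplus> y" "b \<in> A" "y \<in> J" by blast
    have vc: "b \<in> carrier S" "y \<in> carrier S" using v Jc by auto
    have "u \<oplus> v = (a \<oplus> b) \<oplus> (x \<oplus> y)" using uc vc unfolding u(1) v(1) by algebra
    then show "u \<oplus> v \<in> ?E" using I[OF A_closed(4)[OF u(2) v(2)] J(3)[OF u(3) v(3)]] by simp
    obtain c z where z: "x \<otimes> y = c \<oplus> z" "c \<in> A" "z \<in> J" using mult[OF u(3) v(3)] by blast
    have zc: "c \<in> carrier S" "z \<in> carrier S" using z Jc by auto
    have "u \<otimes> v = (a \<otimes> b) \<oplus> (a \<otimes> y \<oplus> b \<otimes> x) \<oplus> x \<otimes> y" using uc vc unfolding u(1) v(1) by algebra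
    also have "\<dots> = (a \<otimes> b \<oplus> c) \<oplus> ((a \<otimes> y \<oplus> b \<otimes> x) \<oplus> z)" using uc vc zc unfolding z(1) by algebra
    finally show "u \<otimes> v \<in> ?E"
      using I[OF A_closed(4)[OF A_closed(5)[OF u(2) v(2)] z(2)]
          J(3)[OF J(3)[OF scale[OF u(2) v(3)] scale[OF v(2) u(3)]] z(3)]] by simp
  qed
qed

lemma adjoin_multiples_interm:
  assumes T: "T \<in> interm A S" and x: "x \<in> carrier S"
    and sq: "\<And>g. g \<in> T \<Longrightarrow> \<exists>a\<in>A. \<exists>h\<in>T. (x \<otimes> x) \<otimes> g = a \<oplus> x \<otimes> h"
  shows "{c \<oplus> x \<otimes> g | c g. c \<in> A \<and> g \<in> T} \<in> interm A S"
proof -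
  note TE = subringE[OF intermD(1)[OF T]] and AT = intermD(2)[OF T]
  have Tc: "y \<in> T \<Longrightarrow> y \<in> carrier S" for y using TE(1) by blast
  let ?J = "{x \<otimes> g | g. g \<in> T}"
  have J: "x \<otimes> g \<in> ?J" if "g \<in> T" for g using that by blast
  have "{a \<oplus> y | a y. a \<in> A \<and> y \<in> ?J} \<in> interm A S"
  proof (rule module_extension_interm)
    show "?J \<subseteq> carrier S" using x Tc by auto
    show "\<zero> \<in> ?J" using J[OF TE(2)] x by simp
    fix u v assume "v \<in> ?J"
    then obtain h where v: "v = x \<otimes> h" "h \<in> T" by blast
    {
      assume "u \<in> ?J"
      then obtain g where u: "u = x \<otimes> g" "g \<in> T" by blast
      have c: "x \<in> carrier S" "g \<in> carrier S" "h \<in> carrier S" using u v x Tc by auto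
      show "u \<oplus> v \<in> ?J" using J[OF TE(7)[OF u(2) v(2)]] c unfolding u(1) v(1) by (simp add: r_distr)
      obtain a k where k: "a \<in> A" "k \<in> T" "(x \<otimes> x) \<otimes> (g \<otimes> h) = a \<oplus> x \<otimes> k"
        using sq[OF TE(6)[OF u(2) v(2)]] by blast
      have "u \<otimes> v = (x \<otimes> x) \<otimes> (g \<otimes> h)" using c unfolding u(1) v(1) by algebra
      then show "\<exists>a\<in>A. \<exists>z\<in>?J. u \<otimes> v = a \<oplus> z" unfolding k(3) using k(1) J[OF k(2)] by blast
    next
      assume u: "u \<in> A"
      then have "u \<otimes> v = x \<otimes> (u \<otimes> h)" using v x Tc by (simp add: m_lcomm)
      then show "u \<otimes> v \<in> ?J" using J[OF TE(6)[OF _ v(2)], of u] u AT by auto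
    }
  qed
  moreover have "{a \<oplus> y | a y. a \<in> A \<and> y \<in> ?J} = {c \<oplus> x \<otimes> g | c g. c \<in> A \<and> g \<in> T}" by blast
  ultimately show ?thesis by simp
qed

text \<open>Typically applied to x = t^2 with t in an atom D: unless t^2 lies in A, D equals A + t^2
  D, and t satisfies t = c + t^2 g.\<close>

lemma adjoin_interm:
  assumes T: "T \<in> interm A S" and x: "x \<in> T"
  shows "{c \<oplus> x \<otimes> g | c g. c \<in> A \<and> g \<in> T} \<in> interm A S"
    and "{c \<oplus> x \<otimes> g | c g. c \<in> A \<and> g \<in> T} \<subseteq> T"
proof -
  note TE = subringE[OF intermD(1)[OF T]] and AT = intermD(2)[OF T]
  have xc: "x \<in> carrier S" using x TE(1) by blast
  show "{c \<oplus> x \<otimes> g | c g. c \<in> A \<and> g \<in> T} \<in> interm A S"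
  proof (rule adjoin_multiples_interm[OF T xc])
    fix g assume g: "g \<in> T"
    then have "(x \<otimes> x) \<otimes> g = \<zero> \<oplus> x \<otimes> (x \<otimes> g)" using xc TE(1) by (auto simp: m_assoc)
    then show "\<exists>a\<in>A. \<exists>h\<in>T. (x \<otimes> x) \<otimes> g = a \<oplus> x \<otimes> h" using A_closed(1) TE(6)[OF x g] by blast
  qed
  show "{c \<oplus> x \<otimes> g | c g. c \<in> A \<and> g \<in> T} \<subseteq> T"
  proof clarify
    fix c g assume "c \<in> A" "g \<in> T"
    then show "c \<oplus> x \<otimes> g \<in> T" using x AT by (intro TE(6,7)) auto
  qed
qed

text \<open>The polynomials in \<open>t\<close> of degree less than \<open>n\<close> with coefficients in \<open>I\<close>.\<close>

primrec psums :: "'a set \<Rightarrow> 'a \<Rightarrow> nat \<Rightarrow> 'a set" where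
  "psums I t 0 = {\<zero>}"
| "psums I t (Suc n) = {x \<oplus> a \<otimes> t [^] n | x a. x \<in> psums I t n \<and> a \<in> I}"

lemma psums_carrier:
  assumes "I \<subseteq> A" "t \<in> carrier S" shows "x \<in> psums I t n \<Longrightarrow> x \<in> carrier S"
  using assms(1) assms(2)[THEN nat_pow_closed] by (induction n arbitrary: x) (auto simp: subset_iff)

lemma psums_add:
  assumes "I \<subseteq> A" "t \<in> carrier S" and I: "\<And>a b. a \<in> I \<Longrightarrow> b \<in> I \<Longrightarrow> a \<oplus> b \<in> I"
  shows "x \<in> psums I t n \<Longrightarrow> y \<in> psums I t n \<Longrightarrow> x \<oplus> y \<in> psums I t n"
proof (induction n arbitrary: x y)
  case (Suc n)
  then obtain x' a y' b where xy: "x = x' \<oplus> a \<otimes> t [^] n" "y = y' \<oplus> b \<otimes> t [^] n"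
    "x' \<in> psums I t n" "y' \<in> psums I t n" "a \<in> I" "b \<in> I" by auto
  have "x \<oplus> y = (x' \<oplus> y') \<oplus> (a \<oplus> b) \<otimes> t [^] n"
    using xy psums_carrier[OF assms(1,2)] assms(1,2) by (auto simp: l_distr a_ac subset_iff)
  then show ?case using Suc.IH[OF xy(3,4)] I[OF xy(5,6)] by auto
qed auto

lemma psums_add_A: "\<lbrakk>t \<in> carrier S; x \<in> psums A t n; y \<in> psums A t n\<rbrakk> \<Longrightarrow> x \<oplus> y \<in> psums A t n"
  using psums_add[OF subset_refl _ A_closed(4)] by blast

lemma psums_add_m: "\<lbrakk>t \<in> carrier S; x \<in> psums m t n; y \<in> psums m t n\<rbrakk> \<Longrightarrow> x \<oplus> y \<in> psums m t n"
  by (rule psums_add[OF mE(1)]) simp_all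

lemma psums_scale:
  assumes "I \<subseteq> A" "t \<in> carrier S" "r \<in> A" and I: "\<And>a. a \<in> I \<Longrightarrow> r \<otimes> a \<in> J"
  shows "x \<in> psums I t n \<Longrightarrow> r \<otimes> x \<in> psums J t n"
proof (induction n arbitrary: x)
  case (Suc n)
  then obtain x' a where x: "x = x' \<oplus> a \<otimes> t [^] n" "x' \<in> psums I t n" "a \<in> I" by auto
  have "r \<otimes> x = r \<otimes> x' \<oplus> (r \<otimes> a) \<otimes> t [^] n"
    using x psums_carrier[OF assms(1,2)] assms(1,2,3) by (auto simp: r_distr m_assoc subset_iff)
  then show ?case using Suc.IH[OF x(2)] I[OF x(3)] by auto
qed (use assms(3) in auto)

lemma psums_Suc_mono:
  assumes "I \<subseteq> A" "t \<in> carrier S" "\<zero> \<in> I"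
  shows "psums I t n \<subseteq> psums I t (Suc n)"
proof
  fix x assume x: "x \<in> psums I t n"
  then have "x = x \<oplus> \<zero> \<otimes> t [^] n" using psums_carrier[OF assms(1,2) x] assms by simp
  then show "x \<in> psums I t (Suc n)" using x assms(3) by auto
qed

lemma psums_mono:
  assumes "I \<subseteq> A" "t \<in> carrier S" "\<zero> \<in> I" "n \<le> k"
  shows "psums I t n \<subseteq> psums I t k"
  using assms(4) by (rule lift_Suc_mono_le[of "psums I t", OF psums_Suc_mono[OF assms(1-3)]])

lemma psums_term:
  assumes "I \<subseteq> A" "t \<in> carrier S" "\<zero> \<in> I" "a \<in> I"
  shows "a \<otimes> t [^] n \<in> psums I t (Suc n)"
proof -
  have "\<zero> \<in> psums I t n" using psums_mono[OF assms(1-3), of 0 n] by auto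
  moreover have "a \<otimes> t [^] n = \<zero> \<oplus> a \<otimes> t [^] n" using assms by (auto simp: subset_iff)
  ultimately show ?thesis using assms(4) by auto
qed

lemma psums_shift:
  assumes "I \<subseteq> A" "t \<in> carrier S" "\<zero> \<in> I"
  shows "x \<in> psums I t n \<Longrightarrow> t \<otimes> x \<in> psums I t (Suc n)"
proof (induction n arbitrary: x)
  case 0
  then show ?case using assms psums_term[OF assms assms(3), of 0] by auto
next
  case (Suc n)
  then obtain x' a where x: "x = x' \<oplus> a \<otimes> t [^] n" "x' \<in> psums I t n" "a \<in> I" by auto
  have "t \<otimes> x = t \<otimes> x' \<oplus> a \<otimes> t [^] Suc n"
    using x psums_carrier[OF assms(1,2)] assms(1,2) by (auto simp: r_distr m_ac subset_iff)
  moreover have "t \<otimes> x' \<in> psums I t (Suc n)" using Suc.IH x by blast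
  ultimately show ?case using x(3) psums.simps(2)[of I t "Suc n"] by blast
qed

lemma psums_mult:
  assumes "I \<subseteq> A" "t \<in> carrier S" "\<zero> \<in> I"
    and add: "\<And>a b. a \<in> I \<Longrightarrow> b \<in> I \<Longrightarrow> a \<oplus> b \<in> I" and scale: "\<And>r a. r \<in> A \<Longrightarrow> a \<in> I \<Longrightarrow> r \<otimes> a \<in> I"
    and y: "y \<in> psums I t k"
  shows "x \<in> psums A t n \<Longrightarrow> x \<otimes> y \<in> psums I t (n + k)"
proof (induction n arbitrary: x)
  case 0
  then show ?case using psums_carrier[OF assms(1,2) y] psums_mono[OF assms(1-3), of 0 k] by auto
next
  case (Suc n)
  then obtain x' a where x: "x = x' \<oplus> a \<otimes> t [^] n" "x' \<in> psums A t n" "a \<in> A" by auto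
  note c = psums_carrier[OF subset_refl assms(2) x(2)] psums_carrier[OF assms(1,2) y]
  have "t [^] n \<otimes> y \<in> psums I t (n + k)"
  proof (induction n)
    case (Suc n)
    then show ?case using psums_shift[OF assms(1-3) Suc] assms(2) c by (simp add: m_ac)
  qed (use y c in simp)
  then have "a \<otimes> (t [^] n \<otimes> y) \<in> psums I t (n + k)" using psums_scale[OF assms(1,2) x(3)] scale x(3) by blast
  then have "x' \<otimes> y \<oplus> a \<otimes> (t [^] n \<otimes> y) \<in> psums I t (n + k)"
    using psums_add[OF assms(1,2) add Suc.IH[OF x(2)]] by blast
  moreover have "x \<otimes> y = x' \<otimes> y \<oplus> a \<otimes> (t [^] n \<otimes> y)"
    using x c assms(2) by (simp add: l_distr m_assoc)
  ultimately show ?case using psums_Suc_mono[OF assms(1-3), of "n + k"] by auto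
qed

lemma psums_subset_subring:
  assumes "T \<in> interm A S" "t \<in> T"
  shows "psums A t n \<subseteq> T"
proof (induction n)
  case 0
  then show ?case using subringE(2)[OF intermD(1)[OF assms(1)]] by simp
next
  case (Suc n)
  note TE = subringE[OF intermD(1)[OF assms(1)]]
  have "t [^] k \<in> T" for k :: nat using assms(2) TE(3,6) by (induction k) auto
  then show ?case using Suc TE(6,7) intermD(2)[OF assms(1)] by (auto simp: subset_iff)
qed

lemma psums_union_interm:
  assumes t: "t \<in> carrier S"
  shows "(\<Union>n. psums A t n) \<in> interm A S"
proof (rule intermI[OF subringI])
  let ?Q = "\<Union>n. psums A t n"
  show "?Q \<subseteq> carrier S" using psums_carrier[OF subset_refl t] by blast
  show AQ: "A \<subseteq> ?Q"
  proof
    fix a assume "a \<in> A"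
    then have "a \<otimes> t [^] (0::nat) \<in> psums A t (Suc 0)" by (intro psums_term) (use t in auto)
    then show "a \<in> ?Q" using \<open>a \<in> A\<close> by (intro UN_I[of "Suc 0"]) simp_all
  qed
  then show "\<one> \<in> ?Q" using A_closed(2) by blast
  fix x assume "x \<in> ?Q"
  then obtain n where x: "x \<in> psums A t n" by blast
  have "\<ominus> \<one> \<otimes> x \<in> psums A t n" by (rule psums_scale[OF subset_refl t _ _ x]) simp_all
  then show "\<ominus> x \<in> ?Q" using psums_carrier[OF subset_refl t x] by (auto simp: l_minus)
  fix y assume "y \<in> ?Q"
  then obtain k where y: "y \<in> psums A t k" by blast
  show "x \<otimes> y \<in> ?Q" using psums_mult[OF subset_refl t _ _ _ y x] by auto
  have "x \<in> psums A t (n + k)" "y \<in> psums A t (n + k)"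
    using x y psums_mono[OF subset_refl t A_closed(1), of n "n + k"] psums_mono[OF subset_refl t A_closed(1), of k "n + k"]
    by auto
  then show "x \<oplus> y \<in> ?Q" using psums_add[OF subset_refl t] by auto
qed

text \<open>The relation for t^n turns an overflow term b t^n with b in I into lower powers with
  coefficients in I. So the span over I of the first n powers is stable under t, hence under every
  polynomial in t.\<close>

lemma integral_psums_mult:
  assumes I: "I \<subseteq> A" "\<zero> \<in> I" "\<And>a b. a \<in> I \<Longrightarrow> b \<in> I \<Longrightarrow> a \<oplus> b \<in> I" "\<And>r a. r \<in> A \<Longrightarrow> a \<in> I \<Longrightarrow> r \<otimes> a \<in> I"
    and t: "t \<in> carrier S" and int: "t [^] n \<in> psums A t n"
    and y: "y \<in> psums I t n"
  shows "x \<in> psums A t k \<Longrightarrow> x \<otimes> y \<in> psums I t n"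
proof (induction k arbitrary: x)
  case 0
  then show ?case using psums_carrier[OF I(1) t y] psums_mono[OF I(1) t I(2), of 0 n] by auto
next
  case (Suc k)
  then obtain x' a where x: "x = x' \<oplus> a \<otimes> t [^] k" "x' \<in> psums A t k" "a \<in> A" by auto
  note c = psums_carrier[OF subset_refl t x(2)] psums_carrier[OF I(1) t y]
  have shift: "t \<otimes> z \<in> psums I t n" if z: "z \<in> psums I t n" for z
  proof -
    obtain w b where w: "t \<otimes> z = w \<oplus> b \<otimes> t [^] n" "w \<in> psums I t n" "b \<in> I"
      using psums_shift[OF I(1) t I(2) z] by auto
    have "b \<otimes> t [^] n \<in> psums I t n"
    proof (rule psums_scale[OF subset_refl t _ _ int])
      show "b \<in> A" using w(3) I(1) by blast
      show "b \<otimes> a \<in> I" if "a \<in> A" for a using I(4)[OF that w(3)] m_comm[of b a] that \<open>b \<in> A\<close> by simp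
    qed
    then show ?thesis unfolding w(1) using psums_add[OF I(1) t I(3) w(2)] by blast
  qed
  have "t [^] k \<otimes> y \<in> psums I t n"
  proof (induction k)
    case (Suc k)
    then show ?case using shift[OF Suc] t c by (simp add: m_ac)
  qed (use y c in simp)
  then have "a \<otimes> (t [^] k \<otimes> y) \<in> psums I t n" using psums_scale[OF I(1) t x(3)] I(4) x(3) by blast
  then have "x' \<otimes> y \<oplus> a \<otimes> (t [^] k \<otimes> y) \<in> psums I t n"
    using psums_add[OF I(1) t I(3) Suc.IH[OF x(2)]] by blast
  moreover have "x \<otimes> y = x' \<otimes> y \<oplus> a \<otimes> (t [^] k \<otimes> y)"
    using x c t by (simp add: l_distr m_assoc)
  ultimately show ?case by simp
qed


lemma psums_m_subset: "psums m t n \<subseteq> psums A t n"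
  by (induction n) (auto, blast intro: m_A)

text \<open>The two rings are A[t] and A + m A[t]; the second is the test ring for a Nakayama
  argument.\<close>

lemma integral_psums_interm:
  assumes t: "t \<in> carrier S" and int: "t [^] n \<in> psums A t n" and n: "0 < n"
  shows "psums A t n \<in> interm A S"
    and "{a \<oplus> y | a y. a \<in> A \<and> y \<in> psums m t n} \<in> interm A S" (is "?E \<in> _")
proof -
  have mA: "m \<subseteq> A" by auto
  have mult_m: "x \<otimes> y \<in> psums m t n" if "x \<in> psums A t n" "y \<in> psums m t n" for x y
    by (rule integral_psums_mult[OF mA _ _ _ t int that(2,1)]) simp_all
  have mult_A: "x \<otimes> y \<in> psums A t n" if "x \<in> psums A t n" "y \<in> psums A t n" for x y
    by (rule integral_psums_mult[OF subset_refl _ _ _ t int that(2,1)]) simp_all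
  note add_A = psums_add_A[OF t] and add_m = psums_add_m[OF t]
  note pc = psums_carrier[OF subset_refl t] psums_carrier[OF mA t]
  have A_sub: "A \<subseteq> psums A t n"
  proof
    fix a assume a: "a \<in> A"
    then have "a \<otimes> t [^] (0::nat) \<in> psums A t (Suc 0)" by (intro psums_term) (use t in auto)
    then have "a \<in> psums A t (Suc 0)" using a by simp
    then show "a \<in> psums A t n" using psums_mono[OF subset_refl t A_closed(1), of "Suc 0" n] n by auto
  qed
  have neg: "\<ominus> x \<in> psums A t n" if "x \<in> psums A t n" for x
  proof -
    have "\<ominus> \<one> \<otimes> x \<in> psums A t n" by (rule psums_scale[OF subset_refl t _ _ that]) simp_all
    then show ?thesis using pc that by (simp add: l_minus)
  qed
  show "psums A t n \<in> interm A S"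
  proof (rule intermI[OF subringI A_sub])
    show "psums A t n \<subseteq> carrier S" using pc by blast
    show "\<one> \<in> psums A t n" using A_sub A_closed(2) by blast
  qed (use mult_A add_A neg in auto)
  show "?E \<in> interm A S"
  proof (rule module_extension_interm)
    show "psums m t n \<subseteq> carrier S" using pc by blast
    show "\<zero> \<in> psums m t n" using psums_mono[OF mA t m_closed(1), of 0 n] by auto
    fix x y assume y: "y \<in> psums m t n"
    show "x \<otimes> y \<in> psums m t n" if "x \<in> A" using mult_m y A_sub that by blast
    show "x \<oplus> y \<in> psums m t n" if "x \<in> psums m t n" using add_m[OF that y] .
    show "\<exists>a\<in>A. \<exists>z\<in>psums m t n. x \<otimes> y = a \<oplus> z" if x: "x \<in> psums m t n"
    proof -
      have "x \<in> psums A t n" using x psums_m_subset by blast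
      then have "x \<otimes> y \<in> psums m t n" "x \<otimes> y = \<zero> \<oplus> x \<otimes> y" using mult_m y pc by auto
      then show ?thesis using A_closed(1) by blast
    qed
  qed
qed

section \<open>Integral and non-integral atoms\<close>

text \<open>Here D = A[t], and A + m D is D or A. Nakayama excludes D, so m D lies in A. It contains
  no unit of A, as otherwise t would lie in m D and hence in A.\<close>

lemma integral_atom_absorbs:
  assumes D: "atom_over A S D" and t: "t \<in> D" "t \<notin> A" and int: "t [^] n \<in> psums A t n"
  shows "absorbs D"
proof -
  note DI = atom_overD(1)[OF D]
  have tc: "t \<in> carrier S" using t(1) intermD(3)[OF DI] by blast
  \<comment> \<open>The Nakayama step contradicts minimality of this degree. It is at least 2,
    because 1 is nonzero and t is not in A.\<close>
  define k where "k = (LEAST k. t [^] k \<in> psums A t k)"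
  have k: "t [^] k \<in> psums A t k" unfolding k_def using int by (rule LeastI)
  have kmin: "t [^] j \<notin> psums A t j" if "j < k" for j using that not_less_Least unfolding k_def by blast
  have mA: "m \<subseteq> A" by auto
  have zero_A: "\<zero> \<in> psums A t j" for j using psums_mono[OF subset_refl tc A_closed(1), of 0 j] by auto
  have psA: "a \<in> psums A t (Suc j)" if "a \<in> A" for a j
  proof -
    have "a \<otimes> t [^] (0::nat) \<in> psums A t (Suc 0)" using that by (intro psums_term) (use tc in auto)
    then have "a \<in> psums A t (Suc 0)" using that by simp
    then show ?thesis using psums_mono[OF subset_refl tc A_closed(1), of "Suc 0" "Suc j"] by auto
  qed
  have "k \<noteq> 0"
  proof
    assume "k = 0"
    then have "\<one> = \<zero>" using k by simp
    then show False using one_notin_m m_closed(1) by simp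
  qed
  moreover have "k \<noteq> 1"
  proof
    assume "k = 1"
    then have "t \<in> psums A t (Suc 0)" using k tc by simp
    then show False using t(2) by auto
  qed
  ultimately obtain j where kj: "k = Suc (Suc j)" by (metis One_nat_def not0_implies_Suc)
  note I = integral_psums_interm[OF tc k, unfolded kj, OF zero_less_Suc]
  let ?P = "psums A t (Suc (Suc j))" and ?Pm = "psums m t (Suc (Suc j))"
  let ?E = "{a \<oplus> y | a y. a \<in> A \<and> y \<in> ?Pm}"
  have "\<one> \<otimes> t [^] (1::nat) \<in> psums A t (Suc 1)" by (intro psums_term) (use tc in auto)
  then have "t \<in> psums A t (Suc 1)" using tc by simp
  then have "t \<in> ?P" using psums_mono[OF subset_refl tc A_closed(1), of "Suc 1" "Suc (Suc j)"] by auto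
  then have PD: "?P = D"
    using atom_overD(4)[OF D I(1) psums_subset_subring[OF DI t(1)]] t(2) by blast
  note PmP = psums_m_subset[of t "Suc (Suc j)"]
  have "?E \<subseteq> D"
    using PmP PD intermD(2)[OF DI] subringE(7)[OF intermD(1)[OF DI]] by blast
  moreover have "?E \<noteq> D"
  proof
    \<comment> \<open>Nakayama by hand: the top power p = t^(k-1) would be a + z + b p with b in m
      and z of lower degree. Dividing by the unit 1 - b expresses p by lower powers.\<close>
    assume E: "?E = D"
    have "\<one> \<otimes> t [^] Suc j \<in> psums A t (Suc (Suc j))" by (intro psums_term) (use tc in auto)
    then have "t [^] Suc j \<in> ?P" by (simp only: l_one[OF nat_pow_closed[OF tc]])
    then have "t [^] Suc j \<in> ?E" unfolding E PD .
    then obtain a y where y: "t [^] Suc j = a \<oplus> y" "a \<in> A" "y \<in> ?Pm" by blast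
    then obtain z b where z: "y = z \<oplus> b \<otimes> t [^] Suc j" "z \<in> psums m t (Suc j)" "b \<in> m" by auto
    have zA: "z \<in> psums A t (Suc j)" using z(2) psums_m_subset by blast
    define p where "p = t [^] Suc j"
    have pc: "p \<in> carrier S" "a \<in> carrier S" "z \<in> carrier S" "b \<in> carrier S"
      using tc y z psums_carrier[OF subset_refl tc zA] by (auto simp: p_def)
    have p: "p = a \<oplus> (z \<oplus> b \<otimes> p)" using y(1) z(1) by (simp add: p_def)
    obtain w where w: "w \<in> A" "(\<one> \<ominus> b) \<otimes> w = \<one>" using one_minus_unit[OF z(3)] by blast
    have wc: "w \<in> carrier S" using w by simp
    have "(\<one> \<ominus> b) \<otimes> p = p \<ominus> b \<otimes> p" using pc by (simp add: minus_eq l_distr l_minus)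
    also have "\<dots> = (a \<oplus> (z \<oplus> b \<otimes> p)) \<ominus> b \<otimes> p" by (rule arg_cong2[OF p refl])
    also have "\<dots> = a \<oplus> z" using pc by algebra
    finally have e: "(\<one> \<ominus> b) \<otimes> p = a \<oplus> z" .
    have "w \<otimes> ((\<one> \<ominus> b) \<otimes> p) = ((\<one> \<ominus> b) \<otimes> w) \<otimes> p" using pc wc by (simp add: m_ac)
    then have "p = w \<otimes> (a \<oplus> z)" using e w(2) pc by simp
    moreover have "a \<oplus> z \<in> psums A t (Suc j)" by (rule psums_add_A[OF tc psA[OF y(2)] zA])
    then have "w \<otimes> (a \<oplus> z) \<in> psums A t (Suc j)" using w(1) by (intro psums_scale[OF subset_refl tc]) auto
    ultimately show False using kmin[of "Suc j"] kj by (simp add: p_def)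
  qed
  ultimately have E: "?E = A" using atom_overD(4)[OF D I(2)] by blast
  have PmA: "?Pm \<subseteq> A"
  proof
    fix y assume y: "y \<in> ?Pm"
    then have "y = \<zero> \<oplus> y" using psums_carrier[OF mA tc y] by simp
    then have "y \<in> ?E" using y A_closed(1) by blast
    then show "y \<in> A" using E by blast
  qed
  have "?Pm \<subseteq> m"
  proof (rule ccontr)
    assume "\<not> ?thesis"
    then obtain y where y: "y \<in> ?Pm" "y \<notin> m" by blast
    then obtain w where w: "w \<in> A" "y \<otimes> w = \<one>" using PmA m_unit by blast
    \<comment> \<open>The inverse w of y gives t = (t w) y, an element of m D.\<close>
    have tw: "t \<otimes> w \<in> ?P" unfolding PD using t(1) w(1) intermD(2)[OF DI] subringE(6)[OF intermD(1)[OF DI]] by blast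
    have "(t \<otimes> w) \<otimes> y \<in> ?Pm"
      by (rule integral_psums_mult[OF mA m_closed(1,2,4) tc k[unfolded kj] y(1) tw])
    moreover have "(t \<otimes> w) \<otimes> y = t" using w tc PmA y(1) by (simp add: m_assoc m_comm[of w y] subset_iff)
    ultimately have "t \<in> ?Pm" by (simp only:)
    then show False using PmA t(2) by blast
  qed
  show ?thesis
    unfolding absorbs_def PD[symmetric]
  proof (intro ballI)
    fix a x assume ax: "a \<in> m" "x \<in> ?P"
    have "a \<otimes> x \<in> ?Pm" by (rule psums_scale[OF subset_refl tc _ _ ax(2)]) (use ax in auto)
    then show "a \<otimes> x \<in> m" using \<open>?Pm \<subseteq> m\<close> by blast
  qed
qed

text \<open>Multiply the relation by a^n: a term c t^k with k \<le> n becomes c a^(n-k) (a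
  t)^k.\<close>

lemma leading_coeff_integral:
  assumes t: "t \<in> carrier S" and a: "a \<in> A" and int: "a \<otimes> t [^] Suc n \<in> psums A t (Suc n)"
  shows "(a \<otimes> t) [^] Suc n \<in> psums A (a \<otimes> t) (Suc n)"
proof -
  have at: "a \<otimes> t \<in> carrier S" using a t by simp
  have *: "a [^] n \<otimes> x \<in> psums A (a \<otimes> t) k" if "x \<in> psums A t k" "k \<le> Suc n" for x k
    using that
  proof (induction k arbitrary: x)
    case (Suc k)
    then obtain y c where x: "x = y \<oplus> c \<otimes> t [^] k" "y \<in> psums A t k" "c \<in> A" by auto
    note yc = psums_carrier[OF subset_refl t x(2)]
    have e: "a [^] n = a [^] (n - k) \<otimes> a [^] k" using Suc.prems(2) a by (simp add: nat_pow_mult)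
    have "a [^] n \<otimes> (c \<otimes> t [^] k) = (c \<otimes> a [^] (n - k)) \<otimes> (a \<otimes> t) [^] k"
      unfolding e using a t x(3) by (simp add: nat_pow_distrib m_ac)
    then have "a [^] n \<otimes> x = a [^] n \<otimes> y \<oplus> (c \<otimes> a [^] (n - k)) \<otimes> (a \<otimes> t) [^] k"
      unfolding x(1) using a t x(3) yc by (simp add: r_distr)
    moreover have "a [^] n \<otimes> y \<in> psums A (a \<otimes> t) k" using Suc x(2) by simp
    moreover have "c \<otimes> a [^] (n - k) \<in> A" using x(3) a by simp
    ultimately show ?case unfolding psums.simps by blast
  qed (use a in simp)
  have "a [^] n \<otimes> (a \<otimes> t [^] Suc n) = (a \<otimes> t) [^] Suc n"
    using a t by (simp add: nat_pow_distrib m_ac)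
  then show ?thesis using *[OF int] by simp
qed

text \<open>
  An atom that is not integral over \<open>A\<close>: in a relation \<open>u t - c = t\<^sup>2 g(t)\<close> the leading coefficient
  \<open>a\<close> makes \<open>a t\<close> integral, hence an element of \<open>A\<close>, so that the degree can be lowered.
\<close>

lemma polynomial_relation_inverse:
  assumes D: "atom_over A S D" "\<not> absorbs D" and t: "t \<in> D" "t \<notin> A"
  shows "\<lbrakk>g \<in> psums A t n; u \<in> A; u \<notin> m; c \<in> A; u \<otimes> t \<ominus> c = t \<otimes> (t \<otimes> g)\<rbrakk> \<Longrightarrow> \<exists>b\<in>m. b \<otimes> t = \<one>"
proof (induction n arbitrary: g)
  note DI = atom_overD(1)[OF D(1)]
  have tc [simp]: "t \<in> carrier S" using t(1) intermD(3)[OF DI] by blast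
  {
    case 0
    then have "u \<otimes> t \<ominus> c = \<zero>" by simp
    then have "u \<otimes> t = c" using 0 by simp
    then show ?case using unit_cancel_A[of u t] 0 t(2) by simp
  next
    case (Suc n)
    obtain l a where g: "g = l \<oplus> a \<otimes> t [^] n" "l \<in> psums A t n" "a \<in> A" using Suc.prems(1) by auto
    note lc [simp] = psums_carrier[OF subset_refl tc g(2)]
    have uc [simp]: "u \<in> carrier S" "c \<in> carrier S" "a \<in> carrier S" using Suc.prems g(3) by auto
    have "t \<otimes> (t \<otimes> g) = t \<otimes> (t \<otimes> l) \<oplus> a \<otimes> t [^] Suc (Suc n)"
      unfolding g(1) by (simp add: r_distr m_ac)
    then have e: "u \<otimes> t \<ominus> c = t \<otimes> (t \<otimes> l) \<oplus> a \<otimes> t [^] Suc (Suc n)" using Suc.prems(5) by simp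
    define p q where "p = a \<otimes> t [^] Suc (Suc n)" and "q = t \<otimes> (t \<otimes> l)"
    have pq [simp]: "p \<in> carrier S" "q \<in> carrier S" by (auto simp: p_def q_def)
    have "p = (u \<otimes> t \<ominus> c) \<ominus> q"
      using tc lc uc pq unfolding e[folded p_def q_def] by algebra
    also have "\<dots> = (u \<otimes> t \<oplus> \<ominus> c) \<oplus> \<ominus> \<one> \<otimes> q" by (simp add: minus_eq l_minus)
    also have "\<dots> \<in> psums A t (Suc (Suc n))"
    proof -
      have "u \<otimes> t [^] (1::nat) \<in> psums A t (Suc 1)" by (intro psums_term) (use Suc.prems in auto)
      then have "u \<otimes> t \<in> psums A t (Suc 1)" by (simp only: nat_pow_eone[OF tc])
      then have 1: "u \<otimes> t \<in> psums A t (Suc (Suc n))"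
        using psums_mono[OF subset_refl tc A_closed(1), of "Suc 1" "Suc (Suc n)"] by auto
      have "\<ominus> c \<otimes> t [^] (0::nat) \<in> psums A t (Suc 0)" by (intro psums_term) (use Suc.prems in auto)
      then have "\<ominus> c \<in> psums A t (Suc 0)" by (simp only: nat_pow_0 r_one a_inv_closed uc)
      then have 2: "\<ominus> c \<in> psums A t (Suc (Suc n))"
        using psums_mono[OF subset_refl tc A_closed(1), of "Suc 0" "Suc (Suc n)"] by auto
      have "q \<in> psums A t (Suc (Suc n))"
        unfolding q_def by (intro psums_shift[OF subset_refl tc A_closed(1)] g(2))
      then have 3: "\<ominus> \<one> \<otimes> q \<in> psums A t (Suc (Suc n))"
        by (rule psums_scale[OF subset_refl tc, rotated 2]) simp_all
      show ?thesis by (rule psums_add_A[OF tc psums_add_A[OF tc 1 2] 3])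
    qed
    finally have "(a \<otimes> t) [^] Suc (Suc n) \<in> psums A (a \<otimes> t) (Suc (Suc n))"
      unfolding p_def by (rule leading_coeff_integral[OF tc g(3)])
    moreover have "a \<otimes> t \<in> D" using t(1) g(3) intermD(2)[OF DI] subringE(6)[OF intermD(1)[OF DI]] by blast
    \<comment> \<open>Otherwise a t would be an element of D outside A that is integral, and
      \<open>integral_atom_absorbs\<close> would apply.\<close>
    ultimately have b: "a \<otimes> t \<in> A" using integral_atom_absorbs[OF D(1)] D(2) by blast
    show ?case
    proof (cases n)
      \<comment> \<open>The leading term a t^n = (a t) t^k now has its coefficient a t in A, so g is
        a polynomial of lower degree.\<close>
      case (Suc k)
      have "a \<otimes> t [^] n = (a \<otimes> t) \<otimes> t [^] k" unfolding Suc by (simp add: m_ac)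
      then have "a \<otimes> t [^] n \<in> psums A t n" unfolding Suc using psums_term[OF subset_refl tc A_closed(1) b, of k] by simp
      then have "g \<in> psums A t n" unfolding g(1) using psums_add_A[OF tc g(2)] by blast
      then show ?thesis using Suc.IH Suc.prems by blast
    next
      \<comment> \<open>Here g is the constant a, and (u - b) t = c with b = a t in A. As t is not
        in A, u - b lies in m, so b is a unit; with w its inverse, w a is the inverse of t.\<close>
      case 0
      then have "u \<otimes> t \<ominus> c = (a \<otimes> t) \<otimes> t" using e g(2) by (simp add: m_ac)
      moreover define b where "b = a \<otimes> t"
      ultimately have e0: "u \<otimes> t \<ominus> c = b \<otimes> t" "b \<in> A" "a \<otimes> t = b" using \<open>a \<otimes> t \<in> A\<close> by simp_all
      have bc [simp]: "b \<in> carrier S" using e0 by simp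
      have "(u \<ominus> b) \<otimes> t = (u \<otimes> t \<ominus> c) \<ominus> b \<otimes> t \<oplus> c" using tc lc uc pq bc by algebra
      also have "\<dots> = c" unfolding e0(1) by (simp add: minus_eq r_neg)
      finally have ub: "(u \<ominus> b) \<otimes> t = c" .
      then have "u \<ominus> b \<in> m" using unit_cancel_A[of "u \<ominus> b" t] t(2) Suc.prems e0(2) by auto
      then have "b \<notin> m"
        using m_closed(2)[of "u \<ominus> b" b] Suc.prems(2,3) by (auto simp: minus_eq a_assoc l_neg)
      then obtain w where w: "w \<in> A" "b \<otimes> w = \<one>" using m_unit e0(2) by blast
      have "(w \<otimes> a) \<otimes> t = (a \<otimes> t) \<otimes> w" using w by (simp add: m_ac)
      then have inv: "(w \<otimes> a) \<otimes> t = \<one>" by (simp only: e0(3) w(2))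
      moreover have "w \<otimes> a \<in> m"
      proof (rule ccontr)
        assume "w \<otimes> a \<notin> m"
        then show False using unit_cancel_A[of "w \<otimes> a" t] inv t(2) w(1) g(3) by simp
      qed
      ultimately show ?thesis by blast
    qed
  }
qed

text \<open>If t^2 is in A, then t is integral and D satisfies \<open>absorbs\<close>. Otherwise t
  lies in A + t^2 D, and since D = A[t] this is a relation for
  \<open>polynomial_relation_inverse\<close> with u = 1.\<close>

lemma atom_dichotomy:
  assumes D: "atom_over A S D" "\<not> absorbs D" and t: "t \<in> D" "t \<notin> A"
  shows "\<exists>b\<in>m. b \<otimes> t = \<one>"
proof -
  note DI = atom_overD(1)[OF D(1)]
  note DE = subringE[OF intermD(1)[OF DI]]
  have tc [simp]: "t \<in> carrier S" using t(1) intermD(3)[OF DI] by blast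
  have tt: "t \<otimes> t \<in> D" using t(1) DE(6) by blast
  let ?Q = "\<Union>n. psums A t n"
  have "\<one> \<otimes> t [^] (1::nat) \<in> psums A t (Suc 1)" by (intro psums_term) auto
  then have "t \<in> psums A t (Suc 1)" by (simp only: nat_pow_eone[OF tc] l_one[OF tc])
  then have "t \<in> ?Q" by blast
  then have Q: "?Q = D"
    using atom_overD(4)[OF D(1) psums_union_interm[OF tc]] psums_subset_subring[OF DI t(1)] t(2) by blast
  let ?E = "{c \<oplus> (t \<otimes> t) \<otimes> g | c g. c \<in> A \<and> g \<in> D}"
  note E = adjoin_interm[OF DI tt]
  show ?thesis
  proof (cases "t \<otimes> t \<in> A")
    case True
    then have "(t \<otimes> t) \<otimes> t [^] (0::nat) \<in> psums A t (Suc 0)" by (intro psums_term) auto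
    moreover have "(t \<otimes> t) \<otimes> t [^] (0::nat) = t [^] (2::nat)" by (simp add: numeral_2_eq_2)
    ultimately have "t [^] (2::nat) \<in> psums A t (Suc 0)" by (simp only:)
    then have "t [^] (2::nat) \<in> psums A t 2"
      using psums_mono[OF subset_refl tc A_closed(1), of "Suc 0" 2] by auto
    then show ?thesis using integral_atom_absorbs[OF D(1) t] D(2) by blast
  next
    case False
    have "t \<otimes> t = \<zero> \<oplus> (t \<otimes> t) \<otimes> \<one>" by simp
    then have "t \<otimes> t \<in> ?E" using A_closed(1) DE(3) by blast
    then have "?E = D" using atom_overD(4)[OF D(1) E] False by blast
    then have "t \<in> ?E" using t(1) by (simp only:)
    then obtain c g where cg: "t = c \<oplus> (t \<otimes> t) \<otimes> g" "c \<in> A" "g \<in> D" by blast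
    have gc [simp]: "c \<in> carrier S" "g \<in> carrier S" using cg DE(1) by auto
    have "\<one> \<otimes> t \<ominus> c = (c \<oplus> (t \<otimes> t) \<otimes> g) \<ominus> c" using cg(1) by simp
    also have "\<dots> = t \<otimes> (t \<otimes> g)" using tc gc by algebra
    finally have rel: "\<one> \<otimes> t \<ominus> c = t \<otimes> (t \<otimes> g)" .
    obtain n where "g \<in> psums A t n" using cg(3) Q by blast
    then show ?thesis using polynomial_relation_inverse[OF D t] rel cg(2) one_notin_m A_closed(2) by blast
  qed
qed

end

section \<open>Ramified and decomposed atoms\<close>

context local_subring
begin

lemma interm_closed:
  assumes "T \<in> interm A S"
  shows "x \<in> T \<Longrightarrow> x \<in> carrier S" "a \<in> A \<Longrightarrow> a \<in> T"
    "\<lbrakk>x \<in> T; y \<in> T\<rbrakk> \<Longrightarrow> x \<oplus> y \<in> T" "\<lbrakk>x \<in> T; y \<in> T\<rbrakk> \<Longrightarrow> x \<otimes> y \<in> T"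
    "\<lbrakk>x \<in> T; y \<in> T\<rbrakk> \<Longrightarrow> x \<ominus> y \<in> T" "x \<in> T \<Longrightarrow> \<ominus> x \<in> T"
  using subringE[OF intermD(1)[OF assms]] intermD(2)[OF assms] by (auto simp: minus_eq)

lemma absorbs_closed:
  assumes "absorbs T" "T \<in> interm A S" "a \<in> m" "x \<in> T"
  shows "a \<otimes> x \<in> m" "x \<otimes> a \<in> m"
  using absorbsD[OF assms(1,3,4)] m_comm[of x a] interm_closed(1)[OF assms(2,4)] assms(3) by auto

text \<open>An A-module with two generators, and a ring as soon as z^2 lies in it.\<close>

definition line :: "'a \<Rightarrow> 'a set"
  where "line z = {a \<oplus> b \<otimes> z | a b. a \<in> A \<and> b \<in> A}"

lemma mem_line: "z \<in> carrier S \<Longrightarrow> z \<in> line z"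
proof -
  assume "z \<in> carrier S"
  then have "z = \<zero> \<oplus> \<one> \<otimes> z" by simp
  then show "z \<in> line z" unfolding line_def using A_closed(1,2) by blast
qed

lemma line_subset:
  assumes "T \<in> interm A S" "z \<in> T" shows "line z \<subseteq> T"
  unfolding line_def by (clarify, intro interm_closed(3,4)[OF assms(1)] interm_closed(2)[OF assms(1)] assms(2))

lemma line_interm:
  assumes z: "z \<in> carrier S" and q: "z \<otimes> z = p \<oplus> q \<otimes> z" "p \<in> A" "q \<in> A"
  shows "line z \<in> interm A S"
proof -
  let ?J = "{b \<otimes> z | b. b \<in> A}"
  have J: "b \<otimes> z \<in> ?J" if "b \<in> A" for b using that by blast
  have sq: "\<exists>a\<in>A. \<exists>y\<in>?J. (c \<otimes> z) \<otimes> (b \<otimes> z) = a \<oplus> y" if "b \<in> A" "c \<in> A" for b c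
  proof -
    have car: "b \<in> carrier S" "c \<in> carrier S" "p \<in> carrier S" "q \<in> carrier S" using that q by auto
    have "(c \<otimes> z) \<otimes> (b \<otimes> z) = c \<otimes> b \<otimes> (z \<otimes> z)" using car z by algebra
    also have "\<dots> = c \<otimes> b \<otimes> p \<oplus> (c \<otimes> b \<otimes> q) \<otimes> z" using car z unfolding q(1) by algebra
    finally show ?thesis
      by (intro bexI[of _ "c \<otimes> b \<otimes> p"] bexI[OF _ J[of "c \<otimes> b \<otimes> q"]]) (use that q(2,3) in simp_all)
  qed
  have "{a \<oplus> y | a y. a \<in> A \<and> y \<in> ?J} \<in> interm A S"
  proof (rule module_extension_interm)
    show "?J \<subseteq> carrier S" using z by auto
    show "\<zero> \<in> ?J" using J[OF A_closed(1)] z by simp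
    fix x y assume "y \<in> ?J"
    then obtain b where y: "y = b \<otimes> z" "b \<in> A" by blast
    show "x \<otimes> y \<in> ?J" if "x \<in> A" using J[of "x \<otimes> b"] that y z by (simp add: m_assoc)
    assume "x \<in> ?J"
    then obtain c where x: "x = c \<otimes> z" "c \<in> A" by blast
    show "x \<oplus> y \<in> ?J" using J[of "c \<oplus> b"] x y z by (simp add: l_distr)
    show "\<exists>a\<in>A. \<exists>z\<in>?J. x \<otimes> y = a \<oplus> z" unfolding x(1) y(1) using sq y(2) x(2) by blast
  qed
  moreover have "{a \<oplus> y | a y. a \<in> A \<and> y \<in> ?J} = line z" unfolding line_def by blast
  ultimately show ?thesis by simp
qed

text \<open>Such an atom is A + A x, so with k = A/m its quotient by m is k[X]/(X^2). In
  \<open>decomposed_atom\<close> an idempotent modulo m gives k \<times> k instead. These forms are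
  suited to computation; the conductor definitions are reached later.\<close>

definition ramified_atom :: "'a set \<Rightarrow> bool"
  where "ramified_atom C \<longleftrightarrow> atom_over A S C \<and> absorbs C \<and> (\<exists>x\<in>C - A. x \<otimes> x \<in> m)"

definition decomposed_atom :: "'a set \<Rightarrow> bool"
  where "decomposed_atom C \<longleftrightarrow> atom_over A S C \<and> absorbs C \<and> (\<exists>x\<in>C - A. x \<otimes> x \<ominus> x \<in> m)"

text \<open>A failure of t-closedness is an element b outside A with c = b^2 - r b and c b in A. The
  ring A + A b contains an atom, in which a multiple t of b satisfies t^2 = c' + r' t with c' in m;
  whether r' is a unit decides the kind.\<close>

lemma not_t_closed_atom:
  assumes "\<not> t_closed A S" "FIP A S"
  shows "\<exists>C. ramified_atom C \<or> decomposed_atom C"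
proof -
  obtain b r where br: "b \<in> carrier S" "r \<in> A" "b \<notin> A" "b [^] (2::nat) \<ominus> r \<otimes> b \<in> A"
    "b [^] (3::nat) \<ominus> r \<otimes> b [^] (2::nat) \<in> A"
    using assms(1) unfolding t_closed_def by blast
  have car [simp]: "b \<in> carrier S" "r \<in> carrier S" using br by auto
  define c where "c = b \<otimes> b \<ominus> r \<otimes> b"
  have cA: "c \<in> A" using br(4) by (simp add: c_def numeral_2_eq_2)
  have car2 [simp]: "c \<in> carrier S" using cA by simp
  have "c \<otimes> b = b [^] (3::nat) \<ominus> r \<otimes> b [^] (2::nat)"
    using car car2 unfolding c_def by (simp add: numeral_2_eq_2 numeral_3_eq_3) (use car in algebra)
  then have cb: "c \<otimes> b \<in> A" using br(5) by simp
  \<comment> \<open>A unit c could be cancelled from c b, putting b into A.\<close>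
  have cm: "c \<in> m" using unit_cancel_A[of c b] cA cb br(3) by auto
  have bb: "b \<otimes> b = c \<oplus> r \<otimes> b" using car car2 unfolding c_def by algebra
  have "line b \<in> interm A S" by (rule line_interm[OF _ bb]) (use cA br in auto)
  moreover have "line b \<noteq> A" using mem_line br by blast
  ultimately obtain C where C: "atom_over A S C" "C \<subseteq> line b" using atom_below[OF assms(2)] by blast
  note CI = atom_overD(1)[OF C(1)]
  obtain t0 where t0: "t0 \<in> C" "t0 \<notin> A" using atom_overD(2,3)[OF C(1)] by blast
  then obtain p q where pq: "t0 = p \<oplus> q \<otimes> b" "p \<in> A" "q \<in> A" using C(2) unfolding line_def by blast
  have car3 [simp]: "p \<in> carrier S" "q \<in> carrier S" using pq by auto
  \<comment> \<open>The constant part p of t0 is dropped: t is still in the atom and outside A, and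
    it inherits from b a quadratic relation with constant term in m.\<close>
  define t where "t = q \<otimes> b"
  have tc [simp]: "t \<in> carrier S" by (simp add: t_def)
  have "t = t0 \<ominus> p" using car car2 car3 tc unfolding pq(1) t_def by algebra
  then have tC: "t \<in> C" using t0 pq interm_closed[OF CI] by simp
  have tA: "t \<notin> A" using t0(2) pq t_def by auto
  define c' r' where "c' = (q \<otimes> q) \<otimes> c" and "r' = r \<otimes> q"
  have c': "c' \<in> m" "r' \<in> A" using cm pq br by (auto simp: c'_def r'_def)
  have car4 [simp]: "c' \<in> carrier S" "r' \<in> carrier S" using c' by auto
  have "t \<otimes> t = (q \<otimes> q) \<otimes> (b \<otimes> b)" using car car2 car3 tc car4 unfolding t_def by algebra
  also have "\<dots> = c' \<oplus> r' \<otimes> t" using car car2 car3 tc car4 unfolding bb c'_def r'_def t_def by algebra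
  finally have tt: "t \<otimes> t = c' \<oplus> r' \<otimes> t" .
  have at: "a \<otimes> t \<in> m" if a: "a \<in> m" for a
  proof -
    have car5 [simp]: "a \<in> carrier S" using a by simp
    have e: "(a \<otimes> t) \<otimes> (a \<otimes> t) = a \<otimes> a \<otimes> c' \<oplus> (a \<otimes> r') \<otimes> (a \<otimes> t)"
    proof -
      have "(a \<otimes> t) \<otimes> (a \<otimes> t) = a \<otimes> a \<otimes> (t \<otimes> t)" using car car2 car3 tc car4 car5 by algebra
      also have "\<dots> = a \<otimes> a \<otimes> c' \<oplus> (a \<otimes> r') \<otimes> (a \<otimes> t)"
        using car car2 car3 tc car4 car5 unfolding tt by algebra
      finally show ?thesis .
    qed
    \<comment> \<open>This ring is A or C. It is not C, since from t = u + v a t the unit 1 - v a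
      could be cancelled. So a t is in A, and by relation \<open>e\<close> its square lies in
      m.\<close>
    have "line (a \<otimes> t) \<in> interm A S" by (rule line_interm[OF _ e]) (use a c' in auto)
    moreover have "a \<otimes> t \<in> C" using interm_closed[OF CI] a tC by simp
    ultimately have L: "line (a \<otimes> t) = A \<or> line (a \<otimes> t) = C"
      using atom_overD(4)[OF C(1)] line_subset[OF CI] by blast
    have atA: "a \<otimes> t \<in> A"
    proof (rule ccontr)
      assume "a \<otimes> t \<notin> A"
      then have "line (a \<otimes> t) = C" using L mem_line[of "a \<otimes> t"] by auto
      then obtain u v where uv: "t = u \<oplus> v \<otimes> (a \<otimes> t)" "u \<in> A" "v \<in> A" using tC unfolding line_def by blast
      have car6 [simp]: "u \<in> carrier S" "v \<in> carrier S" using uv by auto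
      have "(\<one> \<ominus> v \<otimes> a) \<otimes> t = t \<ominus> v \<otimes> (a \<otimes> t)" using car car2 car3 tc car4 car5 car6 by algebra
      also have "\<dots> = (u \<oplus> v \<otimes> (a \<otimes> t)) \<ominus> v \<otimes> (a \<otimes> t)" by (rule arg_cong2[OF uv(1) refl])
      also have "\<dots> = u" using car car2 car3 tc car4 car5 car6 by algebra
      finally have e1: "(\<one> \<ominus> v \<otimes> a) \<otimes> t \<in> A" using uv(2) by simp
      have "\<one> \<ominus> v \<otimes> a \<notin> m" using unit_or_one_minus_unit[of "v \<otimes> a"] uv(3) a by auto
      then show False using unit_cancel_A[OF _ _ tc e1] uv(3) a tA by simp
    qed
    show ?thesis
    proof (rule ccontr)
      assume n: "a \<otimes> t \<notin> m"
      have "(a \<otimes> t) \<otimes> (a \<otimes> t) \<in> m" unfolding e using a c' atA by simp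
      then show False using m_prime[OF atA atA] n by blast
    qed
  qed
  have "line t \<in> interm A S" by (rule line_interm[OF tc tt]) (use c' in auto)
  then have Ct: "line t = C" using atom_overD(4)[OF C(1) _ line_subset[OF CI tC]] mem_line[OF tc] tA by blast
  have ab: "absorbs C"
    unfolding absorbs_def Ct[symmetric]
  proof (intro ballI)
    fix a x assume a: "a \<in> m" and "x \<in> line t"
    then obtain u v where x: "x = u \<oplus> v \<otimes> t" "u \<in> A" "v \<in> A" unfolding line_def by blast
    have car7 [simp]: "u \<in> carrier S" "v \<in> carrier S" "a \<in> carrier S" using x a by auto
    have "a \<otimes> x = a \<otimes> u \<oplus> v \<otimes> (a \<otimes> t)" using car car2 car3 tc car4 car7 unfolding x(1) by algebra
    then show "a \<otimes> x \<in> m" using at[OF a] a x by simp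
  qed
  show ?thesis
  proof (cases "r' \<in> m")
    case True
    then have "t \<otimes> t \<in> m" unfolding tt using c' at by simp
    then show ?thesis unfolding ramified_atom_def using C(1) ab tC tA by blast
  next
    case False
    \<comment> \<open>Scaling by the inverse of r' turns t^2 = c' + r' t into an idempotent relation
      modulo m.\<close>
    then obtain w where w: "w \<in> A" "r' \<otimes> w = \<one>" using c'(2) m_unit by blast
    have car8 [simp]: "w \<in> carrier S" using w by simp
    have "(w \<otimes> t) \<otimes> (w \<otimes> t) \<ominus> w \<otimes> t = w \<otimes> w \<otimes> (t \<otimes> t) \<ominus> w \<otimes> t" using car car2 car3 tc car4 car8 by algebra
    also have "\<dots> = w \<otimes> w \<otimes> c' \<oplus> ((r' \<otimes> w) \<otimes> (w \<otimes> t) \<ominus> w \<otimes> t)" using car car2 car3 tc car4 car8 unfolding tt by algebra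
    also have "\<dots> = w \<otimes> w \<otimes> c'" using car car2 car3 tc car4 car8 unfolding w(2) by algebra
    finally have "(w \<otimes> t) \<otimes> (w \<otimes> t) \<ominus> w \<otimes> t \<in> m" using c' w by simp
    moreover have "w \<otimes> t \<in> C" using interm_closed[OF CI] w tC by simp
    moreover have "w \<otimes> t \<notin> A"
    proof
      assume "w \<otimes> t \<in> A"
      moreover have "t = r' \<otimes> (w \<otimes> t)" using w(2) by (simp add: m_assoc[symmetric])
      ultimately have "t \<in> A" using A_closed(5)[OF c'(2)] by metis
      then show False using tA by blast
    qed
    ultimately show ?thesis unfolding decomposed_atom_def using C(1) ab by blast
  qed
qed

text \<open>Modulo m, x is nonzero and kills d. An element of A that kills x modulo m lies in m; so
  d^2 lies in m if it lies in A, and otherwise d = c + d^2 g yields an idempotent.\<close>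

lemma absorbing_atom_element:
  assumes D: "atom_over A S D" "absorbs D" and C: "C \<in> interm A S" "absorbs C" "x \<in> C" "x \<notin> A"
    and d: "d \<in> D" "d \<notin> A" "x \<otimes> d \<in> m"
  shows "d \<otimes> d \<in> m \<or> (\<exists>e\<in>D - A. e \<otimes> e \<ominus> e \<in> m \<and> x \<otimes> e \<in> m)"
proof -
  note DI = atom_overD(1)[OF D(1)]
  note DC = interm_closed[OF DI] and CC = interm_closed[OF C(1)]
  have car [simp]: "x \<in> carrier S" "d \<in> carrier S" using C d DC CC by auto
  have xm: "x \<notin> m" using C(4) by auto
  have dd: "d \<otimes> d \<in> D" using d DC by blast
  let ?E = "{c \<oplus> (d \<otimes> d) \<otimes> g | c g. c \<in> A \<and> g \<in> D}"
  note E = adjoin_interm[OF DI dd]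
  show ?thesis
  proof (cases "d \<otimes> d \<in> A")
    case True
    have "x \<otimes> (d \<otimes> d) = (x \<otimes> d) \<otimes> d" by (simp add: m_assoc)
    then have "(d \<otimes> d) \<otimes> x \<in> m" using absorbsD[OF D(2) d(3,1)] by (simp add: m_comm)
    then show ?thesis using unit_cancel_m[OF True _ \<open>x \<in> carrier S\<close>] xm by blast
  next
    case False
    have "d \<otimes> d = \<zero> \<oplus> (d \<otimes> d) \<otimes> \<one>" by simp
    then have "d \<otimes> d \<in> ?E" using A_closed(1) DC(2)[OF A_closed(2)] by blast
    then have "?E = D" using atom_overD(4)[OF D(1) E] False by blast
    then have "d \<in> ?E" using d(1) by (simp only:)
    then obtain c g where cg: "d = c \<oplus> (d \<otimes> d) \<otimes> g" "c \<in> A" "g \<in> D" by blast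
    have car2 [simp]: "c \<in> carrier S" "g \<in> carrier S" using cg DC by auto
    \<comment> \<open>Then c = d (1 - e) kills x modulo m, so c is in m, and e^2 - e = - c g is in
      m.\<close>
    define e where "e = d \<otimes> g"
    have car3 [simp]: "e \<in> carrier S" by (simp add: e_def)
    have eD: "e \<in> D" using d(1) cg(3) DC by (simp add: e_def)
    have "c = d \<ominus> (d \<otimes> d) \<otimes> g"
    proof -
      have "d \<ominus> (d \<otimes> d) \<otimes> g = (c \<oplus> (d \<otimes> d) \<otimes> g) \<ominus> (d \<otimes> d) \<otimes> g" by (rule arg_cong2[OF cg(1) refl])
      also have "\<dots> = c" using car car2 car3 by algebra
      finally show ?thesis by simp
    qed
    also have "\<dots> = d \<otimes> (\<one> \<ominus> e)" using car car2 car3 unfolding e_def by algebra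
    finally have c: "c = d \<otimes> (\<one> \<ominus> e)" .
    have "c \<otimes> x = (x \<otimes> d) \<ominus> (x \<otimes> d) \<otimes> e" using car car2 car3 unfolding c by algebra
    then have "c \<otimes> x \<in> m" using d(3) absorbsD[OF D(2) d(3) eD] by simp
    then have cm: "c \<in> m" using unit_cancel_m[OF cg(2) _ \<open>x \<in> carrier S\<close>] xm by blast
    have "e \<otimes> e \<ominus> e = \<ominus> (c \<otimes> g)" using car car2 car3 unfolding c e_def by algebra
    then have ee: "e \<otimes> e \<ominus> e \<in> m" using absorbsD[OF D(2) cm cg(3)] by simp
    have "x \<otimes> e = (x \<otimes> d) \<otimes> g" unfolding e_def by (simp add: m_assoc)
    then have xe: "x \<otimes> e \<in> m" using absorbsD[OF D(2) d(3) cg(3)] by simp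
    \<comment> \<open>An e in A would lie in m, because x e does. Then 1 - e is a unit, and (1 - e)
      d = c would put d into A.\<close>
    have "e \<notin> A"
    proof
      assume eA: "e \<in> A"
      have "e \<otimes> x \<in> m" using xe by (simp add: m_comm)
      then have em: "e \<in> m" using unit_cancel_m[OF eA _ \<open>x \<in> carrier S\<close>] xm by blast
      then have u: "\<one> \<ominus> e \<notin> m" using unit_or_one_minus_unit[OF eA] by blast
      have "(\<one> \<ominus> e) \<otimes> d \<in> A" using c cg(2) by (simp add: m_comm)
      then show False using unit_cancel_A[OF _ u, of d] eA d(2) by simp
    qed
    then show ?thesis using eD ee xe by blast
  qed
qed

section \<open>Pairs of distinct atoms in a distributive lattice\<close>

lemma atom_pair_cases:
  assumes "distributive_ext A S" "atom_over A S C" "atom_over A S D"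
    and E: "E \<in> interm A S" "E \<subseteq> compositum S C D" "E \<noteq> A"
  shows "C \<subseteq> E \<or> D \<subseteq> E"
  using below_two_atoms[OF A assms(1-3) E(1,2)] E(3) compositum_upper1[of C D] by auto

text \<open>A + A (x + y) is a ring other than A below the compositum, so it contains C or D, hence
  x. Writing x = a + b (x + y) gives (1 - b) x = a + b y. As b or 1 - b is a unit, y lies in C or x
  in D.\<close>

lemma atom_pair_line:
  assumes "distributive_ext A S" "atom_over A S C" "atom_over A S D" "C \<noteq> D"
    and x: "x \<in> C" "x \<notin> A" and y: "y \<in> D" "y \<notin> A"
    and z: "(x \<oplus> y) \<otimes> (x \<oplus> y) = p \<oplus> q \<otimes> (x \<oplus> y)" "p \<in> A" "q \<in> A"
  shows False
proof -
  note CI = atom_overD(1)[OF assms(2)] and DI = atom_overD(1)[OF assms(3)]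
  note CC = interm_closed[OF CI] and DC = interm_closed[OF DI]
  have CD: "u \<in> C \<Longrightarrow> u \<in> D \<Longrightarrow> u \<in> A" for u using atoms_disjoint[OF assms(2-4)] by blast
  have car [simp]: "x \<in> carrier S" "y \<in> carrier S" using x y CC DC by auto
  let ?z = "x \<oplus> y"
  have L: "line ?z \<in> interm A S" by (rule line_interm[OF _ z]) simp
  note LC = interm_closed[OF L]
  have zL: "?z \<in> line ?z" by (rule mem_line) simp
  have "?z \<in> compositum S C D"
    using interm_closed(3)[OF compositum_interm[OF CI DI]] x(1) y(1) compositum_upper1[of C D] compositum_upper2[of D C] by blast
  then have sub: "line ?z \<subseteq> compositum S C D" by (rule line_subset[OF compositum_interm[OF CI DI]])
  have yx: "y = ?z \<ominus> x" "x = ?z \<ominus> y" using car by algebra+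
  have "?z \<notin> A"
  proof
    assume "?z \<in> A"
    then have "y \<in> C" using CC(5)[OF CC(2) x(1)] yx(1) by metis
    then show False using CD y by blast
  qed
  then have "line ?z \<noteq> A" using zL by blast
  then have "C \<subseteq> line ?z \<or> D \<subseteq> line ?z" using atom_pair_cases[OF assms(1-3) L sub] by blast
  then have "x \<in> line ?z"
  proof
    assume "D \<subseteq> line ?z"
    then have "?z \<ominus> y \<in> line ?z" using LC(5)[OF zL] y(1) by blast
    then show ?thesis by (simp only: yx(2)[symmetric])
  qed (use x(1) in blast)
  then obtain a b where ab: "x = a \<oplus> b \<otimes> ?z" "a \<in> A" "b \<in> A" unfolding line_def by blast
  have car2 [simp]: "a \<in> carrier S" "b \<in> carrier S" using ab by auto
  have e: "(\<one> \<ominus> b) \<otimes> x = a \<oplus> b \<otimes> y"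
  proof -
    have "(\<one> \<ominus> b) \<otimes> x = x \<ominus> b \<otimes> x" using car car2 by algebra
    also have "\<dots> = (a \<oplus> b \<otimes> ?z) \<ominus> b \<otimes> x" by (rule arg_cong2[OF ab(1) refl])
    also have "\<dots> = a \<oplus> b \<otimes> y" using car car2 by algebra
    finally show ?thesis .
  qed
  show False
  proof (cases "b \<in> m")
    case True
    then have "\<one> \<ominus> b \<notin> m" using unit_or_one_minus_unit[OF ab(3)] by blast
    moreover have "(\<one> \<ominus> b) \<otimes> x \<in> D" unfolding e by (intro DC(3) DC(4) DC(2)[OF ab(2)] DC(2)[OF ab(3)] y(1))
    ultimately have "x \<in> D" using unit_cancel[OF intermD(1,2)[OF DI], of "\<one> \<ominus> b" x] ab(3) by simp
    then show False using CD x by blast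
  next
    case False
    have "b \<otimes> y = (\<one> \<ominus> b) \<otimes> x \<ominus> a" using car car2 unfolding e by algebra
    moreover have "\<one> \<ominus> b \<in> C" using ab(3) CC(2)[of "\<one> \<ominus> b"] by simp
    ultimately have "b \<otimes> y \<in> C" using CC(4)[OF _ x(1), of "\<one> \<ominus> b"] CC(5) CC(2)[OF ab(2)] by simp
    then have "y \<in> C" using unit_cancel[OF intermD(1,2)[OF CI] ab(3) False, of y] by simp
    then show False using CD y by blast
  qed
qed

lemma line_product:
  assumes "C \<in> interm A S" "D \<in> interm A S" "x \<in> C" "y \<in> D" "(x \<otimes> x) \<otimes> (y \<otimes> y) \<in> m"
  shows "line (x \<otimes> y) \<in> interm A S" "line (x \<otimes> y) \<subseteq> compositum S C D"
proof -
  have car: "x \<in> carrier S" "y \<in> carrier S" using interm_closed(1) assms by auto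
  have sq: "(x \<otimes> y) \<otimes> (x \<otimes> y) = (x \<otimes> x) \<otimes> (y \<otimes> y) \<oplus> \<zero> \<otimes> (x \<otimes> y)" using car by algebra
  show "line (x \<otimes> y) \<in> interm A S" by (rule line_interm[OF _ sq]) (use car assms(5) in simp_all)
  note K = compositum_interm[OF assms(1,2)]
  have "x \<in> compositum S C D" "y \<in> compositum S C D"
    using assms(3,4) compositum_upper1[of C D] compositum_upper2[of D C] by blast+
  then show "line (x \<otimes> y) \<subseteq> compositum S C D" by (intro line_subset[OF K] interm_closed(4)[OF K])
qed

text \<open>Multiplying y = a + b x y by x gives x y = a x + b x^2 y with x^2 y in m. So x y lies in
  C, and with it y.\<close>

lemma mem_line_product:
  assumes C: "C \<in> interm A S" "x \<in> C" "x \<otimes> x \<in> m" and D: "absorbs D" "D \<in> interm A S" "y \<in> D"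
    and line: "y \<in> line (x \<otimes> y)"
  shows "y \<in> C"
proof -
  note CC = interm_closed[OF C(1)]
  obtain a b where ab: "y = a \<oplus> b \<otimes> (x \<otimes> y)" "a \<in> A" "b \<in> A" using line unfolding line_def by blast
  have car: "x \<in> carrier S" "y \<in> carrier S" "a \<in> carrier S" "b \<in> carrier S"
    using ab(2,3) C(2) D(3) CC interm_closed(1)[OF D(2)] by auto
  have "x \<otimes> y = x \<otimes> (a \<oplus> b \<otimes> (x \<otimes> y))" by (rule arg_cong[OF ab(1)])
  also have "\<dots> = a \<otimes> x \<oplus> b \<otimes> ((x \<otimes> x) \<otimes> y)" using car by algebra
  finally have "x \<otimes> y \<in> C" using absorbsD[OF D(1) C(3) D(3)] ab(2,3) C(2) CC by simp
  then have "a \<oplus> b \<otimes> (x \<otimes> y) \<in> C" using ab(2,3) CC by simp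
  then show ?thesis by (simp only: ab(1)[symmetric])
qed

text \<open>If x y is in A, so is (x + y)^2, against \<open>atom_pair_line\<close>. Otherwise A + A
  x y is a ring containing C or D, and \<open>mem_line_product\<close> puts x into D or y into
  C.\<close>

lemma ramified_atom_unique:
  assumes "distributive_ext A S" "ramified_atom C" "ramified_atom D"
  shows "C = D"
proof (rule ccontr)
  assume "C \<noteq> D"
  obtain x y where C: "atom_over A S C" "absorbs C" "x \<in> C" "x \<notin> A" "x \<otimes> x \<in> m"
    and D: "atom_over A S D" "absorbs D" "y \<in> D" "y \<notin> A" "y \<otimes> y \<in> m"
    using assms(2,3) unfolding ramified_atom_def by blast
  note CI = atom_overD(1)[OF C(1)] and DI = atom_overD(1)[OF D(1)]
  note CC = interm_closed[OF CI] and DC = interm_closed[OF DI]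
  have car [simp]: "x \<in> carrier S" "y \<in> carrier S" using C D CC DC by auto
  have disj: "u \<in> C \<Longrightarrow> u \<in> D \<Longrightarrow> u \<in> A" for u using atoms_disjoint[OF C(1) D(1) \<open>C \<noteq> D\<close>] by blast
  show False
  proof (cases "x \<otimes> y \<in> A")
    case True
    have "(x \<oplus> y) \<otimes> (x \<oplus> y) = (x \<otimes> x \<oplus> y \<otimes> y \<oplus> (x \<otimes> y \<oplus> x \<otimes> y)) \<oplus> \<zero> \<otimes> (x \<oplus> y)"
      using car by algebra
    then show False
      by (rule atom_pair_line[OF assms(1) C(1) D(1) \<open>C \<noteq> D\<close> C(3,4) D(3,4)]) (use C D True in simp_all)
  next
    case False
    note L = line_product[OF CI DI C(3) D(3) m_closed(4)[OF m_A[OF C(5)] D(5)]]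
    have "line (x \<otimes> y) \<noteq> A" using mem_line[of "x \<otimes> y"] False by auto
    then have "C \<subseteq> line (x \<otimes> y) \<or> D \<subseteq> line (x \<otimes> y)" using atom_pair_cases[OF assms(1) C(1) D(1) L] by blast
    then show False
    proof
      assume "C \<subseteq> line (x \<otimes> y)"
      then have "x \<in> line (y \<otimes> x)" using C(3) m_comm[OF car] by auto
      then show False using mem_line_product[OF DI D(3,5) C(2) CI C(3)] disj C(3,4) by blast
    next
      assume "D \<subseteq> line (x \<otimes> y)"
      then show False using mem_line_product[OF CI C(3,5) D(2) DI D(3)] disj D(3,4) by blast
    qed
  qed
qed

text \<open>The nilpotent x of C kills, modulo m, some d of D outside A. Then
  \<open>absorbing_atom_element\<close> offers a nilpotent in D, excluded by uniqueness of the
  ramified atom, or an idempotent.\<close>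

lemma ramified_atom_other:
  assumes "distributive_ext A S" "ramified_atom C" "atom_over A S D" "absorbs D" "C \<noteq> D"
  shows "decomposed_atom D"
proof -
  obtain x where C: "atom_over A S C" "absorbs C" "x \<in> C" "x \<notin> A" "x \<otimes> x \<in> m"
    using assms(2) unfolding ramified_atom_def by blast
  note CI = atom_overD(1)[OF C(1)] and DI = atom_overD(1)[OF assms(3)]
  note CC = interm_closed[OF CI] and DC = interm_closed[OF DI]
  have disj: "u \<in> C \<Longrightarrow> u \<in> D \<Longrightarrow> u \<in> A" for u using atoms_disjoint[OF C(1) assms(3,5)] by blast
  obtain y where y: "y \<in> D" "y \<notin> A" using atom_overD(2,3)[OF assms(3)] by blast
  have car [simp]: "x \<in> carrier S" "y \<in> carrier S" using C y CC DC by auto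
  have "\<exists>d\<in>D - A. x \<otimes> d \<in> m"
  proof -
    define w where "w = x \<otimes> y"
    have wc [simp]: "w \<in> carrier S" by (simp add: w_def)
    have xy: "(x \<otimes> x) \<otimes> (y \<otimes> y) \<in> m" using absorbsD[OF assms(4) C(5)] DC(4)[OF y(1,1)] by blast
    note L = line_product[OF CI DI C(3) y(1) xy, folded w_def]
    have "w \<otimes> w = (x \<otimes> x) \<otimes> (y \<otimes> y)" using car unfolding w_def by algebra
    then have wm: "w \<otimes> w \<in> m" using xy by simp
    show ?thesis
    proof (cases "w \<in> A")
      case True
      then have "w \<in> m" using wm m_prime by blast
      then show ?thesis using y by (auto simp: w_def)
    next
      case False
      have "line w \<noteq> A" using mem_line[OF wc] False by blast
      then have "C \<subseteq> line w \<or> D \<subseteq> line w" using atom_pair_cases[OF assms(1) C(1) assms(3) L] by blast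
      then show ?thesis
      proof
        assume "D \<subseteq> line w"
        then have "y \<in> C" using mem_line_product[OF CI C(3,5) assms(4) DI y(1)] y(1) by (auto simp: w_def)
        then show ?thesis using disj y by blast
      next
        assume "C \<subseteq> line w"
        then obtain a b where ab: "x = a \<oplus> b \<otimes> w" "a \<in> A" "b \<in> A" using C(3) unfolding line_def by blast
        have car3 [simp]: "a \<in> carrier S" "b \<in> carrier S" using ab by auto
        \<comment> \<open>From x = a + b x y one reads off x (1 - b y) = a, and a^2 = x^2 d^2 is in
          m, so a is in m.\<close>
        define d where "d = \<one> \<ominus> b \<otimes> y"
        have dD: "d \<in> D" unfolding d_def by (intro DC(5) DC(4) DC(2)[OF A_closed(2)] DC(2)[OF ab(3)] y(1))
        have car4 [simp]: "d \<in> carrier S" by (simp add: d_def)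
        have "x \<otimes> d = x \<ominus> b \<otimes> w" using car wc car3 car4 unfolding d_def w_def by algebra
        also have "\<dots> = (a \<oplus> b \<otimes> w) \<ominus> b \<otimes> w" by (rule arg_cong2[OF ab(1) refl])
        also have "\<dots> = a" using car wc car3 car4 by algebra
        finally have xd: "x \<otimes> d = a" .
        have "a \<otimes> a = (x \<otimes> x) \<otimes> (d \<otimes> d)" using car wc car3 car4 unfolding xd[symmetric] by algebra
        also have "\<dots> \<in> m" using absorbsD[OF assms(4) C(5)] DC(4)[OF dD dD] by blast
        finally have am: "a \<in> m" using m_prime[OF ab(2,2)] by blast
        have "d \<notin> A"
        proof
          assume dA: "d \<in> A"
          show False
          proof (cases "b \<in> m")
            case True
            then have "d \<notin> m" using absorbsD[OF assms(4) True y(1)] unit_or_one_minus_unit[of "b \<otimes> y"] by (simp add: d_def)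
            moreover have "d \<otimes> x \<in> A" using xd ab(2) by (simp add: m_comm)
            ultimately show False using unit_cancel_A[OF dA, of x] C(4) by simp
          next
            case False
            have "b \<otimes> y = \<one> \<ominus> d" using car wc car3 car4 unfolding d_def by algebra
            then show False using unit_cancel_A[OF ab(3) False, of y] dA y(2) by simp
          qed
        qed
        then show ?thesis using dD xd am by blast
      qed
    qed
  qed
  then obtain d where d: "d \<in> D" "d \<notin> A" "x \<otimes> d \<in> m" by blast
  show ?thesis
  proof (cases "d \<otimes> d \<in> m")
    case True
    then have "ramified_atom D" unfolding ramified_atom_def using assms(3,4) d by blast
    then show ?thesis using ramified_atom_unique[OF assms(1,2)] assms(5) by blast
  next
    case False
    then obtain e where "e \<in> D - A" "e \<otimes> e \<ominus> e \<in> m"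
      using absorbing_atom_element[OF assms(3,4) CI C(2-4) d] by blast
    then show ?thesis unfolding decomposed_atom_def using assms(3,4) by blast
  qed
qed

text \<open>One of the complementary idempotents x and 1 - x of C, called z, kills some d of D
  outside A modulo m. If d^2 were not in m, D would have an idempotent e with z e in m, and z + e
  would be idempotent, against \<open>atom_pair_line\<close>.\<close>

lemma decomposed_atom_other:
  assumes "distributive_ext A S" "decomposed_atom C" "atom_over A S D" "absorbs D" "C \<noteq> D"
  shows "ramified_atom D"
proof -
  obtain x where C: "atom_over A S C" "absorbs C" and x: "x \<in> C" "x \<notin> A" "x \<otimes> x \<ominus> x \<in> m"
    using assms(2) unfolding decomposed_atom_def by blast
  note CI = atom_overD(1)[OF C(1)] and DI = atom_overD(1)[OF assms(3)]
  note CC = interm_closed[OF CI] and DC = interm_closed[OF DI]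
  have disj: "u \<in> C \<Longrightarrow> u \<in> D \<Longrightarrow> u \<in> A" for u using atoms_disjoint[OF C(1) assms(3,5)] by blast
  obtain y where y: "y \<in> D" "y \<notin> A" using atom_overD(2,3)[OF assms(3)] by blast
  have car [simp]: "x \<in> carrier S" "y \<in> carrier S" using x y CC DC by auto
  let ?E = "\<lambda>x. {c \<oplus> x \<otimes> g | c g. c \<in> A \<and> g \<in> D}"
  \<comment> \<open>The ring A + x D contains x, so it is C or the compositum. In the second case y
    = c + x g, and 1 - x kills y - c modulo m.\<close>
  have step: "x \<otimes> y \<in> C \<or> (\<exists>d\<in>D - A. (\<one> \<ominus> x) \<otimes> d \<in> m)"
    if x: "x \<in> C" "x \<notin> A" "x \<otimes> x \<ominus> x \<in> m" for x
  proof -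
    have xc [simp]: "x \<in> carrier S" using x CC by blast
    have Dc: "g \<in> D \<Longrightarrow> g \<in> carrier S" for g using DC by blast
    have I: "c \<oplus> x \<otimes> g \<in> ?E x" if "c \<in> A" "g \<in> D" for c g using that by blast
    have E: "?E x \<in> interm A S"
    proof (rule adjoin_multiples_interm[OF DI xc])
      fix g assume g: "g \<in> D"
      have gc: "g \<in> carrier S" using Dc[OF g] .
      have "(x \<otimes> x) \<otimes> g = (x \<otimes> x \<ominus> x) \<otimes> g \<oplus> x \<otimes> g" using xc gc by algebra
      then show "\<exists>a\<in>A. \<exists>h\<in>D. (x \<otimes> x) \<otimes> g = a \<oplus> x \<otimes> h"
        using absorbsD[OF assms(4) x(3) g] g m_A by blast
    qed
    note K = compositum_interm[OF CI DI]
    have sub: "?E x \<subseteq> compositum S C D"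
    proof clarify
      fix c g assume cg: "c \<in> A" "g \<in> D"
      have "x \<in> compositum S C D" "g \<in> compositum S C D"
        using x(1) cg(2) compositum_upper1[of C D] compositum_upper2[of D C] by blast+
      then show "c \<oplus> x \<otimes> g \<in> compositum S C D"
        using interm_closed(3)[OF K interm_closed(2)[OF K cg(1)] interm_closed(4)[OF K]] by blast
    qed
    have "\<zero> \<oplus> x \<otimes> \<one> = x" by simp
    then have xE: "x \<in> ?E x" using I[OF A_closed(1) DC(2)[OF A_closed(2)]] by (simp only:)
    have "?E x \<in> {A, C, D, compositum S C D}" by (rule below_two_atoms[OF A assms(1) C(1) assms(3) E sub])
    moreover have "?E x \<noteq> A" "?E x \<noteq> D" using xE x(2) disj[OF x(1)] by metis+
    ultimately have "?E x = C \<or> ?E x = compositum S C D" by (simp only: insert_iff empty_iff simp_thms)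
    then show ?thesis
    proof
      assume EC: "?E x = C"
      have "\<zero> \<oplus> x \<otimes> y = x \<otimes> y" by simp
      then have "x \<otimes> y \<in> ?E x" using I[OF A_closed(1) y(1)] by (simp only:)
      then show ?thesis unfolding EC ..
    next
      assume EK: "?E x = compositum S C D"
      have "y \<in> compositum S C D" using y(1) compositum_upper2[of D C] by blast
      then have "y \<in> ?E x" unfolding EK .
      then obtain c g where cg: "y = c \<oplus> x \<otimes> g" "c \<in> A" "g \<in> D" by blast
      have car4 [simp]: "c \<in> carrier S" "g \<in> carrier S" using cg Dc by auto
      have "(\<one> \<ominus> x) \<otimes> (y \<ominus> c) = \<ominus> ((x \<otimes> x \<ominus> x) \<otimes> g)" using car xc car4 unfolding cg(1) by algebra
      then have "(\<one> \<ominus> x) \<otimes> (y \<ominus> c) \<in> m" using absorbsD[OF assms(4) x(3) cg(3)] by simp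
      moreover have "y \<ominus> c \<in> D" using y(1) DC(2)[OF cg(2)] DC(5) by blast
      moreover have "y \<ominus> c \<notin> A"
      proof
        assume "y \<ominus> c \<in> A"
        moreover have "y = (y \<ominus> c) \<oplus> c" using car xc car4 by algebra
        ultimately have "y \<in> A" using A_closed(4)[OF _ cg(2)] by metis
        then show False using y(2) by blast
      qed
      ultimately show ?thesis by blast
    qed
  qed
  define f where "f = \<one> \<ominus> x"
  have fC: "f \<in> C" unfolding f_def using CC(5)[OF CC(2)[OF A_closed(2)] x(1)] .
  have xf: "x = \<one> \<ominus> f" using car unfolding f_def by algebra
  have car5 [simp]: "f \<in> carrier S" by (simp add: f_def)
  have fA: "f \<notin> A"
  proof
    assume "f \<in> A"
    then have "\<one> \<ominus> f \<in> A" by simp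
    then show False using x(2) xf by metis
  qed
  have "f \<otimes> f \<ominus> f = x \<otimes> x \<ominus> x" using car car5 unfolding f_def by algebra
  then have ff: "f \<otimes> f \<ominus> f \<in> m" using x(3) by simp
  \<comment> \<open>Both products in C would put their sum y into C. So \<open>step\<close> yields
    its second alternative for x or for f.\<close>
  have "x \<otimes> y \<notin> C \<or> f \<otimes> y \<notin> C"
  proof (rule ccontr)
    assume "\<not> ?thesis"
    then have "x \<otimes> y \<oplus> f \<otimes> y \<in> C" using CC(3) by blast
    moreover have "y = x \<otimes> y \<oplus> f \<otimes> y" using car car5 unfolding f_def by algebra
    ultimately have "y \<in> C" by (simp only:)
    then show False using disj y by blast
  qed
  then obtain z d where z: "z \<in> C" "z \<notin> A" "z \<otimes> z \<ominus> z \<in> m" and d: "d \<in> D" "d \<notin> A" "z \<otimes> d \<in> m"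
    using step[OF x] step[OF fC fA ff] fC fA ff x xf[symmetric] unfolding f_def[symmetric] by auto
  show ?thesis
  proof (cases "d \<otimes> d \<in> m")
    case True
    then show ?thesis unfolding ramified_atom_def using assms(3,4) d by blast
  next
    case False
    then obtain e where e: "e \<in> D" "e \<notin> A" "e \<otimes> e \<ominus> e \<in> m" "z \<otimes> e \<in> m"
      using absorbing_atom_element[OF assms(3,4) CI C(2) z(1,2) d] by blast
    have car6 [simp]: "z \<in> carrier S" "e \<in> carrier S" using z e CC DC by auto
    have "(z \<oplus> e) \<otimes> (z \<oplus> e) = ((z \<otimes> z \<ominus> z) \<oplus> (e \<otimes> e \<ominus> e) \<oplus> (z \<otimes> e \<oplus> z \<otimes> e)) \<oplus> \<one> \<otimes> (z \<oplus> e)"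
      using car car5 car6 by algebra
    then have False
      by (rule atom_pair_line[OF assms(1) C(1) assms(3,5) z(1,2) e(1,2)]) (use z(3) e(3,4) in simp_all)
    then show ?thesis ..
  qed
qed

end

section \<open>Minimal ramified and minimal decomposed extensions\<close>

context ambient_ring
begin

text \<open>The coset of a goes to Q + a. Injectivity comes from dividing by Q \<inter> A,
  surjectivity from S = A + Q.\<close>

lemma natural_isoI:
  assumes A: "subring A S" and Q: "ideal Q S"
    and surj: "\<And>t. t \<in> carrier S \<Longrightarrow> \<exists>a\<in>A. t \<ominus> a \<in> Q"
  shows "natural_iso A S (Q \<inter> A) Q"
proof -
  let ?R = "S\<lparr>carrier := A\<rparr>" and ?P = "Q \<inter> A"
  note AE = subringE[OF A]
  interpret R: cring ?R using subring_cring[OF A] .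
  interpret Q: ideal Q S by fact
  note QA = additive_subgroup.a_closed[OF Q.is_additive_subgroup]
  have z: "\<zero> \<in> Q" using additive_subgroup.zero_closed[OF Q.is_additive_subgroup] .
  have Ac: "a \<in> A \<Longrightarrow> a \<in> carrier S" for a using AE(1) by blast
  have PI: "ideal ?P ?R"
    by (rule ideal_of_subringI[OF A]) (use z AE QA Q.I_l_closed Ac in auto)
  interpret P: ideal ?P ?R by fact
  have f: "Q <+>\<^bsub>S\<^esub> (?P +>\<^bsub>?R\<^esub> a) = Q +> a" if a: "a \<in> A" for a
  proof
    show "Q <+>\<^bsub>S\<^esub> (?P +>\<^bsub>?R\<^esub> a) \<subseteq> Q +> a"
    proof
      fix x assume "x \<in> Q <+>\<^bsub>S\<^esub> (?P +>\<^bsub>?R\<^esub> a)"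
      then obtain q p where qp: "q \<in> Q" "p \<in> ?P" "x = q \<oplus> (p \<oplus> a)"
        by (auto simp: set_add_def' a_r_coset_def')
      then have "x = (q \<oplus> p) \<oplus> a" using a Ac Q.Icarr by (simp add: a_assoc)
      then show "x \<in> Q +> a" using QA qp by (auto simp: a_r_coset_def')
    qed
    show "Q +> a \<subseteq> Q <+>\<^bsub>S\<^esub> (?P +>\<^bsub>?R\<^esub> a)"
    proof
      fix x assume "x \<in> Q +> a"
      then obtain q where q: "q \<in> Q" "x = q \<oplus> a" by (auto simp: a_r_coset_def')
      have "x = q \<oplus> (\<zero> \<oplus> a)" using q(2) a Ac by simp
      moreover have "\<zero> \<oplus> a \<in> ?P +>\<^bsub>?R\<^esub> a" using z AE(2) by (auto simp: a_r_coset_def')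
      ultimately show "x \<in> Q <+>\<^bsub>S\<^esub> (?P +>\<^bsub>?R\<^esub> a)" using q(1) unfolding set_add_def' by blast
    qed
  qed
  have cR: "carrier (?R Quot ?P) = (\<lambda>a. ?P +>\<^bsub>?R\<^esub> a) ` A"
    by (auto simp: FactRing_def A_RCOSETS_def')
  have cS: "carrier (S Quot Q) = (\<lambda>a. Q +> a) ` carrier S"
    by (auto simp: FactRing_def A_RCOSETS_def')
  let ?f = "\<lambda>c. Q <+>\<^bsub>S\<^esub> c"
  have "?f \<in> ring_hom (?R Quot ?P) (S Quot Q)"
  proof (rule ring_hom_memI)
    fix c assume "c \<in> carrier (?R Quot ?P)"
    then obtain a where a: "a \<in> A" "c = ?P +>\<^bsub>?R\<^esub> a" unfolding cR by blast
    then show "?f c \<in> carrier (S Quot Q)" unfolding cS using f Ac by auto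
    fix d assume "d \<in> carrier (?R Quot ?P)"
    then obtain b where b: "b \<in> A" "d = ?P +>\<^bsub>?R\<^esub> b" unfolding cR by blast
    have "c \<otimes>\<^bsub>?R Quot ?P\<^esub> d = ?P +>\<^bsub>?R\<^esub> (a \<otimes> b)"
      using P.rcoset_mult_add[of a b] a b by (simp add: FactRing_def)
    then show "?f (c \<otimes>\<^bsub>?R Quot ?P\<^esub> d) = ?f c \<otimes>\<^bsub>S Quot Q\<^esub> ?f d"
      using a b f AE(6) Q.rcoset_mult_add[of a b] Ac by (simp add: FactRing_def)
    have "c \<oplus>\<^bsub>?R Quot ?P\<^esub> d = ?P +>\<^bsub>?R\<^esub> (a \<oplus> b)"
      using P.a_rcos_sum[of a b] a b by (simp add: FactRing_def)
    then show "?f (c \<oplus>\<^bsub>?R Quot ?P\<^esub> d) = ?f c \<oplus>\<^bsub>S Quot Q\<^esub> ?f d"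
      using a b f AE(7) Q.a_rcos_sum[of a b] Ac by (simp add: FactRing_def)
  next
    show "?f \<one>\<^bsub>?R Quot ?P\<^esub> = \<one>\<^bsub>S Quot Q\<^esub>" using f[OF AE(3)] by (simp add: FactRing_def)
  qed
  moreover have "bij_betw ?f (carrier (?R Quot ?P)) (carrier (S Quot Q))"
  proof (rule bij_betwI')
    fix c d assume "c \<in> carrier (?R Quot ?P)" "d \<in> carrier (?R Quot ?P)"
    then obtain a b where ab: "a \<in> A" "c = ?P +>\<^bsub>?R\<^esub> a" "b \<in> A" "d = ?P +>\<^bsub>?R\<^esub> b" unfolding cR by blast
    have "c = d" if "?f c = ?f d"
    proof -
      have "Q +> a = Q +> b" using that ab f by simp
      then have "a \<in> Q +> b" using Q.a_rcos_self[of a] ab Ac by simp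
      then obtain q where q: "q \<in> Q" "a = q \<oplus> b" by (auto simp: a_r_coset_def')
      have qc: "q \<in> carrier S" "b \<in> carrier S" using q Q.Icarr ab Ac by auto
      have "q = a \<ominus> b" unfolding q(2) using qc by (simp add: minus_eq a_assoc r_neg)
      then have "q \<in> A" using AE(5,7) ab by (simp add: minus_eq)
      then have "a \<in> ?P +>\<^bsub>?R\<^esub> b" using q by (auto simp: a_r_coset_def')
      then show "c = d" using P.a_repr_independence'[of a b] ab R.a_repr_independence[of a ?P b]
          P.a_subgroup by simp
    qed
    then show "(?f c = ?f d) = (c = d)" by blast
  next
    show "?f c \<in> carrier (S Quot Q)" if "c \<in> carrier (?R Quot ?P)" for c
      using that f Ac unfolding cR cS by auto
    fix y assume "y \<in> carrier (S Quot Q)"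
    then obtain t where t: "t \<in> carrier S" "y = Q +> t" unfolding cS by blast
    then obtain a where a: "a \<in> A" "t \<ominus> a \<in> Q" using surj by blast
    have "t = (t \<ominus> a) \<oplus> a" using t a Ac by (simp add: minus_eq a_assoc l_neg)
    then have "t \<in> Q +> a" using a(2) unfolding a_r_coset_def' by blast
    then have "y = Q +> a" using a_repr_independence[OF _ Ac[OF a(1)] Q.a_subgroup, of t] t(2) by simp
    then show "\<exists>c\<in>carrier (?R Quot ?P). y = ?f c" using f[OF a(1)] a(1) unfolding cR by auto
  qed
  ultimately show ?thesis unfolding natural_iso_def ring_iso_def by blast
qed

text \<open>Surjectivity on cosets, turned into S = Q + P + A for elements.\<close>

lemma natural_iso_surjD:
  assumes "natural_iso A S P Q" "ideal Q S" "t \<in> carrier S"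
  obtains q p a where "q \<in> Q" "p \<in> P" "a \<in> A" "t = q \<oplus> (p \<oplus> a)"
proof -
  have "(\<lambda>c. Q <+>\<^bsub>S\<^esub> c) ` carrier (S\<lparr>carrier := A\<rparr> Quot P) = carrier (S Quot Q)"
    using assms(1) unfolding natural_iso_def ring_iso_def bij_betw_def by blast
  moreover have "Q +> t \<in> carrier (S Quot Q)" using assms(3) by (auto simp: FactRing_def A_RCOSETS_def')
  ultimately obtain c where c: "c \<in> carrier (S\<lparr>carrier := A\<rparr> Quot P)" "Q +> t = Q <+>\<^bsub>S\<^esub> c" by blast
  obtain a where a: "a \<in> A" "c = P +>\<^bsub>S\<lparr>carrier := A\<rparr>\<^esub> a" using c(1) by (auto simp: FactRing_def A_RCOSETS_def')
  interpret Q: ideal Q S by fact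
  have "t \<in> Q +> t" using Q.a_rcos_self[OF assms(3)] .
  then have "t \<in> Q <+>\<^bsub>S\<^esub> (P +>\<^bsub>S\<lparr>carrier := A\<rparr>\<^esub> a)" using c(2) a(2) by simp
  then show ?thesis using that a(1) by (auto simp: set_add_def' a_r_coset_def')
qed

lemma subring_in_subring:
  assumes "subring A S" "subring T S" "A \<subseteq> T"
  shows "subring A (S\<lparr>carrier := T\<rparr>)"
proof -
  interpret T: ring "S\<lparr>carrier := T\<rparr>" using subring_is_ring[OF assms(2)] .
  show ?thesis using assms(3) subring_is_ring[OF assms(1)] by (intro T.ring_incl_imp_subring) auto
qed

text \<open>The classes of 1 and x form a basis: adjoining 1 to the zero space gives the image of A,
  adjoining x gives everything. The class of x is new because P lies in A and x does not.\<close>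

lemma quotient_dimension_two:
  assumes A: "subring A S" and P: "ideal P S" "P \<subseteq> A" "\<one> \<notin> P" and x: "x \<in> carrier S" "x \<notin> A"
    and gen: "\<And>t. t \<in> carrier S \<Longrightarrow> \<exists>a\<in>A. \<exists>b\<in>A. t = a \<oplus> b \<otimes> x"
  shows "ring.dimension (S Quot P) 2 (carrier (S\<lparr>carrier := A\<rparr> Quot P)) (carrier (S Quot P))"
proof -
  interpret P: ideal P S by fact
  interpret Q: ring "S Quot P" by (rule P.quotient_is_ring)
  note AE = subringE[OF A]
  have Ac: "a \<in> A \<Longrightarrow> a \<in> carrier S" for a using AE(1) by blast
  let ?K = "carrier (S\<lparr>carrier := A\<rparr> Quot P)"
  have K: "?K = (\<lambda>a. P +> a) ` A"
    by (auto simp: FactRing_def A_RCOSETS_def' a_r_coset_def')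
  have c: "carrier (S Quot P) = (\<lambda>a. P +> a) ` carrier S"
    by (auto simp: FactRing_def A_RCOSETS_def')
  have Q0: "\<zero>\<^bsub>S Quot P\<^esub> = P +> \<zero>" using a_coset_add_zero[OF P.a_subset] by (simp add: FactRing_def)
  have Q1: "\<one>\<^bsub>S Quot P\<^esub> = P +> \<one>" by (simp add: FactRing_def)
  have mult: "(P +> a) \<otimes>\<^bsub>S Quot P\<^esub> (P +> b) = P +> (a \<otimes> b)" if "a \<in> carrier S" "b \<in> carrier S" for a b
    using P.rcoset_mult_add[OF that] by (simp add: FactRing_def)
  have add: "(P +> a) \<oplus>\<^bsub>S Quot P\<^esub> (P +> b) = P +> (a \<oplus> b)" if "a \<in> carrier S" "b \<in> carrier S" for a b
    using P.a_rcos_sum[OF that] by (simp add: FactRing_def)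
  have eqD: "\<exists>p\<in>P. a = p \<oplus> b" if "P +> a = P +> b" "a \<in> carrier S" "b \<in> carrier S" for a b
    using P.a_rcos_self[OF that(2)] that(1) by (auto simp: a_r_coset_def')
  have d1: "Q.line_extension ?K \<one>\<^bsub>S Quot P\<^esub> {\<zero>\<^bsub>S Quot P\<^esub>} = ?K"
  proof (rule Set.set_eqI)
    fix u
    have kc: "k \<in> carrier (S Quot P)" if "k \<in> ?K" for k using that Ac unfolding K c by blast
    show "u \<in> Q.line_extension ?K \<one>\<^bsub>S Quot P\<^esub> {\<zero>\<^bsub>S Quot P\<^esub>} \<longleftrightarrow> u \<in> ?K"
      unfolding Q.line_extension_mem_iff using kc by auto
  qed
  have d2: "Q.line_extension ?K (P +> x) ?K = carrier (S Quot P)"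
  proof (rule Set.set_eqI)
    fix u
    show "u \<in> Q.line_extension ?K (P +> x) ?K \<longleftrightarrow> u \<in> carrier (S Quot P)"
    proof
      assume "u \<in> Q.line_extension ?K (P +> x) ?K"
      then obtain a b where "a \<in> A" "b \<in> A" "u = (P +> a) \<otimes>\<^bsub>S Quot P\<^esub> (P +> x) \<oplus>\<^bsub>S Quot P\<^esub> (P +> b)"
        unfolding Q.line_extension_mem_iff K by blast
      then have "u = P +> (a \<otimes> x \<oplus> b)" "a \<otimes> x \<oplus> b \<in> carrier S" using mult add x Ac by auto
      then show "u \<in> carrier (S Quot P)" unfolding c by blast
    next
      assume "u \<in> carrier (S Quot P)"
      then obtain t where t: "t \<in> carrier S" "u = P +> t" unfolding c by blast
      obtain a b where ab: "a \<in> A" "b \<in> A" "t = a \<oplus> b \<otimes> x" using gen[OF t(1)] by blast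
      have "u = (P +> b) \<otimes>\<^bsub>S Quot P\<^esub> (P +> x) \<oplus>\<^bsub>S Quot P\<^esub> (P +> a)"
        using ab x Ac t(2) mult add by (simp add: a_comm)
      then show "u \<in> Q.line_extension ?K (P +> x) ?K"
        unfolding Q.line_extension_mem_iff K using ab by blast
    qed
  qed
  have "Q.dimension (Suc 0) ?K (Q.line_extension ?K \<one>\<^bsub>S Quot P\<^esub> {\<zero>\<^bsub>S Quot P\<^esub>})"
  proof (rule Q.Suc_dim[OF Q.one_closed _ Q.zero_dim])
    show "\<one>\<^bsub>S Quot P\<^esub> \<notin> {\<zero>\<^bsub>S Quot P\<^esub>}"
    proof
      assume "\<one>\<^bsub>S Quot P\<^esub> \<in> {\<zero>\<^bsub>S Quot P\<^esub>}"
      then have "P +> \<one> = P +> \<zero>" using Q0 Q1 by simp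
      then obtain p where "p \<in> P" "\<one> = p \<oplus> \<zero>" using eqD by blast
      then show False using P(3) P.Icarr by auto
    qed
  qed
  then have "Q.dimension (Suc 0) ?K ?K" by (simp only: d1)
  then have "Q.dimension (Suc (Suc 0)) ?K (Q.line_extension ?K (P +> x) ?K)"
  proof (rule Q.Suc_dim[rotated 2])
    show "P +> x \<in> carrier (S Quot P)" using x(1) unfolding c by blast
    show "P +> x \<notin> ?K"
    proof
      assume "P +> x \<in> ?K"
      then obtain a where a: "a \<in> A" "P +> x = P +> a" unfolding K by blast
      then obtain p where "p \<in> P" "x = p \<oplus> a" using eqD x(1) Ac by blast
      then show False using P(2) a(1) x(2) AE(7) by blast
    qed
  qed
  then show ?thesis by (simp only: d2 numeral_2_eq_2)
qed

end

context local_subring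
begin

text \<open>A unit of A in the conductor would carry x into A and could be cancelled.\<close>

lemma conductor_atom:
  assumes "T \<in> interm A S" "absorbs T" "x \<in> T" "x \<notin> A"
  shows "conductor A (S\<lparr>carrier := T\<rparr>) = m"
proof
  show "m \<subseteq> conductor A (S\<lparr>carrier := T\<rparr>)"
    using absorbsD[OF assms(2)] by (auto simp: conductor_def)
  show "conductor A (S\<lparr>carrier := T\<rparr>) \<subseteq> m"
  proof (rule subsetI, rule ccontr)
    fix a assume a: "a \<in> conductor A (S\<lparr>carrier := T\<rparr>)" "a \<notin> m"
    then have "a \<in> A" "a \<otimes> x \<in> A" using assms(3) by (auto simp: conductor_def)
    then show False using unit_cancel_A[OF _ a(2)] assms(4) interm_closed(1)[OF assms(1,3)] by blast
  qed
qed

lemma m_maximal: "maximalideal m (S\<lparr>carrier := A\<rparr>)"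
proof (rule maximalideal_of_subringI[OF A m_ideal one_notin_m])
  fix s assume "s \<in> A - m"
  then obtain b where "b \<in> A" "s \<otimes> b = \<one>" using m_unit by blast
  then have "b \<in> A \<and> s \<otimes> b \<oplus> \<zero> = \<one>" by simp
  then show "\<exists>r\<in>A. \<exists>p\<in>m. s \<otimes> r \<oplus> p = \<one>" using m_closed(1) by blast
qed

lemma maximal_unique:
  assumes "maximalideal P (S\<lparr>carrier := A\<rparr>)"
  shows "P = m"
proof -
  interpret P: maximalideal P "S\<lparr>carrier := A\<rparr>" by fact
  note PE = ideal_of_subringD[OF A P.ideal_axioms]
  have one: "\<one> \<notin> P" using P.one_imp_carrier P.I_notcarr by auto
  have "P \<subseteq> m"
  proof (rule subsetI, rule ccontr)
    fix a assume a: "a \<in> P" "a \<notin> m"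
    then obtain b where b: "b \<in> A" "a \<otimes> b = \<one>" using m_unit PE(1) by blast
    have "b \<otimes> a = \<one>" using b a(1) PE(1) m_comm[of b a] by auto
    then show False using PE(4)[OF b(1) a(1)] one by simp
  qed
  then show ?thesis using P.I_maximal[OF m_ideal] mE(1) one_notin_m A_closed(2) by auto
qed

text \<open>The maximal ideal \<open>m + A x\<close> of \<open>A[x]\<close> when \<open>x\<^sup>2 - q x \<in> m\<close>.\<close>

lemma maximal_over:
  assumes T: "T \<in> interm A S" "absorbs T" and x: "x \<in> T" "x \<notin> A" and line: "T = line x"
    and q: "x \<otimes> x \<ominus> q \<otimes> x \<in> m" "q \<in> A"
  defines "N \<equiv> {a \<oplus> b \<otimes> x | a b. a \<in> m \<and> b \<in> A}"
  shows "maximalideal N (S\<lparr>carrier := T\<rparr>)" "N \<inter> A = m" "\<And>t. t \<in> T \<Longrightarrow> \<exists>a\<in>A. t \<ominus> a \<in> N" "x \<in> N"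
proof -
  note TC = interm_closed[OF T(1)]
  have xc [simp]: "x \<in> carrier S" and qc [simp]: "q \<in> carrier S" using x q(2) TC by auto
  note TS = intermD(1)[OF T(1)]
  have I: "a \<oplus> b \<otimes> x \<in> N" if "a \<in> m" "b \<in> A" for a b using that unfolding N_def by blast
  have "\<zero> \<oplus> \<one> \<otimes> x = x" by simp
  then show xN: "x \<in> N" using I[OF m_closed(1) A_closed(2)] by (simp only:)
  have NT: "N \<subseteq> T"
  proof
    fix y assume "y \<in> N"
    then obtain a b where "y = a \<oplus> b \<otimes> x" "a \<in> m" "b \<in> A" unfolding N_def by blast
    then show "y \<in> T" unfolding line line_def using m_A by blast
  qed
  have ideal: "ideal N (S\<lparr>carrier := T\<rparr>)"
  proof (rule ideal_of_subringI[OF TS NT])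
    have "\<zero> \<oplus> \<zero> \<otimes> x = \<zero>" by simp
    then show "\<zero> \<in> N" using I[OF m_closed(1) A_closed(1)] by (simp only:)
    fix u y assume "y \<in> N"
    then obtain a b where y: "y = a \<oplus> b \<otimes> x" "a \<in> m" "b \<in> A" unfolding N_def by blast
    have car [simp]: "a \<in> carrier S" "b \<in> carrier S" using y by auto
    show "u \<oplus> y \<in> N" if "u \<in> N"
    proof -
      obtain c d where u: "u = c \<oplus> d \<otimes> x" "c \<in> m" "d \<in> A" using \<open>u \<in> N\<close> unfolding N_def by blast
      have car2 [simp]: "c \<in> carrier S" "d \<in> carrier S" using u by auto
      have "u \<oplus> y = (c \<oplus> a) \<oplus> (d \<oplus> b) \<otimes> x" using xc qc car car2 unfolding u(1) y(1) by algebra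
      then show ?thesis using I[OF m_closed(2)[OF u(2) y(2)] A_closed(4)[OF u(3) y(3)]] by simp
    qed
    show "u \<otimes> y \<in> N" if "u \<in> T"
    proof -
      obtain c d where u: "u = c \<oplus> d \<otimes> x" "c \<in> A" "d \<in> A" using \<open>u \<in> T\<close> unfolding line line_def by blast
      have car3 [simp]: "c \<in> carrier S" "d \<in> carrier S" using u by auto
      \<comment> \<open>x^2 is written as (x^2 - q x) + q x, where the first summand lies in
        m.\<close>
      have "u \<otimes> y = (c \<otimes> a \<oplus> (d \<otimes> b) \<otimes> (x \<otimes> x \<ominus> q \<otimes> x)) \<oplus> (c \<otimes> b \<oplus> d \<otimes> a \<oplus> d \<otimes> b \<otimes> q) \<otimes> x"
        using xc qc car car3 unfolding u(1) y(1) by algebra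
      moreover have "c \<otimes> a \<oplus> (d \<otimes> b) \<otimes> (x \<otimes> x \<ominus> q \<otimes> x) \<in> m"
        using u(2,3) y(2,3) q by (intro m_closed(2,4) A_closed(5))
      moreover have "c \<otimes> b \<oplus> d \<otimes> a \<oplus> d \<otimes> b \<otimes> q \<in> A" using u y q by simp
      ultimately show ?thesis using I by simp
    qed
  qed
  have split: "b \<in> m" if "a \<in> A" "b \<in> A" "a \<oplus> b \<otimes> x \<in> A" for a b
  proof (rule ccontr)
    assume "b \<notin> m"
    have car4 [simp]: "a \<in> carrier S" "b \<in> carrier S" using that by auto
    have "b \<otimes> x = (a \<oplus> b \<otimes> x) \<ominus> a" using xc qc car4 by algebra
    then have "b \<otimes> x \<in> A" using A_closed(6)[OF that(3,1)] by simp
    then show False using unit_cancel_A[OF that(2) \<open>b \<notin> m\<close> xc] x(2) by blast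
  qed
  show NA: "N \<inter> A = m"
  proof
    show "N \<inter> A \<subseteq> m"
    proof
      fix y assume y: "y \<in> N \<inter> A"
      then obtain a b where ab: "y = a \<oplus> b \<otimes> x" "a \<in> m" "b \<in> A" unfolding N_def by blast
      then have "b \<in> m" using split[of a b] y by simp
      then show "y \<in> m" unfolding ab(1) using ab(2) absorbsD[OF T(2) _ x(1)] by simp
    qed
    show "m \<subseteq> N \<inter> A"
    proof
      fix a assume a: "a \<in> m"
      then have "a \<oplus> \<zero> \<otimes> x = a" by simp
      then show "a \<in> N \<inter> A" using I[OF a A_closed(1)] a by auto
    qed
  qed
  show "\<exists>a\<in>A. t \<ominus> a \<in> N" if "t \<in> T" for t
  proof -
    obtain a b where t: "t = a \<oplus> b \<otimes> x" "a \<in> A" "b \<in> A" using \<open>t \<in> T\<close> unfolding line line_def by blast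
    have car5 [simp]: "a \<in> carrier S" "b \<in> carrier S" using t by auto
    have "t \<ominus> a = \<zero> \<oplus> b \<otimes> x" using xc qc car5 unfolding t(1) by algebra
    then show ?thesis using I[OF m_closed(1) t(3)] t(2) by metis
  qed
  show "maximalideal N (S\<lparr>carrier := T\<rparr>)"
  proof (rule maximalideal_of_subringI[OF TS ideal])
    show "\<one> \<notin> N" using NA one_notin_m A_closed(2) by blast
    fix s assume s: "s \<in> T - N"
    then obtain a b where ab: "s = a \<oplus> b \<otimes> x" "a \<in> A" "b \<in> A" unfolding line line_def by blast
    have car6 [simp]: "a \<in> carrier S" "b \<in> carrier S" using ab by auto
    have "a \<notin> m" using s ab I by blast
    then obtain w where w: "w \<in> A" "a \<otimes> w = \<one>" using m_unit ab(2) by blast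
    have car7 [simp]: "w \<in> carrier S" using w by simp
    have "s \<otimes> w \<oplus> (\<zero> \<oplus> (\<ominus> (b \<otimes> w)) \<otimes> x) = a \<otimes> w" using xc qc car6 car7 unfolding ab(1) by algebra
    then show "\<exists>r\<in>T. \<exists>p\<in>N. s \<otimes> r \<oplus> p = \<one>"
      using I[OF m_closed(1), of "\<ominus> (b \<otimes> w)"] w ab TC(2)[OF w(1)] by (metis A_closed(3,5))
  qed
qed

lemma interm_ring:
  assumes T: "T \<in> interm A S"
  shows "ambient_ring (S\<lparr>carrier := T\<rparr>)" "subring A (S\<lparr>carrier := T\<rparr>)"
  using ambient_ring.intro[OF subring_cring[OF intermD(1)[OF T]]] subring_in_subring[OF A intermD(1,2)[OF T]]
  by auto

lemma natural_iso_over: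
  assumes T: "T \<in> interm A S" and N: "maximalideal N (S\<lparr>carrier := T\<rparr>)" "N \<inter> A = m"
    and surj: "\<And>t. t \<in> T \<Longrightarrow> \<exists>a\<in>A. t \<ominus> a \<in> N"
  shows "natural_iso A (S\<lparr>carrier := T\<rparr>) m N"
  unfolding N(2)[symmetric]
proof -
  note TC = interm_closed[OF T]
  interpret T: ambient_ring "S\<lparr>carrier := T\<rparr>" using interm_ring(1)[OF T] .
  show "natural_iso A (S\<lparr>carrier := T\<rparr>) (N \<inter> A) N"
  proof (rule T.natural_isoI[OF interm_ring(2)[OF T] maximalideal.axioms(1)[OF N(1)]])
    fix t assume "t \<in> carrier (S\<lparr>carrier := T\<rparr>)"
    then obtain a where a: "t \<in> T" "a \<in> A" "t \<ominus> a \<in> N" using surj by auto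
    have "\<ominus>\<^bsub>S\<lparr>carrier := T\<rparr>\<^esub> a = \<ominus> a"
      by (rule T.minus_equality) (use a(2) TC l_neg in auto)
    then have "t \<ominus>\<^bsub>S\<lparr>carrier := T\<rparr>\<^esub> a = t \<ominus> a" by (simp add: minus_eq T.minus_eq)
    then show "\<exists>a\<in>A. t \<ominus>\<^bsub>S\<lparr>carrier := T\<rparr>\<^esub> a \<in> N"
      using a(2,3) by metis
  qed
qed

lemma atom_line:
  assumes "atom_over A S T" "x \<in> T" "x \<notin> A" "x \<otimes> x \<ominus> q \<otimes> x \<in> m" "q \<in> A"
  shows "T = line x"
proof -
  note TI = atom_overD(1)[OF assms(1)]
  have car [simp]: "x \<in> carrier S" "q \<in> carrier S" using interm_closed[OF TI] assms by auto
  have "x \<otimes> x = (x \<otimes> x \<ominus> q \<otimes> x) \<oplus> q \<otimes> x" using car by algebra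
  then have "line x \<in> interm A S" by (rule line_interm[rotated]) (use assms in simp_all)
  then show ?thesis using atom_overD(4)[OF assms(1) _ line_subset[OF TI assms(2)]] mem_line[of x] assms(3) by auto
qed

lemma ramified_atom_minimal_ramified:
  assumes "ramified_atom T"
  shows "minimal_ramified A (S\<lparr>carrier := T\<rparr>)"
proof -
  obtain x where T: "atom_over A S T" "absorbs T" and x: "x \<in> T" "x \<notin> A" "x \<otimes> x \<in> m"
    using assms unfolding ramified_atom_def by blast
  note TI = atom_overD(1)[OF T(1)]
  note TC = interm_closed[OF TI]
  have xc [simp]: "x \<in> carrier S" using x TC by blast
  have q: "x \<otimes> x \<ominus> \<zero> \<otimes> x \<in> m" using x(3) by (simp add: minus_eq)
  note line = atom_line[OF T(1) x(1,2) q A_closed(1)]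
  \<comment> \<open>The nilpotent case q = 0; this ideal serves as M'.\<close>
  define N where "N = {a \<oplus> b \<otimes> x | a b. a \<in> m \<and> b \<in> A}"
  note N = maximal_over[OF TI T(2) x(1,2) line q A_closed(1), folded N_def]
  interpret T: ambient_ring "S\<lparr>carrier := T\<rparr>" using interm_ring(1)[OF TI] .
  note AT = interm_ring(2)[OF TI]
  note nat = natural_iso_over[OF TI N(1-3)]
  have mT: "ideal m (S\<lparr>carrier := T\<rparr>)"
    by (rule ideal_of_subringI[OF intermD(1)[OF TI]]) (use TC(2) absorbs_closed[OF T(2) TI] in auto)
  have prod: "y \<in> m" if "y \<in> N \<cdot>\<^bsub>S\<lparr>carrier := T\<rparr>\<^esub> N" for y
    using that
  proof (induction rule: ideal_prod.induct)
    case (prod i j)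
    obtain a b c d where ij: "i = a \<oplus> b \<otimes> x" "a \<in> m" "b \<in> A" "j = c \<oplus> d \<otimes> x" "c \<in> m" "d \<in> A"
      using prod unfolding N_def by blast
    have car [simp]: "a \<in> carrier S" "b \<in> carrier S" "c \<in> carrier S" "d \<in> carrier S" using ij by auto
    have "i \<otimes> j = a \<otimes> c \<oplus> (d \<otimes> (a \<otimes> x) \<oplus> b \<otimes> (c \<otimes> x)) \<oplus> (b \<otimes> d) \<otimes> (x \<otimes> x)"
      using xc car unfolding ij(1,4) by algebra
    then show ?case using ij x(3) absorbsD[OF T(2) ij(2) x(1)] absorbsD[OF T(2) ij(5) x(1)] by simp
  qed (simp add: ring_record_simps)
  have dim: "ring.dimension ((S\<lparr>carrier := T\<rparr>) Quot m) 2 (carrier (S\<lparr>carrier := A\<rparr> Quot m))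
      (carrier ((S\<lparr>carrier := T\<rparr>) Quot m))"
  proof -
    have "\<exists>a\<in>A. \<exists>b\<in>A. t = a \<oplus> b \<otimes> x" if "t \<in> T" for t
      using that unfolding line line_def by blast
    then show ?thesis using T.quotient_dimension_two[OF AT mT _ _ _ x(2)] one_notin_m x(1) by (auto simp: subset_iff)
  qed
  have "A \<subset> T" using atom_overD(2,3)[OF T(1)] by blast
  moreover have "m \<subset> N" using N(2,4) x(2) by auto
  ultimately show ?thesis
    unfolding minimal_ramified_def Let_def conductor_atom[OF TI T(2) x(1,2)]
    using m_maximal N(1) prod dim nat by auto
qed

lemma decomposed_atom_minimal_decomposed:
  assumes "decomposed_atom T"
  shows "minimal_decomposed A (S\<lparr>carrier := T\<rparr>)"
proof -
  obtain x where T: "atom_over A S T" "absorbs T" and x: "x \<in> T" "x \<notin> A" "x \<otimes> x \<ominus> x \<in> m"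
    using assms unfolding decomposed_atom_def by blast
  note TI = atom_overD(1)[OF T(1)]
  note TC = interm_closed[OF TI]
  have xc [simp]: "x \<in> carrier S" using x TC by blast
  \<comment> \<open>The complementary idempotent modulo m; m + A x and m + A y are the two maximal
    ideals.\<close>
  define y where "y = \<one> \<ominus> x"
  have yc [simp]: "y \<in> carrier S" by (simp add: y_def)
  have yT: "y \<in> T" unfolding y_def using TC(5)[OF TC(2)[OF A_closed(2)] x(1)] .
  have xy: "\<one> \<ominus> y = \<one> \<otimes> x" using xc yc unfolding y_def by algebra
  have yA: "y \<notin> A"
  proof
    assume "y \<in> A"
    then have "\<one> \<ominus> y \<in> A" by simp
    then show False using x(2) xy by simp
  qed
  have yy: "y \<otimes> y \<ominus> y = x \<otimes> x \<ominus> x" using xc yc unfolding y_def by algebra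
  have qx: "x \<otimes> x \<ominus> \<one> \<otimes> x \<in> m" and qy: "y \<otimes> y \<ominus> \<one> \<otimes> y \<in> m" using x(3) yy by simp_all
  note lx = atom_line[OF T(1) x(1,2) qx A_closed(2)] and ly = atom_line[OF T(1) yT yA qy A_closed(2)]
  define N1 where "N1 = {a \<oplus> b \<otimes> x | a b. a \<in> m \<and> b \<in> A}"
  define N2 where "N2 = {a \<oplus> b \<otimes> y | a b. a \<in> m \<and> b \<in> A}"
  note N1 = maximal_over[OF TI T(2) x(1,2) lx qx A_closed(2), folded N1_def]
  note N2 = maximal_over[OF TI T(2) yT yA ly qy A_closed(2), folded N2_def]
  have inter: "m = N1 \<inter> N2"
  proof
    show "m \<subseteq> N1 \<inter> N2" using N1(2) N2(2) by blast
    show "N1 \<inter> N2 \<subseteq> m"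
    proof
      fix t assume t: "t \<in> N1 \<inter> N2"
      then obtain a b c d where t1: "t = a \<oplus> b \<otimes> x" "a \<in> m" "b \<in> A" and t2: "t = c \<oplus> d \<otimes> y" "c \<in> m" "d \<in> A"
        unfolding N1_def N2_def by blast
      have car [simp]: "a \<in> carrier S" "b \<in> carrier S" "c \<in> carrier S" "d \<in> carrier S" using t1 t2 by auto
      have car2 [simp]: "t \<in> carrier S" unfolding t1(1) by simp
      have "t \<otimes> x = (c \<oplus> d \<otimes> y) \<otimes> x" by (simp only: t2(1)[symmetric])
      also have "\<dots> = c \<otimes> x \<ominus> d \<otimes> (x \<otimes> x \<ominus> x)" using xc yc car car2 unfolding y_def by algebra
      finally have 1: "t \<otimes> x \<in> m" using absorbsD[OF T(2) t2(2) x(1)] t2(3) x(3) by simp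
      have "t \<otimes> y = (a \<oplus> b \<otimes> x) \<otimes> y" by (simp only: t1(1)[symmetric])
      also have "\<dots> = a \<otimes> y \<ominus> b \<otimes> (x \<otimes> x \<ominus> x)" using xc yc car car2 unfolding y_def by algebra
      finally have 2: "t \<otimes> y \<in> m" using absorbsD[OF T(2) t1(2) yT] t1(3) x(3) by simp
      \<comment> \<open>x + y = 1, and t x and t y lie in m because x y does.\<close>
      have "t = t \<otimes> x \<oplus> t \<otimes> y" using xc yc car car2 unfolding y_def by algebra
      then show "t \<in> m" using m_closed(2)[OF 1 2] by simp
    qed
  qed
  have "A \<subset> T" using atom_overD(2,3)[OF T(1)] by blast
  then show ?thesis
    unfolding minimal_decomposed_def Let_def conductor_atom[OF TI T(2) x(1,2)]
    using m_maximal N1(1) N2(1) inter natural_iso_over[OF TI N1(1-3)] natural_iso_over[OF TI N2(1-3)] by auto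
qed

text \<open>Supplies the incomparability that \<open>four_element_boolean\<close> requires. In U, m
  is an intersection of two primes, so an element with square in m is in m, while T has such an
  element outside m. If U lay in T, the two maximal ideals of U would split 1 in a way that the
  prime M' forbids.\<close>

lemma ramified_decomposed_incomparable:
  assumes T: "T \<in> interm A S" and U: "U \<in> interm A S"
    and ram: "minimal_ramified A (S\<lparr>carrier := T\<rparr>)" and dec: "minimal_decomposed A (S\<lparr>carrier := U\<rparr>)"
  shows "\<not> T \<subseteq> U" "\<not> U \<subseteq> T"
proof -
  note TC = interm_closed[OF T] and UC = interm_closed[OF U]
  note TS = intermD(1)[OF T] and US = intermD(1)[OF U]
  interpret T: ambient_ring "S\<lparr>carrier := T\<rparr>" using interm_ring(1)[OF T] .
  interpret U: ambient_ring "S\<lparr>carrier := U\<rparr>" using interm_ring(1)[OF U] .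
  have P: "conductor A (S\<lparr>carrier := T\<rparr>) = m" "conductor A (S\<lparr>carrier := U\<rparr>) = m"
    using maximal_unique ram dec unfolding minimal_ramified_def minimal_decomposed_def Let_def by simp_all
  obtain M' where M': "maximalideal M' (S\<lparr>carrier := T\<rparr>)" "M' \<cdot>\<^bsub>S\<lparr>carrier := T\<rparr>\<^esub> M' \<subseteq> m" "m \<subset> M'"
    using ram unfolding minimal_ramified_def Let_def P by blast
  obtain M1 M2 where M12: "maximalideal M1 (S\<lparr>carrier := U\<rparr>)" "maximalideal M2 (S\<lparr>carrier := U\<rparr>)" "m = M1 \<inter> M2"
    "natural_iso A (S\<lparr>carrier := U\<rparr>) m M1" and AU: "A \<subset> U"
    using dec unfolding minimal_decomposed_def Let_def P by auto
  have sq: "x \<otimes> y \<in> m" if "x \<in> M'" "y \<in> M'" for x y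
    using ideal_prod.prod[OF that, of "S\<lparr>carrier := T\<rparr>"] M'(2) by auto
  note M1p = maximalideal_of_subringD[OF US M12(1)] and M2p = maximalideal_of_subringD[OF US M12(2)]
    and Mp = maximalideal_of_subringD[OF TS M'(1)]
  note M1i = ideal_of_subringD[OF US maximalideal.axioms(1)[OF M12(1)]]
    and M2i = ideal_of_subringD[OF US maximalideal.axioms(1)[OF M12(2)]]
    and Mi = ideal_of_subringD[OF TS maximalideal.axioms(1)[OF M'(1)]]
  show "\<not> T \<subseteq> U"
  proof
    assume sub: "T \<subseteq> U"
    obtain x where x: "x \<in> M'" "x \<notin> m" using M'(3) by blast
    then have "x \<in> U" using Mi(1) sub by blast
    then have "x \<in> M1" "x \<in> M2" using sq[OF x(1,1)] M12(3) M1p(3) M2p(3) by blast+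
    then show False using x(2) M12(3) by blast
  qed
  show "\<not> U \<subseteq> T"
  proof
    assume sub: "U \<subseteq> T"
    \<comment> \<open>Otherwise M1 = m, and U = M1 + m + A would be A.\<close>
    have "\<not> M1 \<subseteq> M2"
    proof
      assume "M1 \<subseteq> M2"
      then have m1: "M1 = m" using M12(3) by blast
      have "U \<subseteq> A"
      proof
        fix t assume "t \<in> U"
        then have "t \<in> carrier (S\<lparr>carrier := U\<rparr>)" by simp
        then obtain q p a where "q \<in> M1" "p \<in> m" "a \<in> A"
            "t = q \<oplus>\<^bsub>S\<lparr>carrier := U\<rparr>\<^esub> (p \<oplus>\<^bsub>S\<lparr>carrier := U\<rparr>\<^esub> a)"
          by (rule U.natural_iso_surjD[OF M12(4) maximalideal.axioms(1)[OF M12(1)]])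
        then show "t \<in> A" using m1 by simp
      qed
      then show False using AU by blast
    qed
    then obtain e where e: "e \<in> M1" "e \<notin> M2" by blast
    then obtain u q where uq: "u \<in> U" "q \<in> M2" "e \<otimes> u \<oplus> q = \<one>" using M2p(2) M1i(1) by blast
    have c: "e \<in> U" "q \<in> U" using e uq M1i(1) M2i(1) by auto
    have car [simp]: "e \<in> carrier S" "u \<in> carrier S" "q \<in> carrier S" using c uq UC by auto
    have eu: "e \<otimes> u \<in> M1" using M1i(4)[OF uq(1) e(1)] by (simp add: m_comm)
    have euU: "e \<otimes> u \<in> U" using eu M1i(1) by blast
    have "q \<otimes> (e \<otimes> u) \<in> M1" "(e \<otimes> u) \<otimes> q \<in> M2" using M1i(4)[OF c(2) eu] M2i(4)[OF euU uq(2)] by auto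
    moreover have "(e \<otimes> u) \<otimes> q = q \<otimes> (e \<otimes> u)" by (simp add: m_ac)
    ultimately have "(e \<otimes> u) \<otimes> q \<in> M'" using M12(3) M'(3) by auto
    \<comment> \<open>An element of M' has its square in m, so inside U it lies in both M1 and M2.
      In either case the sum 1 falls into one of them.\<close>
    then have "e \<otimes> u \<in> M' \<or> q \<in> M'" using Mp(3) euU c(2) sub by blast
    then show False
    proof
      assume "e \<otimes> u \<in> M'"
      then have "e \<otimes> u \<in> M2" using sq M12(3) M2p(3)[OF euU euU] by blast
      then show False using M2i(3)[OF _ uq(2)] uq(3) M2p(1) by metis
    next
      assume "q \<in> M'"
      then have "q \<in> M1" using sq M12(3) M1p(3)[OF c(2,2)] by blast
      then show False using M1i(3)[OF eu] uq(3) M1p(1) by metis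
    qed
  qed
qed

section \<open>Boolean extensions that are not t-closed\<close>

text \<open>If D contains the inverse t of some a in m, then x in C equals t (a x) with a x in m, so
  x would lie in D as well.\<close>

lemma all_atoms_absorb:
  assumes C: "atom_over A S C" "absorbs C" and D: "atom_over A S D"
  shows "absorbs D"
proof (rule ccontr)
  assume n: "\<not> absorbs D"
  then have "C \<noteq> D" using C(2) by blast
  obtain t where t: "t \<in> D" "t \<notin> A" using atom_overD(2,3)[OF D] by blast
  obtain x where x: "x \<in> C" "x \<notin> A" using atom_overD(2,3)[OF C(1)] by blast
  note CC = interm_closed[OF atom_overD(1)[OF C(1)]] and DC = interm_closed[OF atom_overD(1)[OF D]]
  obtain a where a: "a \<in> m" "a \<otimes> t = \<one>" using atom_dichotomy[OF D n t] by blast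
  have car [simp]: "a \<in> carrier S" "t \<in> carrier S" "x \<in> carrier S" using a t x CC DC by auto
  have "t \<otimes> (a \<otimes> x) = (a \<otimes> t) \<otimes> x" by (simp add: m_ac)
  then have "t \<otimes> (a \<otimes> x) = x" using a(2) by simp
  moreover have "t \<otimes> (a \<otimes> x) \<in> D" using DC(4)[OF t(1)] DC(2)[OF m_A[OF absorbsD[OF C(2) a(1) x(1)]]] by blast
  ultimately have "x \<in> D" by simp
  then show False using x atoms_disjoint[OF C(1) D \<open>C \<noteq> D\<close>] by blast
qed

text \<open>Atoms generate S. A single atom is therefore S itself; otherwise there are exactly two,
  one of each kind, and distributivity leaves no further rings.\<close>

lemma boolean_not_t_closed:
  assumes bool: "boolean_ext A S" and fip: "FIP A S" and nt: "\<not> t_closed A S"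
  shows "minimal_ext A S \<or>
    (\<exists>U\<in>interm A S. \<exists>T\<in>interm A S. minimal_ramified A (S\<lparr>carrier := T\<rparr>) \<and>
      minimal_decomposed A (S\<lparr>carrier := U\<rparr>) \<and> interm A S = {A, T, U, carrier S})"
proof -
  have dist: "distributive_ext A S" using bool by (simp add: boolean_ext_def)
  obtain C where C: "ramified_atom C \<or> decomposed_atom C" using not_t_closed_atom[OF nt fip] by blast
  then have Ca: "atom_over A S C" "absorbs C" by (auto simp: ramified_atom_def decomposed_atom_def)
  note CI = atom_overD(1)[OF Ca(1)]
  show ?thesis
  proof (cases "\<exists>D. atom_over A S D \<and> D \<noteq> C")
    case False
    then have "C = carrier S" by (intro boolean_atoms_generate[OF bool fip CI]) auto
    then have "interm A S = {A, carrier S}" "A \<subset> carrier S"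
      using Ca(1) intermD(3) interm_base[OF A] unfolding atom_over_def by (auto dest: intermD(2,3))
    then show ?thesis unfolding minimal_ext_def by blast
  next
    case True
    then obtain D where D: "atom_over A S D" "D \<noteq> C" by blast
    have abs: "absorbs E" if "atom_over A S E" for E using all_atoms_absorb[OF Ca that] .
    have "\<exists>T U. ramified_atom T \<and> decomposed_atom U"
      using C D abs ramified_atom_other[OF dist _ D(1)] decomposed_atom_other[OF dist _ D(1)] by metis
    then obtain T U where TU: "ramified_atom T" "decomposed_atom U" by blast
    then have TUa: "atom_over A S T" "atom_over A S U" by (auto simp: ramified_atom_def decomposed_atom_def)
    note TI = atom_overD(1)[OF TUa(1)] and UI = atom_overD(1)[OF TUa(2)]
    have gen: "compositum S T U = carrier S"
    proof (rule boolean_atoms_generate[OF bool fip compositum_interm[OF TI UI]])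
      fix E assume E: "atom_over A S E"
      \<comment> \<open>A third atom would be decomposed because of T and ramified because of U,
        against uniqueness of the ramified atom.\<close>
      have "E = T \<or> E = U"
      proof (rule ccontr)
        assume ne: "\<not> ?thesis"
        then have "decomposed_atom E" "ramified_atom E"
          using ramified_atom_other[OF dist TU(1) E abs[OF E]] decomposed_atom_other[OF dist TU(2) E abs[OF E]] by auto
        then show False using ramified_atom_unique[OF dist TU(1)] ne by blast
      qed
      then show "E \<subseteq> compositum S T U" using compositum_upper1 compositum_upper2 by blast
    qed
    have "interm A S = {A, T, U, carrier S}"
    proof
      show "interm A S \<subseteq> {A, T, U, carrier S}"
        using below_two_atoms[OF A dist TUa] intermD(3) unfolding gen by blast
      show "{A, T, U, carrier S} \<subseteq> interm A S" using TI UI interm_base[OF A] interm_top[OF A] by blast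
    qed
    then show ?thesis
      using TI UI ramified_atom_minimal_ramified[OF TU(1)] decomposed_atom_minimal_decomposed[OF TU(2)] by blast
  qed
qed

end

section \<open>Local extensions whose maximal ideal is absorbed\<close>

context local_subring
begin

text \<open>The colon m : m in S, the largest intermediate ring in which m is an ideal.\<close>

definition absorber :: "'a set"
  where "absorber = {x \<in> carrier S. \<forall>a\<in>m. a \<otimes> x \<in> m}"

lemma absorbs_iff: "T \<subseteq> carrier S \<Longrightarrow> absorbs T \<longleftrightarrow> T \<subseteq> absorber"
  by (auto simp: absorbs_def absorber_def)

lemma absorber_interm: "absorber \<in> interm A S"
proof (rule intermI[OF subringI])
  show "absorber \<subseteq> carrier S" "A \<subseteq> absorber" "\<one> \<in> absorber" by (auto simp: absorber_def)
  show "\<ominus> x \<in> absorber" if "x \<in> absorber" for x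
    using that by (auto simp: absorber_def r_minus)
  show "x \<oplus> y \<in> absorber" if "x \<in> absorber" "y \<in> absorber" for x y
    using that by (auto simp: absorber_def r_distr)
  show "x \<otimes> y \<in> absorber" if xy: "x \<in> absorber" "y \<in> absorber" for x y
  proof -
    have "a \<otimes> (x \<otimes> y) \<in> m" if a: "a \<in> m" for a
    proof -
      have "(a \<otimes> x) \<otimes> y \<in> m" using xy a by (auto simp: absorber_def)
      then show ?thesis using xy a by (simp add: absorber_def m_assoc)
    qed
    then show ?thesis using xy by (simp add: absorber_def)
  qed
qed

text \<open>If all atoms absorb, they lie in \<open>absorber\<close>, and atoms generate S. A
  non-absorbing atom is excluded by comparing it with a second one, which then does not absorb
  either.\<close>

lemma boolean_absorbs:
  assumes bool: "boolean_ext A S" and fip: "FIP A S" and proper: "A \<subset> carrier S" and nmin: "\<not> minimal_ext A S"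
  shows "absorbs (carrier S)"
proof -
  have abs: "absorbs D" if D: "atom_over A S D" for D
  proof (rule ccontr)
    assume n: "\<not> absorbs D"
    obtain C where C: "atom_over A S C" "C \<noteq> D"
    proof (rule ccontr)
      assume "\<not> thesis"
      then have "D = carrier S"
        using that by (intro boolean_atoms_generate[OF bool fip atom_overD(1)[OF D]]) blast
      then have "interm A S = {A, carrier S}"
        using D intermD(3) interm_base[OF A] unfolding atom_over_def by (auto dest: intermD(2,3))
      then show False using nmin proper unfolding minimal_ext_def by blast
    qed
    note DC = interm_closed[OF atom_overD(1)[OF D]] and CC = interm_closed[OF atom_overD(1)[OF C(1)]]
    have disj: "u \<in> C \<Longrightarrow> u \<in> D \<Longrightarrow> u \<in> A" for u using atoms_disjoint[OF C(1) D C(2)] by blast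
    have nC: "\<not> absorbs C" using all_atoms_absorb[OF C(1) _ D] n by blast
    obtain t where t: "t \<in> D" "t \<notin> A" using atom_overD(2,3)[OF D] by blast
    obtain s where s: "s \<in> C" "s \<notin> A" using atom_overD(2,3)[OF C(1)] by blast
    obtain a where a: "a \<in> m" "a \<otimes> t = \<one>" using atom_dichotomy[OF D n t] by blast
    obtain b where b: "b \<in> m" "b \<otimes> s = \<one>" using atom_dichotomy[OF C(1) nC s] by blast
    have car [simp]: "a \<in> carrier S" "b \<in> carrier S" "t \<in> carrier S" "s \<in> carrier S"
      using a b t s DC CC by auto
    \<comment> \<open>In effect t/s, as b is the inverse of s. If w is in A, then t = w s lies in C;
      otherwise w is the inverse of some d in m, and s = d t lies in D.\<close>
    define w where "w = b \<otimes> t"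
    have car2 [simp]: "w \<in> carrier S" by (simp add: w_def)
    have wD: "w \<in> D" unfolding w_def using DC(4)[OF DC(2)[OF m_A[OF b(1)]] t(1)] .
    show False
    proof (cases "w \<in> A")
      case True
      have "w \<otimes> s = (b \<otimes> s) \<otimes> t" unfolding w_def by (simp add: m_ac)
      then have "t = w \<otimes> s" using b(2) by simp
      then have "t \<in> C" using CC(4)[OF CC(2)[OF True] s(1)] by simp
      then show False using disj t by blast
    next
      case False
      then obtain d where d: "d \<in> m" "d \<otimes> w = \<one>" using atom_dichotomy[OF D n wD] by blast
      have car3 [simp]: "d \<in> carrier S" using d by simp
      have "(d \<otimes> w) \<otimes> s = d \<otimes> t \<otimes> (b \<otimes> s)" unfolding w_def by (simp add: m_ac)
      then have "s = d \<otimes> t" using b(2) d(2) by simp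
      then have "s \<in> D" using DC(4)[OF DC(2)[OF m_A[OF d(1)]] t(1)] by simp
      then show False using disj s by blast
    qed
  qed
  have "absorber = carrier S"
  proof (rule boolean_atoms_generate[OF bool fip absorber_interm])
    fix D assume D: "atom_over A S D"
    show "D \<subseteq> absorber" using abs[OF D] absorbs_iff[OF intermD(3)[OF atom_overD(1)[OF D]]] by simp
  qed
  then show ?thesis using absorbs_iff[of "carrier S"] by simp
qed

lemma t_closed_square:
  assumes tc: "t_closed A S" and T: "T \<in> interm A S" "absorbs T" and x: "x \<in> T" "x \<otimes> x \<in> m"
  shows "x \<in> m"
proof -
  have car [simp]: "x \<in> carrier S" using interm_closed(1)[OF T(1) x(1)] .
  have "x [^] (2::nat) \<ominus> \<zero> \<otimes> x = x \<otimes> x" by (simp add: numeral_2_eq_2 minus_eq)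
  moreover have "x [^] (3::nat) \<ominus> \<zero> \<otimes> x [^] (2::nat) = (x \<otimes> x) \<otimes> x" by (simp add: numeral_3_eq_3 minus_eq)
  ultimately have "x \<in> A"
    using tc x(2) absorbsD[OF T(2) x(2,1)] A_closed(1) m_A \<open>x \<in> carrier S\<close> unfolding t_closed_def by metis
  then show ?thesis using m_prime x(2) by blast
qed

text \<open>Modelled on Artinian algebras over a field: finiteness of the lattice makes rings built
  from powers of x repeat. This gives a unit directly or an idempotent modulo m, and t-closedness
  forces the latter into A.\<close>

lemma t_closed_units:
  assumes tc: "t_closed A S" and fip: "FIP A S" and T: "T \<in> interm A S" "absorbs T"
    and x: "x \<in> T" "x \<notin> m"
  shows "\<exists>y\<in>T. x \<otimes> y = \<one>"
proof -
  note TC = interm_closed[OF T(1)]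
  have car [simp]: "x \<in> carrier S" using TC x by blast
  \<comment> \<open>The exponents are powers of two so that \<open>t_closed_square\<close> can lead
    back from \<open>y i\<close> in m to x in m.\<close>
  define y where "y j = x [^] ((2::nat) ^ j)" for j :: nat
  have pow: "x [^] (n::nat) \<in> T" for n by (induction n) (use x TC A_closed(2) in auto)
  have yT: "y j \<in> T" for j unfolding y_def by (rule pow)
  have car2 [simp]: "y j \<in> carrier S" for j unfolding y_def by simp
  have ySuc: "y (Suc j) = y j \<otimes> y j" for j unfolding y_def by (simp add: nat_pow_mult mult_2)
  define F where "F j = {c \<oplus> y j \<otimes> g | c g. c \<in> A \<and> g \<in> T}" for j
  have FI: "F j \<in> interm A S" for j unfolding F_def by (rule adjoin_interm(1)[OF T(1) yT])
  have "F (Suc j) \<subseteq> F j" for j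
  proof
    fix z assume "z \<in> F (Suc j)"
    then obtain c g where z: "z = c \<oplus> y (Suc j) \<otimes> g" "c \<in> A" "g \<in> T" unfolding F_def by blast
    have "z = c \<oplus> y j \<otimes> (y j \<otimes> g)" unfolding z(1) ySuc using z TC by (simp add: m_assoc)
    then show "z \<in> F j" unfolding F_def using z(2) TC(4)[OF yT z(3)] by blast
  qed
  then have Fmono: "F k \<subseteq> F j" if "j \<le> k" for j k using lift_Suc_antimono_le[of F] that by blast
  \<comment> \<open>The rings \<open>F j\<close> decrease and only finitely many rings exist, so two
    consecutive ones agree.\<close>
  have "\<not> inj F"
  proof
    assume "inj F"
    moreover have "finite (range F)" using fip FI unfolding FIP_def by (meson finite_subset image_subsetI)
    ultimately show False using finite_imageD infinite_UNIV_nat by blast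
  qed
  then obtain i k where ik: "F i = F k" "i < k" unfolding inj_def by (metis linorder_neqE_nat)
  define z where "z = y i"
  have zT: "z \<in> T" using yT by (simp add: z_def)
  have car3 [simp]: "z \<in> carrier S" by (simp add: z_def)
  have "\<zero> \<oplus> y i \<otimes> \<one> = y i" by simp
  then have "y i \<in> F i" unfolding F_def using TC(2)[OF A_closed(2)] A_closed(1) by (metis (mono_tags, lifting) mem_Collect_eq)
  then have "y i \<in> F (Suc i)" using ik Fmono[of "Suc i" k] by auto
  then obtain c g where cg: "z = c \<oplus> (z \<otimes> z) \<otimes> g" "c \<in> A" "g \<in> T" unfolding F_def ySuc z_def by blast
  have car4 [simp]: "c \<in> carrier S" "g \<in> carrier S" using cg TC by auto
  define e where "e = z \<otimes> g"
  have eT: "e \<in> T" unfolding e_def by (rule TC(4)[OF zT cg(3)])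
  have car5 [simp]: "e \<in> carrier S" by (simp add: e_def)
  have "z \<otimes> (\<one> \<ominus> e) = z \<ominus> (z \<otimes> z) \<otimes> g" using car car2 car3 car4 car5 unfolding e_def by algebra
  also have "\<dots> = (c \<oplus> (z \<otimes> z) \<otimes> g) \<ominus> (z \<otimes> z) \<otimes> g" by (rule arg_cong2[OF cg(1) refl])
  also have "\<dots> = c" using car car2 car3 car4 car5 by algebra
  finally have c: "c = z \<otimes> (\<one> \<ominus> e)" by simp
  have oe: "\<one> \<ominus> e \<in> T" using TC(5)[OF TC(2)[OF A_closed(2)] eT] .
  have unit: "\<exists>v\<in>T. z \<otimes> v = \<one>"
  proof (cases "c \<in> m")
    case False
    then obtain w where w: "w \<in> A" "c \<otimes> w = \<one>" using m_unit cg(2) by blast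
    have car6 [simp]: "w \<in> carrier S" using w by simp
    have "z \<otimes> ((\<one> \<ominus> e) \<otimes> w) = c \<otimes> w" unfolding c by (simp add: m_assoc)
    then show ?thesis using w TC(4)[OF oe TC(2)[OF w(1)]] by auto
  next
    case True
    have ee: "e \<otimes> e \<ominus> e = \<ominus> (c \<otimes> g)" using car car2 car3 car4 car5 unfolding c e_def by algebra
    have cgm: "c \<otimes> g \<in> m" using absorbsD[OF T(2) True cg(3)] .
    then have ee_m: "e \<otimes> e \<ominus> e \<in> m" unfolding ee by simp
    \<comment> \<open>An idempotent modulo m satisfies the relations of t-closedness with r =
      1.\<close>
    have "e [^] (2::nat) \<ominus> \<one> \<otimes> e = e \<otimes> e \<ominus> e" by (simp add: numeral_2_eq_2)
    moreover have "e [^] (3::nat) \<ominus> \<one> \<otimes> e [^] (2::nat) = (e \<otimes> e \<ominus> e) \<otimes> e" by (simp add: numeral_2_eq_2 numeral_3_eq_3) (use car5 in algebra)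
    ultimately have eA: "e \<in> A"
      using tc ee_m absorbsD[OF T(2) ee_m eT] A_closed(2) m_A \<open>e \<in> carrier S\<close> unfolding t_closed_def by metis
    have "e \<otimes> (\<one> \<ominus> e) = c \<otimes> g" using car car2 car3 car4 car5 unfolding c e_def by algebra
    then have "e \<in> m \<or> \<one> \<ominus> e \<in> m" using cgm m_prime[of e "\<one> \<ominus> e"] eA by simp
    \<comment> \<open>With e in m the unit 1 - e could be cancelled from z (1 - e) = c in m, so z
      and then x would be in m.\<close>
    moreover have "e \<notin> m"
    proof
      assume "e \<in> m"
      then have u: "\<one> \<ominus> e \<notin> m" using unit_or_one_minus_unit[OF eA] by blast
      have "(\<one> \<ominus> e) \<otimes> z \<in> m" using True c by (simp add: m_comm)
      then have "z \<in> m" using unit_cancel_m[OF _ u, of z] eA by simp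
      moreover have "y j \<in> m \<Longrightarrow> x \<in> m" for j
      proof (induction j)
        case 0
        then show ?case by (simp add: y_def)
      next
        case (Suc j)
        have "y j \<in> m" using t_closed_square[OF tc T yT] Suc.prems unfolding ySuc by blast
        then show ?case by (rule Suc.IH)
      qed
      ultimately show False using x(2) unfolding z_def by blast
    qed
    ultimately obtain w where w: "w \<in> A" "e \<otimes> w = \<one>" using m_unit[OF eA] by blast
    have car7 [simp]: "w \<in> carrier S" using w by simp
    have "z \<otimes> (g \<otimes> w) = e \<otimes> w" unfolding e_def by (simp add: m_assoc)
    then show ?thesis using w TC(4)[OF cg(3) TC(2)[OF w(1)]] by auto
  qed
  then obtain v where v: "v \<in> T" "z \<otimes> v = \<one>" by blast
  obtain n where n: "(2::nat) ^ i = Suc n" by (metis not0_implies_Suc power_not_zero zero_neq_numeral)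
  have "v \<in> carrier S" using TC v by blast
  then have "x \<otimes> (x [^] n \<otimes> v) = z \<otimes> v" unfolding z_def y_def n by (simp add: m_ac)
  then show ?thesis using v TC(4)[OF pow v(1)] by auto
qed

text \<open>By \<open>t_closed_units\<close>, \<open>absorber\<close> is itself local with maximal
  ideal m, so \<open>atom_dichotomy\<close> applies to an atom over it. An absorbing atom would lie
  inside \<open>absorber\<close>, and inverses of elements of m are excluded by
  \<open>ninv\<close>.\<close>

lemma t_closed_absorbs:
  assumes tc: "t_closed A S" and fip: "FIP A S"
    and ninv: "\<And>a t. a \<in> m \<Longrightarrow> t \<in> carrier S \<Longrightarrow> a \<otimes> t \<noteq> \<one>"
  shows "absorbs (carrier S)"
proof -
  let ?T = absorber
  note T = absorber_interm
  note TC = interm_closed[OF T]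
  have abs: "absorbs ?T" using absorbs_iff[OF intermD(3)[OF T]] by simp
  have "local_subring S ?T m"
  proof (intro local_subring.intro local_subring_axioms.intro ambient_ring_axioms)
    show "subring ?T S" using intermD(1)[OF T] .
    show "ideal m (S\<lparr>carrier := ?T\<rparr>)"
      by (rule ideal_of_subringI[OF intermD(1)[OF T]]) (use TC(2) absorbs_closed[OF abs T] in auto)
    show "\<exists>b\<in>?T. a \<otimes> b = \<one>" if "a \<in> ?T" "a \<notin> m" for a using t_closed_units[OF tc fip T abs that] .
  qed (rule one_notin_m)
  then interpret T: local_subring S ?T m .
  have "?T = carrier S"
  proof (rule ccontr)
    assume ne: "?T \<noteq> carrier S"
    have "interm ?T S \<subseteq> interm A S" using intermD(2)[OF T] by (auto simp: interm_def)
    then have "FIP ?T S" using fip finite_subset unfolding FIP_def by blast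
    then obtain D where D: "atom_over ?T S D"
      by (rule atom_below[OF _ interm_top[OF intermD(1)[OF T]] ne[symmetric]])
    obtain t where t: "t \<in> D" "t \<notin> ?T" using atom_overD(2,3)[OF D] by blast
    have tcar: "t \<in> carrier S" using t(1) intermD(3)[OF atom_overD(1)[OF D]] by blast
    show False
    proof (cases "T.absorbs D")
      case True
      have "t \<in> ?T" unfolding absorber_def using tcar T.absorbsD[OF True _ t(1)] by blast
      then show False using t(2) by blast
    next
      case False
      obtain a where "a \<in> m" "a \<otimes> t = \<one>" using T.atom_dichotomy[OF D False t] by blast
      then show False using ninv tcar by blast
    qed
  qed
  then show ?thesis using abs by simp
qed

end

section \<open>Residue fields\<close>

context localized_subring
begin

lemma local_localization: "local_subring RB (loc R) (loc M)"
  by (intro local_subring.intro local_subring_axioms.intro L.ambient_ring_axioms loc_R_subring loc_M_ideal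
      one_notin_loc_M loc_M_unit)

sublocale LL: local_subring RB "loc R" "loc M"
  by (rule local_localization)

text \<open>In the locale \<open>residual_extension\<close> this is the only maximal ideal of S
  above M.\<close>

definition contr :: "'a set"
  where "contr = {x \<in> carrier S. frac x \<one> \<in> loc M}"

lemma contr_iff: "x \<in> contr \<longleftrightarrow> x \<in> carrier S \<and> (\<exists>u\<in>R - M. u \<otimes> x \<in> M)"
  unfolding contr_def using frac_loc_M_iff[OF _ D_one] by blast

lemma M_inverse:
  assumes "u \<in> R - M" obtains r p where "r \<in> R" "p \<in> M" "u \<otimes> r \<oplus> p = \<one>"
  using Mmax(2)[OF assms] by blast

text \<open>Clearing denominators gives u p x = u s t, with the left side in N and the right side in
  R - M.\<close>

lemma Max_above_noninvertible:
  assumes N: "N \<in> Max_above R S M" and a: "a \<in> loc M" and z: "z \<in> carrier RB"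
  shows "a \<otimes>\<^bsub>RB\<^esub> z \<noteq> \<one>\<^bsub>RB\<^esub>"
proof
  assume e: "a \<otimes>\<^bsub>RB\<^esub> z = \<one>\<^bsub>RB\<^esub>"
  have N': "maximalideal N S" "N \<inter> R = M" using N by (auto simp: Max_above_def)
  interpret N: maximalideal N S by (rule N'(1))
  obtain p s where p: "a = frac p s" "p \<in> M" "s \<in> R - M" using a unfolding loc_sub_def by blast
  obtain x t where x: "x \<in> carrier S" "t \<in> R - M" "z = frac x t" using z by (rule loc_carrierE)
  have "frac (p \<otimes> x) (s \<otimes> t) = frac \<one> \<one>" using e p x by (simp add: loc_one)
  then obtain u where u: "u \<in> R - M" "u \<otimes> (\<one> \<otimes> (p \<otimes> x)) = u \<otimes> ((s \<otimes> t) \<otimes> \<one>)"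
    using lfrac_eq_iff[of "p \<otimes> x" \<one> "s \<otimes> t" \<one>] p x D_mult[OF p(3) x(2)] by auto
  have pN: "p \<in> N" using p(2) N'(2) by blast
  have "(u \<otimes> x) \<otimes> p \<in> N" using N.I_l_closed[OF pN, of "u \<otimes> x"] u(1) x(1) by simp
  moreover have "(u \<otimes> x) \<otimes> p = u \<otimes> (\<one> \<otimes> (p \<otimes> x))" using u(1) x(1) p by (simp add: m_ac)
  moreover have "u \<otimes> ((s \<otimes> t) \<otimes> \<one>) = u \<otimes> (s \<otimes> t)" using p x by simp
  ultimately have "u \<otimes> (s \<otimes> t) \<in> N" using u(2) by simp
  moreover have "u \<otimes> (s \<otimes> t) \<in> R - M" using D_mult[OF u(1) D_mult[OF p(3) x(2)]] .
  ultimately show False using N'(2) by blast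
qed

end

text \<open>S_M is local with the same maximal ideal as R_M.\<close>

locale residual_extension = localized_subring +
  assumes absorbs: "LL.absorbs (carrier RB)"
    and units: "\<And>z. z \<in> carrier RB \<Longrightarrow> z \<notin> loc M \<Longrightarrow> \<exists>w\<in>carrier RB. z \<otimes>\<^bsub>RB\<^esub> w = \<one>\<^bsub>RB\<^esub>"
begin

lemma contr_ideal: "ideal contr S"
proof -
  have "ideal contr (S\<lparr>carrier := carrier S\<rparr>)"
  proof (rule ideal_of_subringI[OF carrier_is_subring])
    show "contr \<subseteq> carrier S" "\<zero> \<in> contr"
      using LL.m_closed(1) by (auto simp: contr_def loc_zero)
    fix x y assume y: "y \<in> contr"
    show "x \<oplus> y \<in> contr" if x: "x \<in> contr"
    proof -
      have c: "x \<in> carrier S" "y \<in> carrier S" using x y by (auto simp: contr_def)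
      then have "frac x \<one> \<oplus>\<^bsub>RB\<^esub> frac y \<one> = frac (x \<oplus> y) \<one>" using D_one by simp
      moreover have "frac x \<one> \<oplus>\<^bsub>RB\<^esub> frac y \<one> \<in> loc M"
        by (rule LL.m_closed(2)) (use x y in \<open>auto simp: contr_def\<close>)
      ultimately show ?thesis using c by (simp add: contr_def)
    qed
    show "x \<otimes> y \<in> contr" if x: "x \<in> carrier S"
    proof -
      have "frac y \<one> \<in> loc M" "y \<in> carrier S" using y by (auto simp: contr_def)
      then have "frac y \<one> \<otimes>\<^bsub>RB\<^esub> frac x \<one> \<in> loc M"
        using LL.absorbsD[OF absorbs] x loc_carrierI[OF x D_one] by blast
      moreover have "frac y \<one> \<otimes>\<^bsub>RB\<^esub> frac x \<one> = frac (x \<otimes> y) \<one>"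
        using x \<open>y \<in> carrier S\<close> D_one by (simp add: m_comm)
      ultimately show ?thesis using x \<open>y \<in> carrier S\<close> by (simp add: contr_def)
    qed
  qed
  then show ?thesis by simp
qed

lemma contr_carrier: "x \<in> contr \<Longrightarrow> x \<in> carrier S"
  by (simp add: contr_def)

lemma M_contr: "M \<subseteq> contr"
  using loc_memI[OF _ D_one] by (auto simp: contr_def)

lemma contr_Int: "contr \<inter> R = M"
proof
  show "M \<subseteq> contr \<inter> R" using M_contr by auto
  show "contr \<inter> R \<subseteq> M"
  proof
    fix x assume x: "x \<in> contr \<inter> R"
    then obtain u where "u \<in> R - M" "u \<otimes> x \<in> M" using contr_iff by blast
    then show "x \<in> M" using Mmax(3)[of u x] x by blast
  qed
qed

text \<open>Clear denominators in the inverse of s in S_M, then invert the remaining factor u t of R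
  - M modulo M.\<close>

lemma contr_inverse:
  assumes s: "s \<in> carrier S" "s \<notin> contr"
  obtains r p where "r \<in> carrier S" "p \<in> M" "s \<otimes> r \<oplus> p = \<one>"
proof -
  have "frac s \<one> \<in> carrier RB" "frac s \<one> \<notin> loc M" using s by (auto simp: contr_def intro!: loc_carrierI D_one)
  then obtain w where w: "w \<in> carrier RB" "frac s \<one> \<otimes>\<^bsub>RB\<^esub> w = \<one>\<^bsub>RB\<^esub>" using units by blast
  obtain y t where y: "y \<in> carrier S" "t \<in> R - M" "w = frac y t" using w(1) by (rule loc_carrierE)
  have "frac (s \<otimes> y) (\<one> \<otimes> t) = frac \<one> \<one>" using w(2) y s D_one by (simp add: loc_one)
  then obtain u where u: "u \<in> R - M" "u \<otimes> (\<one> \<otimes> (s \<otimes> y)) = u \<otimes> ((\<one> \<otimes> t) \<otimes> \<one>)"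
    using lfrac_eq_iff[of "s \<otimes> y" \<one> "\<one> \<otimes> t" \<one>] s y D_mult[OF D_one y(2)] by auto
  have uc [simp]: "u \<in> carrier S" "t \<in> carrier S" "y \<in> carrier S" "s \<in> carrier S" using u y s by auto
  obtain r p where rp: "r \<in> R" "p \<in> M" "(u \<otimes> t) \<otimes> r \<oplus> p = \<one>" using M_inverse[OF D_mult[OF u(1) y(2)]] .
  have car [simp]: "r \<in> carrier S" "p \<in> carrier S" using rp by auto
  have "u \<otimes> (s \<otimes> y) = u \<otimes> t" using u(2) by simp
  moreover have "s \<otimes> (u \<otimes> y \<otimes> r) = (u \<otimes> (s \<otimes> y)) \<otimes> r" by (simp add: m_ac)
  ultimately have "s \<otimes> (u \<otimes> y \<otimes> r) \<oplus> p = \<one>" using rp(3) by simp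
  then show ?thesis using that[of "u \<otimes> y \<otimes> r" p] rp(2) by simp
qed

lemma contr_maximal: "maximalideal contr S"
proof -
  have "maximalideal contr (S\<lparr>carrier := carrier S\<rparr>)"
  proof (rule maximalideal_of_subringI[OF carrier_is_subring])
    show "ideal contr (S\<lparr>carrier := carrier S\<rparr>)" using contr_ideal by simp
    show "\<one> \<notin> contr" using contr_Int one_R by blast
    fix s assume "s \<in> carrier S - contr"
    then show "\<exists>r\<in>carrier S. \<exists>p\<in>contr. s \<otimes> r \<oplus> p = \<one>"
      using contr_inverse[of s] M_contr by blast
  qed
  then show ?thesis by simp
qed

text \<open>An x in \<open>contr\<close> has u x in M for some u in R - M. Any N above M is prime
  and does not contain u, so it contains x.\<close>

lemma Max_above_eq: "Max_above R S M = {contr}"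
proof
  show "{contr} \<subseteq> Max_above R S M" using contr_maximal contr_Int by (simp add: Max_above_def)
  show "Max_above R S M \<subseteq> {contr}"
  proof
    fix N assume N: "N \<in> Max_above R S M"
    then have N': "maximalideal N S" "N \<inter> R = M" by (auto simp: Max_above_def)
    interpret N: maximalideal N S by (rule N'(1))
    have prime: "primeideal N S" using maximalideal_prime[OF N'(1)] .
    have "contr \<subseteq> N"
    proof
      fix x assume "x \<in> contr"
      then obtain u where u: "x \<in> carrier S" "u \<in> R - M" "u \<otimes> x \<in> M" using contr_iff by blast
      then have "u \<in> N \<or> x \<in> N" using primeideal.I_prime[OF prime, of u x] N'(2) by auto
      then show "x \<in> N" using u(2) N'(2) by blast
    qed
    then have "N = contr"
      using maximalideal.I_maximal[OF contr_maximal N.ideal_axioms] N.I_notcarr N.a_subset by blast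
    then show "N \<in> {contr}" by simp
  qed
qed

lemma localized_contr: "localized_subring S (carrier S) contr"
  by (intro localized_subring.intro localized_subring_axioms.intro ambient_ring_axioms carrier_is_subring)
    (simp add: contr_maximal)

sublocale N: localized_subring S "carrier S" contr
  by (rule localized_contr)

declare N.R_carrier [simp del] N.M_R [simp del] N.D_carr [simp del]

text \<open>The generated ideal becomes a set of fractions, for which \<open>frac_loc_M_iff\<close>
  decides membership.\<close>

lemma loc_ideal_eq: "loc_ideal S contr = loc_sub contr S (carrier S - contr)"
  (is "_ = ?N")
proof -
  have ideal: "ideal ?N N.RB"
  proof -
    have "N.RB\<lparr>carrier := N.loc (carrier S)\<rparr> = N.RB" by (simp add: N.loc_carrier)
    then show ?thesis using N.loc_M_ideal by simp
  qed
  let ?G = "(\<lambda>p. lfrac S (carrier S - contr) p \<one>) ` contr"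
  note cc = contr_carrier
  have G: "?G \<subseteq> carrier N.RB" by (intro image_subsetI N.loc_carrierI[OF cc N.D_one])
  show ?thesis
    unfolding loc_ideal_def
  proof
    show "Idl\<^bsub>N.RB\<^esub> ?G \<subseteq> ?N"
    proof (rule N.L.genideal_minimal[OF ideal])
      show "?G \<subseteq> ?N" by (intro image_subsetI N.loc_memI[OF _ N.D_one])
    qed
    show "?N \<subseteq> Idl\<^bsub>N.RB\<^esub> ?G"
    proof
      fix z assume "z \<in> ?N"
      then obtain p s where p: "z = lfrac S (carrier S - contr) p s" "p \<in> contr" "s \<in> carrier S - contr"
        unfolding loc_sub_def by blast
      have "lfrac S (carrier S - contr) p \<one> \<in> Idl\<^bsub>N.RB\<^esub> ?G"
        using N.L.genideal_self[OF G] p(2) by blast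
      then have "lfrac S (carrier S - contr) p \<one> \<otimes>\<^bsub>N.RB\<^esub> lfrac S (carrier S - contr) \<one> s \<in> Idl\<^bsub>N.RB\<^esub> ?G"
        using ideal.I_r_closed[OF N.L.genideal_ideal[OF G]] N.loc_carrierI[OF one_closed p(3)] by blast
      then show "z \<in> Idl\<^bsub>N.RB\<^esub> ?G" using N.frac_split[OF cc[OF p(2)] p(3)] p(1) by simp
    qed
  qed
qed

text \<open>
  As \<open>contr\<close> is maximal, every class in the residue field has a representative in \<open>S\<close>; so the rings
  between the two residue fields are the images of the rings between \<open>R + contr\<close> and \<open>S\<close>.
\<close>

definition res :: "'a \<Rightarrow> ('a \<times> 'a) set set"
  where "res x = loc_ideal S contr +>\<^bsub>N.RB\<^esub> lfrac S (carrier S - contr) x \<one>"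

lemma loc_ideal_ideal: "ideal (loc_ideal S contr) N.RB"
proof -
  have "N.RB\<lparr>carrier := N.loc (carrier S)\<rparr> = N.RB" by (simp add: N.loc_carrier)
  then show ?thesis using N.loc_M_ideal by (simp add: loc_ideal_eq)
qed

lemma kappa_cring: "cring (kappa S contr)"
  unfolding kappa_def using ideal.quotient_is_cring[OF loc_ideal_ideal N.L.is_cring] .

lemma frac_hom: "(\<lambda>x. lfrac S (carrier S - contr) x \<one>) \<in> ring_hom S N.RB"
  by (rule ring_hom_memI) (simp_all add: N.loc_one)

lemma res_hom: "res \<in> ring_hom S (kappa S contr)"
proof -
  interpret I: ideal "loc_ideal S contr" N.RB by (rule loc_ideal_ideal)
  have "(\<lambda>x. loc_ideal S contr +>\<^bsub>N.RB\<^esub> x) \<in> ring_hom N.RB (kappa S contr)"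
    unfolding kappa_def by (rule I.rcos_ring_hom)
  then have "(\<lambda>x. loc_ideal S contr +>\<^bsub>N.RB\<^esub> x) \<circ> (\<lambda>x. lfrac S (carrier S - contr) x \<one>) \<in> ring_hom S (kappa S contr)"
    by (rule ring_hom_trans[OF frac_hom])
  then show ?thesis by (simp add: res_def[abs_def] comp_def)
qed

text \<open>r inverts s modulo \<open>contr\<close>, and x/s - (x r)/1 = (x p)/s lies in the
  ideal.\<close>

lemma class_frac:
  assumes "x \<in> carrier S" "s \<in> carrier S" "r \<in> carrier S" "p \<in> contr" "s \<otimes> r \<oplus> p = \<one>" "s \<notin> contr"
  shows "loc_ideal S contr +>\<^bsub>N.RB\<^esub> lfrac S (carrier S - contr) x s = res (x \<otimes> r)"
proof -
  let ?q = "\<lambda>x s. lfrac S (carrier S - contr) x s"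
  have sD: "s \<in> carrier S - contr" using assms by blast
  have pc [simp]: "p \<in> carrier S" using assms(4) by (rule contr_carrier)
  have car [simp]: "x \<in> carrier S" "s \<in> carrier S" "r \<in> carrier S" using assms by auto
  have q: "?q x s \<in> carrier N.RB" "?q (x \<otimes> r) \<one> \<in> carrier N.RB"
    using N.loc_carrierI sD N.D_one by auto
  have "?q x s \<ominus>\<^bsub>N.RB\<^esub> ?q (x \<otimes> r) \<one> = ?q (\<one> \<otimes> x \<oplus> s \<otimes> \<ominus> (x \<otimes> r)) (s \<otimes> \<one>)"
    using sD N.D_one by (simp add: N.L.minus_eq N.loc_a_inv)
  also have "\<one> \<otimes> x \<oplus> s \<otimes> \<ominus> (x \<otimes> r) = x \<otimes> p"
  proof -
    have "x \<otimes> p = x \<otimes> ((s \<otimes> r \<oplus> p) \<ominus> s \<otimes> r)" using pc car by algebra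
    also have "\<dots> = \<one> \<otimes> x \<oplus> s \<otimes> \<ominus> (x \<otimes> r)" using pc car unfolding assms(5) by algebra
    finally show ?thesis by simp
  qed
  finally have "?q x s \<ominus>\<^bsub>N.RB\<^esub> ?q (x \<otimes> r) \<one> = ?q (x \<otimes> p) (s \<otimes> \<one>)" .
  moreover have "x \<otimes> p \<in> contr" using ideal.I_l_closed[OF contr_ideal assms(4)] by simp
  ultimately have "?q x s \<ominus>\<^bsub>N.RB\<^esub> ?q (x \<otimes> r) \<one> \<in> loc_ideal S contr"
    using N.loc_memI[of "x \<otimes> p" contr s] sD by (simp add: loc_ideal_eq)
  then show ?thesis unfolding res_def using N.L.quotient_eq_iff_same_a_r_cos[OF loc_ideal_ideal q] by blast
qed

lemma res_surj: "res ` carrier S = carrier (kappa S contr)"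
proof
  show "res ` carrier S \<subseteq> carrier (kappa S contr)" using res_hom by (auto simp: ring_hom_def)
  show "carrier (kappa S contr) \<subseteq> res ` carrier S"
  proof
    fix y assume "y \<in> carrier (kappa S contr)"
    then obtain z where z: "z \<in> carrier N.RB" "y = loc_ideal S contr +>\<^bsub>N.RB\<^esub> z"
      by (auto simp: kappa_def FactRing_def A_RCOSETS_def')
    obtain x s where x: "x \<in> carrier S" "s \<in> carrier S - contr" "z = lfrac S (carrier S - contr) x s"
      using z(1) by (rule N.loc_carrierE)
    obtain r p where rp: "r \<in> carrier S" "p \<in> M" "s \<otimes> r \<oplus> p = \<one>" using contr_inverse[of s] x(2) by blast
    have "y = res (x \<otimes> r)" unfolding z(2) x(3)
      by (rule class_frac[where p = p]) (use x rp M_contr in auto)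
    then show "y \<in> res ` carrier S" using x(1) rp(1) by blast
  qed
qed

lemma res_eq_iff:
  assumes "x \<in> carrier S" "y \<in> carrier S"
  shows "res x = res y \<longleftrightarrow> x \<ominus> y \<in> contr"
proof -
  let ?q = "\<lambda>x. lfrac S (carrier S - contr) x \<one>"
  have q: "?q x \<in> carrier N.RB" "?q y \<in> carrier N.RB" using N.loc_carrierI[OF _ N.D_one] assms by auto
  have "?q x \<ominus>\<^bsub>N.RB\<^esub> ?q y = ?q (x \<ominus> y)"
    using assms N.D_one by (simp add: N.L.minus_eq N.loc_a_inv minus_eq)
  then have "res x = res y \<longleftrightarrow> ?q (x \<ominus> y) \<in> loc_ideal S contr"
    unfolding res_def using N.L.quotient_eq_iff_same_a_r_cos[OF loc_ideal_ideal q] by simp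
  also have "\<dots> \<longleftrightarrow> (\<exists>u\<in>carrier S - contr. u \<otimes> (x \<ominus> y) \<in> contr)"
    unfolding loc_ideal_eq using N.frac_loc_M_iff[OF _ N.D_one] assms by simp
  also have "\<dots> \<longleftrightarrow> x \<ominus> y \<in> contr"
  proof
    assume "\<exists>u\<in>carrier S - contr. u \<otimes> (x \<ominus> y) \<in> contr"
    then obtain u where "u \<in> carrier S - contr" "u \<otimes> (x \<ominus> y) \<in> contr" by blast
    then show "x \<ominus> y \<in> contr" using N.Mmax(3)[of u "x \<ominus> y"] assms by auto
  next
    assume "x \<ominus> y \<in> contr"
    then show "\<exists>u\<in>carrier S - contr. u \<otimes> (x \<ominus> y) \<in> contr" using N.D_one assms by (intro bexI[of _ \<one>]) simp_all
  qed
  finally show ?thesis .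
qed

text \<open>A denominator in R - M has an inverse modulo M in R itself, so fractions with numerator
  in R have the classes of elements of R.\<close>

lemma kappa_sub_eq: "kappa_sub R S M contr = res ` R"
proof
  show "res ` R \<subseteq> kappa_sub R S M contr" unfolding kappa_sub_def res_def using D_one by blast
  show "kappa_sub R S M contr \<subseteq> res ` R"
  proof
    fix y assume "y \<in> kappa_sub R S M contr"
    then obtain r s where y: "y = loc_ideal S contr +>\<^bsub>N.RB\<^esub> lfrac S (carrier S - contr) r s" "r \<in> R" "s \<in> R - M"
      unfolding kappa_sub_def by blast
    obtain q p where qp: "q \<in> R" "p \<in> M" "s \<otimes> q \<oplus> p = \<one>" using M_inverse[OF y(3)] .
    have "y = res (r \<otimes> q)" unfolding y(1)
      by (rule class_frac[where p = p]) (use y qp M_contr contr_Int in auto)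
    then show "y \<in> res ` R" using y(2) qp(1) RE(6) by blast
  qed
qed

lemma ring_hom_res: "ring_hom_ring S (kappa S contr) res"
  using res_hom ring_axioms cring.axioms(1)[OF kappa_cring] by (simp add: ring_hom_ringI2)

definition pre :: "('a \<times> 'a) set set set \<Rightarrow> 'a set"
  where "pre K = {x \<in> carrier S. res x \<in> K}"

lemma kappa_sub_subring: "subring (kappa_sub R S M contr) (kappa S contr)"
  unfolding kappa_sub_eq by (rule ring_hom_ring.img_is_subring[OF ring_hom_res R])

lemma res_num_interm:
  assumes "V \<in> interm (loc R) RB"
  shows "res ` num V \<in> interm (kappa_sub R S M contr) (kappa S contr)"
proof -
  note nV = num_interm[OF assms]
  show ?thesis unfolding kappa_sub_eq
    using ring_hom_ring.img_is_subring[OF ring_hom_res intermD(1)[OF nV]] intermD(2)[OF nV]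
    by (intro intermI) auto
qed

lemma pre_interm:
  assumes K: "K \<in> interm (kappa_sub R S M contr) (kappa S contr)"
  shows "pre K \<in> interm R S"
proof -
  interpret h: ring_hom_ring S "kappa S contr" res by (rule ring_hom_res)
  note KE = subringE[OF intermD(1)[OF K]]
  have RK: "R \<subseteq> pre K" using intermD(2)[OF K] by (auto simp: pre_def kappa_sub_eq)
  show ?thesis
  proof (rule intermI[OF subringI RK])
    show "\<one> \<in> pre K" using RK RE(3) by blast
  qed (use KE in \<open>auto simp: pre_def\<close>)
qed

lemma contr_num:
  assumes V: "V \<in> interm (loc R) RB" shows "contr \<subseteq> num V"
  using intermD(2)[OF V] loc_mono[OF ME(1)] unfolding contr_def num_def by blast

text \<open>If u x lies in \<open>pre K\<close> and r inverts u modulo M, then x and r (u x) have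
  the same class, so x lies in \<open>pre K\<close>.\<close>

lemma num_loc_pre:
  assumes K: "K \<in> interm (kappa_sub R S M contr) (kappa S contr)"
  shows "num (loc (pre K)) = pre K"
proof
  interpret h: ring_hom_ring S "kappa S contr" res by (rule ring_hom_res)
  note KE = subringE[OF intermD(1)[OF K]]
  note P = pre_interm[OF K]
  show "pre K \<subseteq> num (loc (pre K))" using loc_memI[OF _ D_one] by (auto simp: num_def pre_def)
  show "num (loc (pre K)) \<subseteq> pre K"
  proof
    fix x assume "x \<in> num (loc (pre K))"
    then obtain u where u: "x \<in> carrier S" "u \<in> R - M" "u \<otimes> x \<in> pre K"
      using loc_mem_iff[OF P _ D_one] by (auto simp: num_def)
    obtain r p where rp: "r \<in> R" "p \<in> M" "u \<otimes> r \<oplus> p = \<one>" using M_inverse[OF u(2)] .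
    have car [simp]: "x \<in> carrier S" "u \<in> carrier S" "r \<in> carrier S" "p \<in> carrier S" using u rp by auto
    have rux: "r \<otimes> (u \<otimes> x) \<in> pre K"
      using subringE(6)[OF intermD(1)[OF P]] intermD(2)[OF P] rp(1) u(3) by blast
    have "x \<ominus> r \<otimes> (u \<otimes> x) = (u \<otimes> r \<oplus> p) \<otimes> x \<ominus> r \<otimes> (u \<otimes> x)" unfolding rp(3) by simp
    also have "\<dots> = x \<otimes> p" using car by algebra
    also have "\<dots> \<in> contr" using ideal.I_l_closed[OF contr_ideal, of p x] rp(2) M_contr by auto
    finally have eq: "res x = res (r \<otimes> (u \<otimes> x))" by (intro iffD2[OF res_eq_iff]) simp_all
    have "res (r \<otimes> (u \<otimes> x)) \<in> K" using rux unfolding pre_def by blast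
    then have "res x \<in> K" by (simp only: eq)
    then show "x \<in> pre K" using u(1) unfolding pre_def by blast
  qed
qed

text \<open>Both lattices are compared through rings between R and S. Since \<open>num V\<close>
  contains \<open>contr\<close>, it is the full preimage of its image under \<open>res\<close>; and
  \<open>pre K\<close> is unchanged by localizing and contracting.\<close>

lemma kappa_boolean_iff:
  "boolean_ext (loc R) RB \<longleftrightarrow> boolean_ext (kappa_sub R S M contr) (kappa S contr)"
proof (rule boolean_order_iso[where f = "\<lambda>V. res ` num V" and g = "\<lambda>K. loc (pre K)"])
  show "cring RB" by (rule L.is_cring)
  show "subring (loc R) RB" by (rule loc_R_subring)
  show "cring (kappa S contr)" by (rule kappa_cring)
  show "subring (kappa_sub R S M contr) (kappa S contr)" by (rule kappa_sub_subring)
next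
  fix V assume V: "V \<in> interm (loc R) RB"
  note nV = num_interm[OF V]
  have "pre (res ` num V) = num V"
  proof
    show "num V \<subseteq> pre (res ` num V)" by (auto simp: pre_def num_def)
    show "pre (res ` num V) \<subseteq> num V"
    proof
      fix x assume "x \<in> pre (res ` num V)"
      then obtain y where y: "x \<in> carrier S" "y \<in> num V" "res x = res y" by (auto simp: pre_def)
      have yc: "y \<in> carrier S" using y(2) by (simp add: num_def)
      have "x \<ominus> y \<in> num V" using res_eq_iff[OF y(1) yc] y(3) contr_num[OF V] by blast
      then have "(x \<ominus> y) \<oplus> y \<in> num V" using subringE(7)[OF intermD(1)[OF nV]] y(2) by blast
      then show "x \<in> num V" using y(1) yc by (simp add: minus_eq a_assoc l_neg)
    qed
  qed
  then show "res ` num V \<in> interm (kappa_sub R S M contr) (kappa S contr) \<and> loc (pre (res ` num V)) = V"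
    using res_num_interm[OF V] loc_num[OF V] by simp
next
  fix K assume K: "K \<in> interm (kappa_sub R S M contr) (kappa S contr)"
  have "res ` pre K = K"
  proof
    show "res ` pre K \<subseteq> K" by (auto simp: pre_def)
    show "K \<subseteq> res ` pre K"
    proof
      fix y assume y: "y \<in> K"
      then have "y \<in> res ` carrier S" using intermD(3)[OF K] res_surj by blast
      then show "y \<in> res ` pre K" using y by (auto simp: pre_def)
    qed
  qed
  then show "loc (pre K) \<in> interm (loc R) RB \<and> res ` num (loc (pre K)) = K"
    using loc_interm[OF pre_interm[OF K]] num_loc_pre[OF K] by simp
next
  show "res ` num T \<subseteq> res ` num U" if "T \<subseteq> U" for T U using that by (auto simp: num_def)
  show "loc (pre T) \<subseteq> loc (pre U)" if "T \<subseteq> U" for T U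
    by (rule loc_mono) (use that in \<open>auto simp: pre_def\<close>)
qed

lemma kappa_sub_proper:
  assumes "loc R \<subset> carrier RB"
  shows "kappa_sub R S M contr \<subset> carrier (kappa S contr)"
proof -
  have "kappa_sub R S M contr \<noteq> carrier (kappa S contr)"
  proof
    assume e: "kappa_sub R S M contr = carrier (kappa S contr)"
    have "carrier RB \<subseteq> loc R"
    proof
      fix z assume "z \<in> carrier RB"
      then obtain x s where x: "x \<in> carrier S" "s \<in> R - M" "z = frac x s" by (rule loc_carrierE)
      have "res x \<in> res ` R" using e res_surj x(1) kappa_sub_eq by blast
      then obtain r where r: "r \<in> R" "res x = res r" by blast
      \<comment> \<open>x agrees with r modulo \<open>contr\<close>, so some u in R - M has u (x -
        r) in M and therefore u x in R.\<close>
      then have "x \<ominus> r \<in> contr" using res_eq_iff[OF x(1)] by simp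
      then obtain u where u: "u \<in> R - M" "u \<otimes> (x \<ominus> r) \<in> M" using contr_iff by blast
      have car [simp]: "x \<in> carrier S" "u \<in> carrier S" "r \<in> carrier S" using x u r by auto
      have "u \<otimes> (x \<ominus> r) \<oplus> u \<otimes> r \<in> R" using u r RE(6,7) by simp
      moreover have "u \<otimes> x = u \<otimes> (x \<ominus> r) \<oplus> u \<otimes> r" using car by algebra
      ultimately have "u \<otimes> x \<in> R" by simp
      then show "z \<in> loc R" unfolding x(3) using loc_mem_iff[OF interm_base[OF R] x(1,2)] u(1) by blast
    qed
    then show False using assms by blast
  qed
  then show ?thesis using subringE(1)[OF kappa_sub_subring] by blast
qed

end

section \<open>The local alternatives and the residue field criterion\<close>

context localized_subring
begin

lemma MSupp_proper:
  assumes "M \<in> MSupp R S"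
  shows "loc R \<subset> carrier RB"
proof -
  obtain x where x: "x \<in> carrier S" "\<forall>u\<in>R - M. u \<otimes> x \<notin> R" using assms MSupp_iff[OF R] by blast
  then have "frac x \<one> \<notin> loc R" using loc_mem_iff[OF interm_base[OF R] x(1) D_one] by blast
  moreover have "frac x \<one> \<in> carrier RB" by (rule loc_carrierI[OF x(1) D_one])
  ultimately show ?thesis using subringE(1)[OF loc_R_subring] by blast
qed

lemma boolean_locally_iff:
  assumes fip: "FIP R S" and proper: "loc R \<subset> carrier RB"
  shows "boolean_ext (loc R) RB \<longleftrightarrow>
    minimal_ext (loc R) RB \<or>
    (\<exists>U\<in>interm (loc R) RB. \<exists>T\<in>interm (loc R) RB.
      minimal_ramified (loc R) (RB\<lparr>carrier := T\<rparr>) \<and> minimal_decomposed (loc R) (RB\<lparr>carrier := U\<rparr>) \<and>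
      interm (loc R) RB = {loc R, T, U, carrier RB}) \<or>
    (loc R \<subset> carrier RB \<and> boolean_ext (loc R) RB \<and> t_closed (loc R) RB)"
  (is "?bool \<longleftrightarrow> ?min \<or> ?four \<or> ?t")
proof
  assume ?bool
  then show "?min \<or> ?four \<or> ?t"
    using LL.boolean_not_t_closed[OF _ loc_FIP[OF fip]] proper by blast
next
  assume "?min \<or> ?four \<or> ?t"
  then show ?bool
  proof (elim disjE)
    assume ?min
    then show ?bool by (rule L.minimal_boolean[OF loc_R_subring])
  next
    assume ?four
    then obtain U T where UT: "U \<in> interm (loc R) RB" "T \<in> interm (loc R) RB"
      "minimal_ramified (loc R) (RB\<lparr>carrier := T\<rparr>)" "minimal_decomposed (loc R) (RB\<lparr>carrier := U\<rparr>)"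
      and I: "interm (loc R) RB = {loc R, T, U, carrier RB}" by blast
    show ?bool
      by (rule L.four_element_boolean[OF loc_R_subring I LL.ramified_decomposed_incomparable[OF UT(2,1,3,4)]])
  qed blast
qed

lemma residual_if_t_closed:
  assumes fip: "FIP R S" and tc: "t_closed (loc R) RB" and abs: "LL.absorbs (carrier RB)"
  shows "residual_extension S R M"
proof (intro residual_extension.intro residual_extension_axioms.intro localized_subring_axioms abs)
  show "\<exists>w\<in>carrier RB. z \<otimes>\<^bsub>RB\<^esub> w = \<one>\<^bsub>RB\<^esub>" if "z \<in> carrier RB" "z \<notin> loc M" for z
    using LL.t_closed_units[OF tc loc_FIP[OF fip] L.interm_top[OF loc_R_subring] abs that] .
qed

text \<open>What has to be shown is that S_M absorbs the maximal ideal of R_M. If some N lies above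
  M, no element of that ideal becomes invertible and t-closedness gives absorption; otherwise the
  extension is not minimal and the Boolean property gives it. The assumption \<open>nontriv\<close>
  excludes cases such as Z localized at p inside Q, which is minimal and t-closed but has no N above
  M.\<close>

lemma boolean_t_closed_iff_kappa:
  assumes fip: "FIP R S" and proper: "loc R \<subset> carrier RB"
    and nontriv: "Max_above R S M \<noteq> {} \<or> \<not> minimal_ext (loc R) RB"
  shows "(loc R \<subset> carrier RB \<and> boolean_ext (loc R) RB \<and> t_closed (loc R) RB) \<longleftrightarrow>
    (loc R \<subset> carrier RB \<and> t_closed (loc R) RB \<and>
      (\<exists>N. Max_above R S M = {N} \<and> kappa_sub R S M N \<subset> carrier (kappa S N) \<and>
           boolean_ext (kappa_sub R S M N) (kappa S N)))"
proof (cases "t_closed (loc R) RB \<and> (boolean_ext (loc R) RB \<or> Max_above R S M \<noteq> {})")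
  \<comment> \<open>Both sides fail here: t-closedness is missing, or the extension is not Boolean
    and no N exists.\<close>
  case False
  then show ?thesis by auto
next
  case True
  have "LL.absorbs (carrier RB)"
  proof (cases "Max_above R S M = {}")
    case False
    then obtain N where "N \<in> Max_above R S M" by blast
    then show ?thesis
      using LL.t_closed_absorbs[OF _ loc_FIP[OF fip]] Max_above_noninvertible True by blast
  next
    case empty: True
    then show ?thesis
      using LL.boolean_absorbs[OF _ loc_FIP[OF fip] proper] True nontriv by blast
  qed
  then have "residual_extension S R M" using residual_if_t_closed[OF fip] True by blast
  then interpret residual_extension S R M .
  show ?thesis
    using Max_above_eq kappa_boolean_iff kappa_sub_proper[OF proper] True proper by auto
qed

end

theorem theorem3p29:
  fixes R :: "'a set" and S :: "('a, 'm) ring_scheme"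
  assumes "cring S" and "subring R S" and "R \<subset> carrier S" and "FIP R S"
  shows
    "(boolean_ext R S \<longleftrightarrow>
       (\<forall>M\<in>MSupp R S.
          minimal_ext (sub_at R S M) (ring_at R S M)
        \<or> (\<exists>U\<in>interm (sub_at R S M) (ring_at R S M).
           \<exists>T\<in>interm (sub_at R S M) (ring_at R S M).
             minimal_ramified (sub_at R S M) (ring_at R S M\<lparr>carrier := T\<rparr>) \<and>
             minimal_decomposed (sub_at R S M) (ring_at R S M\<lparr>carrier := U\<rparr>) \<and>
             interm (sub_at R S M) (ring_at R S M) =
               {sub_at R S M, T, U, carrier (ring_at R S M)})
        \<or> (sub_at R S M \<subset> carrier (ring_at R S M) \<and>
           boolean_ext (sub_at R S M) (ring_at R S M) \<and>
           t_closed (sub_at R S M) (ring_at R S M))))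
     \<and>
     (\<forall>M\<in>MSupp R S.
        Max_above R S M \<noteq> {} \<or> \<not> minimal_ext (sub_at R S M) (ring_at R S M) \<longrightarrow>
        ((sub_at R S M \<subset> carrier (ring_at R S M) \<and>
          boolean_ext (sub_at R S M) (ring_at R S M) \<and>
          t_closed (sub_at R S M) (ring_at R S M))
         \<longleftrightarrow>
         (sub_at R S M \<subset> carrier (ring_at R S M) \<and>
          t_closed (sub_at R S M) (ring_at R S M) \<and>
          (\<exists>N. Max_above R S M = {N} \<and>
               kappa_sub R S M N \<subset> carrier (kappa S N) \<and>
               boolean_ext (kappa_sub R S M N) (kappa S N)))))"
proof -
  interpret ambient_ring S using assms(1) by (rule ambient_ring.intro)
  have loc: "localized_subring S R M" "sub_at R S M \<subset> carrier (ring_at R S M)" if "M \<in> MSupp R S" for M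
    using MSupp_localized[OF assms(2) that] localized_subring.MSupp_proper[OF _ that] by blast+
  show ?thesis
    by (rule conjI, unfold boolean_iff_locally[OF assms(2,4)], rule ball_cong[OF refl],
        rule localized_subring.boolean_locally_iff[OF loc(1) assms(4) loc(2)], assumption+, intro ballI impI,
        rule localized_subring.boolean_t_closed_iff_kappa[OF loc(1) assms(4) loc(2)])
qed

end
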